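(* Let $x>0$. (i) If $q=e^{-\pi x/\sqrt{12}}$, then \[ \frac{F(1,1,1,x^2)}{(3+x^2)^2}=\frac{\pi^2}{24\sqrt3\,x}\operatorname{Im}\left(\int_0^{iq}\frac{f^9(-u^3)}{f^3(-u)}\,du\right). \] (ii) If $q=e^{-\pi x}$, then \[ F_{(1,2)}(x)=\frac{\pi^3}{32}-\frac{\pi^2}{16x}\int_0^q\frac{\varphi^2(-u)\varphi^4(u)-1}{u}\,du. \] (iii) If $q=e^{-\pi x/3}$ and $\rho=e^{2\pi i/3}$, then \[ F_{(1,4)}(x)=\frac{25\pi^2}{36x}\operatorname{Im}\left(\int_0^{\rho q}\varphi^2(u)\psi^4(u^2)\,du\right). \] (iv) If $q=e^{-\pi x/\sqrt8}$, then \[ F_{(2,2)}(x)=\frac{9\pi^2}{32\sqrt2\,x}\int_0^q\varphi(-u^2)\varphi(u^4)\left(3\psi^4(-u^2)-\psi^4(u^2)\right)du. \]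
   Context: Ramanujan's notation, for $|u|<1$: $\varphi(u)=\sum_{n=-\infty}^{\infty}u^{n^2}$, $\psi(u)=\sum_{n=0}^{\infty}u^{n(n+1)/2}$, $f(-u)=\prod_{n=1}^{\infty}(1-u^n)$ (so $f(-u^3)=\prod_{n\ge1}(1-u^{3n})$). Integrals from $0$ to a point $w$ in the unit disc are along the straight segment. For positive reals $a,b,c,d$, \[ F(a,b,c,d):=(a+b+c+d)^2\sum_{n_i=-\infty}^{\infty}\frac{(-1)^{n_1+n_2+n_3+n_4}}{\left(a(6n_1+1)^2+b(6n_2+1)^2+c(6n_3+1)^2+d(6n_4+1)^2\right)^2}, \] summed as $\lim_{v\to\infty}\sum_{n_1=-v}^{v}\cdots\sum_{n_4=-v}^{v}$. For $x>0$: $F_{(1,2)}(x):=\sum_{n=-\infty}^{\infty}\sum_{k=0}^{\infty}\frac{(-1)^{n+k}(2k+1)}{((2k+1)^2+x^2(2n)^2)^2}$, $F_{(1,4)}(x):=25\sum_{n,k=-\infty}^{\infty}\frac{(-1)^n(3k+1)}{(4(3k+1)^2+x^2(6n+1)^2)^2}$, $F_{(2,2)}(x):=9\sum_{n,k=0}^{\infty}\frac{(-1)^{n(n+1)/2+k}(2k+1)}{(2(2k+1)^2+x^2(2n+1)^2)^2}$.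
   Formalization: In part (ii) the coefficient π²/(16x) is replaced by π²/(32x): the printed value is false, since as x→∞ F_(1,2)(x) = π³/32 − (π²/(8x))e^{−πx} + lower order while the integral is 4e^{−πx} + lower order. *)

theory Defs
  imports "HOL-Complex_Analysis.Complex_Analysis"
begin

text \<open>Ramanujan's theta functions and product; all of them converge for \<open>norm u < 1\<close>.\<close>

definition ram_phi :: "complex \<Rightarrow> complex" where
  "ram_phi u = (\<Sum>\<^sub>\<infinity>n::int. u ^ nat (n\<^sup>2))"

definition ram_psi :: "complex \<Rightarrow> complex" where
  "ram_psi u = (\<Sum>n. u ^ (n * (n + 1) div 2))"

text \<open>The sign is chosen so that \<open>ram_f (- u)\<close> is the product of \<open>1 - u ^ n\<close> over \<open>n \<ge> 1\<close>.\<close>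

definition ram_f :: "complex \<Rightarrow> complex" where
  "ram_f v = (\<Prod>n. 1 - (- v) ^ Suc n)"

text \<open>The four-fold series is not absolutely convergent: it is the limit of the sums over the
  cubes \<open>{-v..v}\<close>.\<close>

definition lattice_F :: "real \<Rightarrow> real \<Rightarrow> real \<Rightarrow> real \<Rightarrow> real" where
  "lattice_F a b c d = (a + b + c + d)\<^sup>2 *
     lim (\<lambda>v::nat.
       \<Sum>n1 = - int v..int v. \<Sum>n2 = - int v..int v. \<Sum>n3 = - int v..int v. \<Sum>n4 = - int v..int v.
         (-1) powi (n1 + n2 + n3 + n4) /
         (a * (6 * real_of_int n1 + 1)\<^sup>2 + b * (6 * real_of_int n2 + 1)\<^sup>2 +
          c * (6 * real_of_int n3 + 1)\<^sup>2 + d * (6 * real_of_int n4 + 1)\<^sup>2)\<^sup>2)"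

text \<open>For \<open>x > 0\<close> the following double series converge absolutely: the terms are of size
  \<open>r powr (-3)\<close> on a two-dimensional lattice. The order of summation is thus immaterial.\<close>

definition F12 :: "real \<Rightarrow> real" where
  "F12 x = (\<Sum>\<^sub>\<infinity>(n, k) \<in> (UNIV :: int set) \<times> (UNIV :: nat set).
     (-1) powi (n + int k) * (2 * real k + 1) /
     ((2 * real k + 1)\<^sup>2 + x\<^sup>2 * (2 * real_of_int n)\<^sup>2)\<^sup>2)"

definition F14 :: "real \<Rightarrow> real" where
  "F14 x = 25 * (\<Sum>\<^sub>\<infinity>(n, k) \<in> (UNIV :: int set) \<times> (UNIV :: int set).
     (-1) powi n * (3 * real_of_int k + 1) /
     (4 * (3 * real_of_int k + 1)\<^sup>2 + x\<^sup>2 * (6 * real_of_int n + 1)\<^sup>2)\<^sup>2)"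

definition F22 :: "real \<Rightarrow> real" where
  "F22 x = 9 * (\<Sum>\<^sub>\<infinity>(n, k) \<in> (UNIV :: nat set) \<times> (UNIV :: nat set).
     (-1) ^ (n * (n + 1) div 2 + k) * (2 * real k + 1) /
     (2 * (2 * real k + 1)\<^sup>2 + x\<^sup>2 * (2 * real n + 1)\<^sup>2)\<^sup>2)"

text \<open>These functions enter the identities with contour integrals over \<open>linepath 0 w\<close>. In the case of
  \<open>F12\<close> the integrand is \<open>((ram_phi (- u))\<^sup>2 * ram_phi u ^ 4 - 1) / u\<close>, whose value at the
  endpoint \<open>u = 0\<close> does not affect the integral. Its coefficient is \<open>pi\<^sup>2 / (32 * x)\<close>; the source
  prints \<open>16\<close> in place of \<open>32\<close>, which is a misprint. Indeed, summing over \<open>k\<close> first and keeping the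
  terms with \<open>n\<close> in \<open>{-1, 0, 1}\<close> shows that \<open>F12 x\<close> is \<open>pi ^ 3 / 32 - pi\<^sup>2 / (8 * x) * exp (- pi * x)\<close>
  up to lower order as \<open>x\<close> tends to infinity, while the integrand equals \<open>4 + O(u)\<close>, so that the
  integral is \<open>4 * exp (- pi * x)\<close> up to lower order.\<close>

end

theory Submission
  imports Defs "HOL-Real_Asymp.Real_Asymp"
begin

text \<open>Each integrand, multiplied by \<open>u\<close>, is a Lambert series \<open>\<Sum>j. c j * K (u ^ j)\<close> with a periodic
  coefficient \<open>c\<close>. This is a statement about a single theta function \<open>T\<close>: by Liouville's theorem the
  quotient of two sides with the same quasi-periods and zeros is constant, which yields the addition formula of
  \<open>(log T)''\<close> (that is, of the Weierstrass function) and, upon differentiation, the expansion of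
  \<open>T (2 * z) / T z ^ 4\<close> as a bilateral series. Parts (i), (ii) and (iii) take \<open>z\<close> at division points.
  Part (iv) needs the second derivative of a quotient of two theta functions instead.

  Integrating termwise replaces \<open>c j\<close> by \<open>c j / j\<close> and \<open>K\<close> by an elementary function whose values at
  \<open>exp (- y)\<close> times a root of unity are, by the partial fractions of \<open>1 / sin\<^sup>2\<close>, the row
  sums of the double series.

  For part (i) the sum over a cube is the Laplace transform of a product of four partial theta sums. These
  are bounded by \<open>exp (- t)\<close> since they alternate, so dominated convergence gives the limit over the cubes.
  Three of the factors form the cube of Euler's product, which Jacobi's identity expands into a simple
  series, so that a double series remains.\<close>

section \<open>q-Pochhammer symbols\<close>

text \<open>The complex end points come from the signs of the lattice sums. The integrands of (i)
  and (iii) carry only a character modulo 3 or modulo 4. Taking the imaginary part at \<i> q or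
  \<rho> q supplies the other one, since powers of the root of unity are real or conjugate in pairs,
  and the product is the character modulo 12 whose value at |6n + 1| is (-1)^n. In (ii) and (iv) the
  end point is real, so \<i> is built into the kernel \<open>odd_li1\<close> instead. Part (iv) is
  harder because its character modulo 8 combines four bilateral series at points differing by half
  periods, and their sum is not a single quotient T(2z) / T(z)^4. It is, however, the second
  derivative of an alternating sum \<open>alt\<close> that does have a simple product form G. Then
  G'' = G (\<Phi>^2 + \<Phi>') with \<Phi> = G' / G, and the addition formula evaluates both \<Phi>
  and \<Phi>'; quadratic and quartic identities between \<open>ram_phi\<close> and
  \<open>ram_psi\<close> bring the result to the stated integrand.\<close>

lemma has_field_derivative_series_compose:
  fixes K :: "complex \<Rightarrow> complex" and \<phi> :: "nat \<Rightarrow> complex \<Rightarrow> complex" and c :: "nat \<Rightarrow> complex"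
  assumes K: "K holomorphic_on S" "open S" "0 \<in> S" "K 0 = 0"
    and \<phi>: "\<And>k. \<phi> k holomorphic_on U" "open U" "z \<in> U" "\<And>k. \<phi> k z \<in> S"
    and M: "\<And>k u. u \<in> U \<Longrightarrow> norm (\<phi> k u) \<le> M k" "summable M"
    and c: "\<And>k. norm (c k) \<le> C"
  shows "summable (\<lambda>k. c k * K (\<phi> k z))"
    and "summable (\<lambda>k. c k * (deriv (\<phi> k) z * deriv K (\<phi> k z)))"
    and "((\<lambda>u. \<Sum>k. c k * K (\<phi> k u)) has_field_derivative
           (\<Sum>k. c k * (deriv (\<phi> k) z * deriv K (\<phi> k z)))) (at z)"
proof -
  have "(K has_field_derivative deriv K 0) (at 0)"
    using K holomorphic_derivI by blast
  hence "((\<lambda>v. (K v - K 0) / (v - 0)) \<longlongrightarrow> deriv K 0) (at 0)"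
    by (simp add: has_field_derivative_iff)
  hence "eventually (\<lambda>v. norm (K v / v) < norm (deriv K 0) + 1) (at 0)"
    using K(4) by (intro order_tendstoD(2)[of "\<lambda>v. norm (K v / v)" "norm (deriv K 0)"] tendsto_norm) auto
  then obtain d1 where d1: "d1 > 0" "\<And>v. v \<noteq> 0 \<Longrightarrow> norm v < d1 \<Longrightarrow> norm (K v / v) < norm (deriv K 0) + 1"
    unfolding eventually_at by auto
  obtain d2 where d2: "d2 > 0" "ball 0 d2 \<subseteq> S"
    using K by (meson openE)
  define d where "d = min d1 d2"
  define B where "B = norm (deriv K 0) + 1"
  have d: "d > 0" using d1 d2 by (simp add: d_def)
  have dS: "v \<in> S" if "norm v < d" for v
    using d2 that by (auto simp: d_def)
  \<comment> \<open>\<open>K\<close> vanishes at 0, hence is at most linear there. This turns the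
    summable bound \<open>M\<close> on the arguments into a summable bound on the terms.\<close>
  have KB: "norm (K v) \<le> B * norm v" if "norm v < d" for v
  proof (cases "v = 0")
    case False
    hence "norm (K v / v) < B" using d1(2)[of v] that by (simp add: d_def B_def)
    thus ?thesis using False by (simp add: norm_divide field_simps)
  qed (use K(4) in auto)
  have "M \<longlonglongrightarrow> 0" by (rule summable_LIMSEQ_zero) fact
  hence "eventually (\<lambda>k. M k < d) sequentially" using d by (rule order_tendstoD)
  then obtain k0 where k0: "\<And>k. k \<ge> k0 \<Longrightarrow> M k < d" by (auto simp: eventually_at_top_linorder)
  \<comment> \<open>Membership in \<open>S\<close> is assumed at \<open>z\<close> only. The first
    \<open>k0\<close> arguments force the neighbourhood to shrink; all later ones lie near 0 on the
    whole of \<open>U\<close>.\<close>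
  define V where "V = U \<inter> (\<Inter>k\<in>{..<k0}. U \<inter> \<phi> k -` S)"
  have "open (U \<inter> \<phi> k -` S)" for k
    using \<phi>(1)[of k] K(2) \<phi>(2) by (intro continuous_open_preimage holomorphic_on_imp_continuous_on)
  hence "open V" unfolding V_def using \<phi>(2) by (intro open_Int open_INT) auto
  hence V: "open V" "z \<in> V" "V \<subseteq> U" unfolding V_def using \<phi> by auto
  have VS: "\<phi> k u \<in> S" if "u \<in> V" for k u
  proof (cases "k < k0")
    case False
    hence "M k < d" using k0 by auto
    thus ?thesis using M(1)[of u k] that V by (intro dS) auto
  qed (use that in \<open>auto simp: V_def split: if_splits\<close>)
  define f where "f = (\<lambda>n u. \<Sum>k<n. c k * K (\<phi> k u))"
  define g where "g = (\<lambda>u. \<Sum>k. c k * K (\<phi> k u))"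
  have C0: "C \<ge> 0" using c[of 0] norm_ge_zero order_trans by blast
  have ul: "uniform_limit V f g sequentially"
    unfolding f_def g_def
  proof (rule Weierstrass_m_test_ev)
    show "summable (\<lambda>k. C * (B * M k))" using M by (intro summable_mult)
    show "\<forall>\<^sub>F k in sequentially. \<forall>u\<in>V. norm (c k * K (\<phi> k u)) \<le> C * (B * M k)"
      using eventually_ge_at_top[of k0]
    proof eventually_elim
      case (elim k)
      show ?case
      proof
        fix u assume u: "u \<in> V"
        have "norm (\<phi> k u) \<le> M k" using M u V by auto
        moreover have "norm (K (\<phi> k u)) \<le> B * norm (\<phi> k u)"
          using k0[OF elim] calculation by (intro KB) auto
        moreover have "B \<ge> 0" by (simp add: B_def)
        ultimately have "norm (K (\<phi> k u)) \<le> B * M k" by (meson mult_left_mono order_trans)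
        thus "norm (c k * K (\<phi> k u)) \<le> C * (B * M k)"
          unfolding norm_mult by (intro mult_mono c C0) auto
      qed
    qed
  qed
  have hol\<phi>: "\<phi> k holomorphic_on V" for k using \<phi> V holomorphic_on_subset by blast
  have holK: "(\<lambda>u. K (\<phi> k u)) holomorphic_on V" for k
    using VS by (intro holomorphic_on_compose_gen[OF hol\<phi> K(1), unfolded o_def]) auto
  have holf: "f n holomorphic_on V" for n
    unfolding f_def by (intro holomorphic_intros holK)
  have holg: "g holomorphic_on V"
  proof (rule holomorphic_uniform_sequence[OF V(1) holf])
    fix x assume x: "x \<in> V"
    then obtain e where "e > 0" "cball x e \<subseteq> V" using V(1) open_contains_cball by blast
    thus "\<exists>d>0. cball x d \<subseteq> V \<and> uniform_limit (cball x d) f g sequentially"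
      using uniform_limit_on_subset[OF ul] by blast
  qed
  have "(\<lambda>n. f n z) \<longlonglongrightarrow> g z" by (rule tendsto_uniform_limitI[OF ul V(2)])
  hence s: "(\<lambda>k. c k * K (\<phi> k z)) sums g z" unfolding sums_def f_def .
  thus "summable (\<lambda>k. c k * K (\<phi> k z))" by (simp add: sums_iff)
  have df: "deriv (f n) z = (\<Sum>k<n. c k * (deriv (\<phi> k) z * deriv K (\<phi> k z)))" for n
  proof (rule DERIV_imp_deriv)
    have "(\<phi> k has_field_derivative deriv (\<phi> k) z) (at z)" for k
      using hol\<phi> V holomorphic_derivI by blast
    moreover have "(K has_field_derivative deriv K (\<phi> k z)) (at (\<phi> k z))" for k
      using K \<phi>(4) holomorphic_derivI by blast
    ultimately have "((\<lambda>u. K (\<phi> k u)) has_field_derivative deriv (\<phi> k) z * deriv K (\<phi> k z)) (at z)" for k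
      by (metis DERIV_chain2 mult.commute)
    thus "(f n has_field_derivative (\<Sum>k<n. c k * (deriv (\<phi> k) z * deriv K (\<phi> k z)))) (at z)"
      unfolding f_def by (auto intro!: derivative_eq_intros simp: mult_ac)
  qed
  have "(\<lambda>n. deriv (f n) z) \<longlonglongrightarrow> deriv g z"
    by (rule deriv_complex_uniform_limit[OF ul _ _ V(1,2)]) (use holf in auto)
  hence s': "(\<lambda>k. c k * (deriv (\<phi> k) z * deriv K (\<phi> k z))) sums deriv g z"
    unfolding df sums_def .
  thus "summable (\<lambda>k. c k * (deriv (\<phi> k) z * deriv K (\<phi> k z)))" by (simp add: sums_iff)
  have "(g has_field_derivative deriv g z) (at z)"
    using holg V holomorphic_derivI by blast
  thus "((\<lambda>u. \<Sum>k. c k * K (\<phi> k u)) has_field_derivative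
           (\<Sum>k. c k * (deriv (\<phi> k) z * deriv K (\<phi> k z)))) (at z)"
    using s' by (simp add: sums_iff g_def)
qed

definition qpoch :: "complex \<Rightarrow> complex \<Rightarrow> complex" where
  "qpoch a q = (\<Prod>n. 1 - a * q ^ n)"

lemma convergent_qpoch:
  fixes a q :: complex
  assumes "norm q < 1"
  shows "convergent_prod (\<lambda>n. 1 - a * q ^ n)"
  by (intro abs_convergent_prod_imp_convergent_prod summable_imp_abs_convergent_prod)
    (use assms in \<open>simp add: norm_mult norm_power summable_mult summable_geometric\<close>)

lemma has_prod_qpoch: "norm q < 1 \<Longrightarrow> (\<lambda>n. 1 - a * q ^ n) has_prod qpoch a q"
  unfolding qpoch_def by (intro convergent_prod_has_prod convergent_qpoch)

lemma qpoch_LIMSEQ: "norm q < 1 \<Longrightarrow> (\<lambda>N. \<Prod>n<N. 1 - a * q ^ n) \<longlonglongrightarrow> qpoch a q"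
  using has_prod_imp_tendsto'[OF has_prod_qpoch] .

text \<open>Uniformity in \<open>a\<close> on discs makes the product holomorphic in its first
  argument and its logarithmic derivative a termwise sum.\<close>

lemma uniform_limit_qpoch:
  assumes "norm q < 1"
  shows "uniform_limit (cball 0 R) (\<lambda>N a. \<Prod>n<N. 1 - a * q ^ n) (\<lambda>a. qpoch a q) sequentially"
proof -
  have "uniformly_convergent_on (cball 0 R) (\<lambda>N a. \<Prod>n<N. 1 + (- a * q ^ n))"
  proof (rule uniformly_convergent_on_prod)
    show "uniformly_convergent_on (cball 0 R) (\<lambda>N a. \<Sum>n<N. norm (- a * q ^ n))"
    proof (rule Weierstrass_m_test')
      show "summable (\<lambda>n. R * norm q ^ n)"
        using assms by (intro summable_mult summable_geometric) auto
      fix n a assume "a \<in> cball (0::complex) R"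
      thus "norm (norm (- a * q ^ n)) \<le> R * norm q ^ n"
        by (auto simp: norm_mult norm_power intro!: mult_right_mono)
    qed
  qed (auto intro!: continuous_intros)
  then obtain l where l: "uniform_limit (cball 0 R) (\<lambda>N a. \<Prod>n<N. 1 + (- a * q ^ n)) l sequentially"
    by (auto simp: uniformly_convergent_on_def)
  have "l a = qpoch a q" if "a \<in> cball 0 R" for a
    using tendsto_uniform_limitI[OF l that] qpoch_LIMSEQ[OF assms, of a] LIMSEQ_unique by simp blast
  thus ?thesis using l by (subst uniform_limit_cong'[where g = "\<lambda>N a. \<Prod>n<N. 1 + (- a * q ^ n)" and i = l]) auto
qed

lemma holomorphic_qpoch: "norm q < 1 \<Longrightarrow> (\<lambda>a. qpoch a q) holomorphic_on UNIV"
proof (rule holomorphic_uniform_sequence[where f = "\<lambda>N a. \<Prod>n<N. 1 - a * q ^ n"])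
  fix x :: complex assume q: "norm q < 1"
  have "cball x 1 \<subseteq> cball 0 (norm x + 1)" by (simp add: cball_subset_cball_iff)
  thus "\<exists>d>0. cball x d \<subseteq> UNIV \<and>
     uniform_limit (cball x d) (\<lambda>N a. \<Prod>n<N. 1 - a * q ^ n) (\<lambda>a. qpoch a q) sequentially"
    using uniform_limit_on_subset[OF uniform_limit_qpoch[OF q]] by (intro exI[of _ 1]) auto
qed (auto intro!: holomorphic_intros)

lemma qpoch_holomorphic [holomorphic_intros]:
  "norm q < 1 \<Longrightarrow> f holomorphic_on A \<Longrightarrow> (\<lambda>z. qpoch (f z) q) holomorphic_on A"
  using holomorphic_on_compose_gen[OF _ holomorphic_qpoch, of f A q] by (simp add: o_def)

lemma qpoch_eq_0_iff: "norm q < 1 \<Longrightarrow> qpoch a q = 0 \<longleftrightarrow> (\<exists>n. a * q ^ n = 1)"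
  using has_prod_eq_0_iff[OF has_prod_qpoch] by (auto simp: image_iff) 

lemma qpoch_shift: 
  assumes "norm q < 1"
  shows "qpoch a q = (1 - a) * qpoch (a * q) q"
proof (rule LIMSEQ_unique)
  show "(\<lambda>N. \<Prod>n<Suc N. 1 - a * q ^ n) \<longlonglongrightarrow> qpoch a q"
    using qpoch_LIMSEQ[OF assms] by (rule LIMSEQ_Suc)
  have "(\<lambda>N. \<Prod>n<Suc N. 1 - a * q ^ n) = (\<lambda>N. (1 - a) * (\<Prod>n<N. 1 - a * q * q ^ n))"
    by (subst prod.lessThan_Suc_shift) (simp add: mult_ac)
  thus "(\<lambda>N. \<Prod>n<Suc N. 1 - a * q ^ n) \<longlonglongrightarrow> (1 - a) * qpoch (a * q) q"
    using tendsto_mult_left[OF qpoch_LIMSEQ[OF assms, of "a * q"], of "1 - a"] by simp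
qed

text \<open>The factors are grouped by the residue of the exponent modulo \<open>m\<close>.\<close>

lemma qpoch_split:
  assumes "norm q < 1" "m > 0"
  shows "qpoch a q = (\<Prod>i<m. qpoch (a * q ^ i) (q ^ m))"
proof (rule LIMSEQ_unique)
  have "strict_mono (\<lambda>N. m * N)" using assms by (simp add: strict_mono_def)
  thus "(\<lambda>N. \<Prod>n<m*N. 1 - a * q ^ n) \<longlonglongrightarrow> qpoch a q"
    using LIMSEQ_subseq_LIMSEQ[OF qpoch_LIMSEQ[OF assms(1)], of "\<lambda>N. m * N" a] by (simp add: o_def)
  have "(\<Prod>n<m*N. 1 - a * q ^ n) = (\<Prod>i<m. \<Prod>n<N. 1 - a * q ^ i * (q ^ m) ^ n)" for N
  proof (induction N)
    case (Suc N)
    have "(\<Prod>n<m * Suc N. 1 - a * q ^ n) = (\<Prod>n<m*N. 1 - a * q ^ n) * (\<Prod>n=m*N..<m*N+m. 1 - a * q ^ n)"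
      by (simp add: lessThan_atLeast0 prod.atLeastLessThan_concat add.commute)
    also have "(\<Prod>n=m*N..<m*N+m. 1 - a * q ^ n) = (\<Prod>i<m. 1 - a * q ^ (i + m*N))"
      using prod.shift_bounds_nat_ivl[of "\<lambda>n. 1 - a * q ^ n" 0 "m*N" m] by (simp add: lessThan_atLeast0 add.commute)
    also have "\<dots> = (\<Prod>i<m. 1 - a * q ^ i * (q ^ m) ^ N)"
      by (intro prod.cong) (simp_all add: power_add power_mult mult.assoc)
    finally show ?case
      by (simp only: Suc.IH prod.distrib prod.lessThan_Suc)
  qed auto
  moreover have "norm (q ^ m) < 1" using assms by (simp add: norm_power power_less_one_iff)
  ultimately show "(\<lambda>N. \<Prod>n<m*N. 1 - a * q ^ n) \<longlonglongrightarrow> (\<Prod>i<m. qpoch (a * q ^ i) (q ^ m))"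
    by (auto intro!: tendsto_prod qpoch_LIMSEQ)
qed

lemma qpoch_split2:
  assumes "norm q < 1"
  shows "qpoch a q = qpoch a (q\<^sup>2) * qpoch (a * q) (q\<^sup>2)"
  using qpoch_split[OF assms, of 2 a] by (simp add: numeral_2_eq_2)

text \<open>Factor by factor this is a difference of squares.\<close>

lemma qpoch_mult_minus:
  assumes "norm q < 1"
  shows "qpoch a q * qpoch (- a) q = qpoch (a\<^sup>2) (q\<^sup>2)"
proof (rule LIMSEQ_unique)
  show "(\<lambda>N. (\<Prod>n<N. 1 - a * q ^ n) * (\<Prod>n<N. 1 - (- a) * q ^ n)) \<longlonglongrightarrow> qpoch a q * qpoch (- a) q"
    by (intro tendsto_mult qpoch_LIMSEQ assms)
  have "norm (q\<^sup>2) < 1" using assms by (simp add: norm_power power_less_one_iff)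
  from qpoch_LIMSEQ[OF this, of "a\<^sup>2"]
  show "(\<lambda>N. (\<Prod>n<N. 1 - a * q ^ n) * (\<Prod>n<N. 1 - (- a) * q ^ n)) \<longlonglongrightarrow> qpoch (a\<^sup>2) (q\<^sup>2)"
    by (simp add: prod.distrib[symmetric] algebra_simps power2_eq_square power_mult_distrib)
qed

lemma qpoch_logderiv:
  assumes "norm q < 1" "qpoch a q \<noteq> 0"
  shows "(\<lambda>k. - (q ^ k) / (1 - a * q ^ k)) sums (deriv (\<lambda>a. qpoch a q) a / qpoch a q)"
proof -
  have "uniform_limit (ball 0 (norm a + 1)) (\<lambda>N a. \<Prod>n<N. 1 - a * q ^ n) (\<lambda>a. qpoch a q) sequentially"
    by (rule uniform_limit_on_subset[OF uniform_limit_qpoch[OF assms(1)] ball_subset_cball])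
  hence "(\<lambda>k. deriv (\<lambda>a. 1 - a * q ^ k) a / (1 - a * q ^ k)) sums (deriv (\<lambda>a. qpoch a q) a / qpoch a q)"
    by (rule logderiv_prodinf_complex_uniform_limit) (use assms in \<open>auto intro!: holomorphic_intros\<close>)
  moreover have "deriv (\<lambda>a. 1 - a * q ^ k) a = - (q ^ k)" for k
    by (rule DERIV_imp_deriv) (auto intro!: derivative_eq_intros)
  ultimately show ?thesis by simp
qed

section \<open>Theta functions and their addition formula\<close>

text \<open>Jacobi's theta function as a product, without the factor \<open>qpoch q q\<close> that
  the triple product carries.\<close>

definition theta :: "complex \<Rightarrow> complex \<Rightarrow> complex" where
  "theta x q = qpoch x q * qpoch (q / x) q"

definition Theta :: "complex \<Rightarrow> complex \<Rightarrow> complex" where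
  "Theta q z = theta (exp z) q"

text \<open>Equivalences are assumed rather than implications, so that the induction also runs
  towards negative multiples.\<close>

lemma lattice_induct:
  fixes s t :: complex
  assumes "\<And>z. P z \<longleftrightarrow> P (z + s)" "\<And>z. P z \<longleftrightarrow> P (z + t)"
  shows "P (z + of_int k * s + of_int m * t) \<longleftrightarrow> P z"
proof -
  have "P (z + of_int k * s) \<longleftrightarrow> P z" for z
  proof (induction k rule: int_induct[where k = 0])
    case (step1 i)
    thus ?case using assms(1)[of "z + of_int i * s"] by (simp add: algebra_simps)
  next
    case (step2 i)
    thus ?case using assms(1)[of "z + of_int (i - 1) * s"] by (simp add: algebra_simps)
  qed auto
  moreover have "P (z + of_int m * t) \<longleftrightarrow> P z" for z
  proof (induction m rule: int_induct[where k = 0])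
    case (step1 i)
    thus ?case using assms(2)[of "z + of_int i * t"] by (simp add: algebra_simps)
  next
    case (step2 i)
    thus ?case using assms(2)[of "z + of_int (i - 1) * t"] by (simp add: algebra_simps)
  qed auto
  ultimately show ?thesis by (metis add.assoc)
qed

text \<open>Fixing a logarithm of \<open>q\<close> fixes the quasi-period \<open>\<omega>\<close>
  and, through \<open>\<omega> / 2\<close>, a square root of \<open>q\<close>.\<close>

locale nome =
  fixes q \<omega> :: complex
  assumes exp_\<omega>: "exp \<omega> = q" and lt1: "norm q < 1"
begin

lemma nz: "q \<noteq> 0"
  using exp_\<omega> exp_not_eq_zero by blast

lemma theta_mult_q: "x \<noteq> 0 \<Longrightarrow> theta (q * x) q = - theta x q / x"
  unfolding theta_def using nz
  by (simp add: qpoch_shift[OF lt1, of x] qpoch_shift[OF lt1, of "1 / x"] field_simps)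

lemma theta_inverse: "x \<noteq> 0 \<Longrightarrow> theta (1 / x) q = - theta x q / x"
  unfolding theta_def using nz
  by (simp add: qpoch_shift[OF lt1, of x] qpoch_shift[OF lt1, of "1 / x"] field_simps)

lemma theta_q_div: "x \<noteq> 0 \<Longrightarrow> theta (q / x) q = theta x q"
proof -
  assume "x \<noteq> 0"
  have "q / (q / x) = x" using nz by (simp add: field_simps)
  thus ?thesis by (metis theta_def mult.commute)
qed

lemma power_ne_1: "q ^ Suc n \<noteq> 1"
proof
  assume "q ^ Suc n = 1"
  hence "norm q ^ Suc n = 1" by (metis norm_one norm_power)
  moreover have "norm q ^ Suc n < 1" using lt1 nz by (intro power_Suc_less_one) auto
  ultimately show False by simp
qed

lemma qpoch_q_nonzero: "qpoch q q \<noteq> 0"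
  using power_ne_1 by (simp add: qpoch_eq_0_iff[OF lt1])

text \<open>The first factor of \<open>theta\<close> contributes the powers with k \<le> 0, the
  second those with k > 0.\<close>

lemma theta_eq_0_iff:
  assumes "x \<noteq> 0"
  shows "theta x q = 0 \<longleftrightarrow> (\<exists>k::int. x = q powi k)"
proof
  assume "theta x q = 0"
  then consider n where "x * q ^ n = 1" | n where "q / x * q ^ n = 1"
    by (auto simp: theta_def qpoch_eq_0_iff[OF lt1])
  thus "\<exists>k::int. x = q powi k"
  proof cases
    case 1
    hence "x = q powi (- int n)" using nz by (simp add: power_int_minus field_simps)
    thus ?thesis by blast
  next
    case 2
    hence "x = q powi (int (Suc n))" using assms by (simp add: field_simps del: of_nat_Suc)
    thus ?thesis by blast
  qed
next
  assume "\<exists>k::int. x = q powi k"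
  then obtain k :: int where k: "x = q powi k" by blast
  show "theta x q = 0"
  proof (cases "k \<le> 0")
    case True
    hence "x * q ^ nat (- k) = 1" using nz k by (simp add: power_int_def power_inverse)
    thus ?thesis by (auto simp: theta_def qpoch_eq_0_iff[OF lt1])
  next
    case False
    then obtain n where "k = int (Suc n)" by (metis not_le zero_less_imp_eq_int gr0_implies_Suc of_nat_0_less_iff)
    hence "q / x * q ^ n = 1" using nz k by (simp add: field_simps del: of_nat_Suc)
    thus ?thesis by (auto simp: theta_def qpoch_eq_0_iff[OF lt1])
  qed
qed

abbreviation T :: "complex \<Rightarrow> complex" where "T \<equiv> Theta q"
abbreviation T' :: "complex \<Rightarrow> complex" where "T' \<equiv> deriv (Theta q)"
abbreviation T'' :: "complex \<Rightarrow> complex" where "T'' \<equiv> deriv (deriv (Theta q))"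
abbreviation \<tau> :: complex where "\<tau> \<equiv> 2 * complex_of_real pi * \<i>"

lemma exp_\<tau> [simp]: "exp \<tau> = 1"
  using exp_two_pi_i by simp

lemma exp_add_\<tau> [simp]: "exp (z + \<tau>) = exp z"
  by (simp only: exp_add exp_\<tau>) simp

lemma T_eq: "T = (\<lambda>z. qpoch (exp z) q * qpoch (q * exp (- z)) q)"
  by (auto simp: Theta_def theta_def exp_minus field_simps)

lemma holomorphic_T: "T holomorphic_on A"
  unfolding T_eq using lt1 by (intro holomorphic_intros) auto

lemma holomorphic_T': "T' holomorphic_on A"
  by (rule holomorphic_on_subset[of _ UNIV], rule holomorphic_deriv[OF holomorphic_T]) auto

lemma holomorphic_T'': "T'' holomorphic_on A"
  by (rule holomorphic_on_subset[of _ UNIV], rule holomorphic_deriv[OF holomorphic_T']) auto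

lemma DERIV_T [derivative_intros]:
  "(f has_field_derivative f') (at z within S) \<Longrightarrow>
     ((\<lambda>z. T (f z)) has_field_derivative T' (f z) * f') (at z within S)"
  by (rule DERIV_chain2[OF holomorphic_derivI[OF holomorphic_T[of UNIV]]]) auto

lemma DERIV_T' [derivative_intros]:
  "(f has_field_derivative f') (at z within S) \<Longrightarrow>
     ((\<lambda>z. T' (f z)) has_field_derivative T'' (f z) * f') (at z within S)"
  by (rule DERIV_chain2[OF holomorphic_derivI[OF holomorphic_T'[of UNIV]]]) auto

lemma T_add_\<tau>: "T (z + \<tau>) = T z"
  by (simp add: Theta_def)

lemma T_add_\<omega>: "T (z + \<omega>) = - exp (- z) * T z"
  using theta_mult_q[of "exp z"] nz by (simp add: Theta_def exp_add exp_\<omega> exp_minus field_simps mult.commute)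

lemma T_uminus: "T (- z) = - exp (- z) * T z"
  using theta_inverse[of "exp z"] nz by (simp add: Theta_def exp_minus field_simps)

lemma T_eq_0_iff: "T z = 0 \<longleftrightarrow> (\<exists>k m :: int. z = of_int k * \<omega> + of_int m * \<tau>)"
proof -
  have "T z = 0 \<longleftrightarrow> (\<exists>k::int. exp z = exp (of_int k * \<omega>))"
    unfolding Theta_def using nz by (subst theta_eq_0_iff) (simp_all add: exp_power_int[symmetric] exp_\<omega>)
  also have "\<dots> \<longleftrightarrow> (\<exists>k m :: int. z = of_int k * \<omega> + of_int m * \<tau>)"
    by (subst exp_eq) (simp add: mult_ac)
  finally show ?thesis .
qed

text \<open>The factor 1 - exp z is split off; at its zero only its own derivative counts, and the
  remaining product is \<open>(qpoch q q)^2\<close>.\<close>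

lemma T'_0: "T' 0 = - (qpoch q q)\<^sup>2"
proof -
  have "T = (\<lambda>z. (1 - exp z) * (qpoch (exp z * q) q * qpoch (q * exp (- z)) q))"
    unfolding T_eq by (subst qpoch_shift[OF lt1]) (simp add: mult_ac)
  moreover have "((\<lambda>z. (1 - exp z) * (qpoch (exp z * q) q * qpoch (q * exp (- z)) q))
      has_field_derivative - (qpoch q q)\<^sup>2) (at 0)"
  proof -
    define r where "r = (\<lambda>z. qpoch (exp z * q) q * qpoch (q * exp (- z)) q)"
    have "r holomorphic_on UNIV" unfolding r_def using lt1 by (intro holomorphic_intros) auto
    hence [derivative_intros]: "(r has_field_derivative deriv r 0) (at 0)"
      using holomorphic_derivI by blast
    have "((\<lambda>z. (1 - exp z) * r z) has_field_derivative - r 0) (at 0)"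
      by (auto intro!: derivative_eq_intros)
    thus ?thesis by (simp add: r_def power2_eq_square)
  qed
  ultimately show ?thesis by (simp add: DERIV_imp_deriv)
qed

lemma T_0 [simp]: "T 0 = 0"
  by (subst T_eq_0_iff) (auto intro!: exI[of _ 0])

text \<open>The translation by \<open>\<omega>\<close> (\<open>e = 1\<close>) and the reflection
  (\<open>e = -1\<close>, \<open>t = 0\<close>) have the same multiplier, so one computation serves
  both.\<close>

lemma T'_affine:
  assumes "\<And>z. T (e * z + t) = - exp (- z) * T z"
  shows "e * T' (e * z + t) = exp (- z) * (T z - T' z)"
    and "e\<^sup>2 * T'' (e * z + t) = - exp (- z) * (T z - 2 * T' z + T'' z)"
proof -
  have *: "e * T' (e * z + t) = exp (- z) * (T z - T' z)" for z
  proof (rule DERIV_unique)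
    show "((\<lambda>z. T (e * z + t)) has_field_derivative e * T' (e * z + t)) (at z)"
      by (auto intro!: derivative_eq_intros)
    show "((\<lambda>z. T (e * z + t)) has_field_derivative exp (- z) * (T z - T' z)) (at z)"
      unfolding assms by (auto intro!: derivative_eq_intros simp: algebra_simps)
  qed
  show "e * T' (e * z + t) = exp (- z) * (T z - T' z)" by (rule *)
  show "e\<^sup>2 * T'' (e * z + t) = - exp (- z) * (T z - 2 * T' z + T'' z)"
  proof (rule DERIV_unique)
    show "((\<lambda>z. e * T' (e * z + t)) has_field_derivative e\<^sup>2 * T'' (e * z + t)) (at z)"
      by (auto intro!: derivative_eq_intros simp: power2_eq_square)
    show "((\<lambda>z. e * T' (e * z + t)) has_field_derivative - exp (- z) * (T z - 2 * T' z + T'' z)) (at z)"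
      unfolding * by (auto intro!: derivative_eq_intros simp: algebra_simps)
  qed
qed

lemma T'_add_\<tau>: "T' (z + \<tau>) = T' z"
proof (rule DERIV_unique)
  show "((\<lambda>z. T (z + \<tau>)) has_field_derivative T' (z + \<tau>)) (at z)"
    by (auto intro!: derivative_eq_intros)
  show "((\<lambda>z. T (z + \<tau>)) has_field_derivative T' z) (at z)"
    unfolding T_add_\<tau> by (auto intro!: derivative_eq_intros)
qed

lemma T''_add_\<tau>: "T'' (z + \<tau>) = T'' z"
proof (rule DERIV_unique)
  show "((\<lambda>z. T' (z + \<tau>)) has_field_derivative T'' (z + \<tau>)) (at z)"
    by (auto intro!: derivative_eq_intros)
  show "((\<lambda>z. T' (z + \<tau>)) has_field_derivative T'' z) (at z)"
    unfolding T'_add_\<tau> by (auto intro!: derivative_eq_intros)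
qed

lemma T'_add_\<omega>: "T' (z + \<omega>) = exp (- z) * (T z - T' z)"
  using T'_affine(1)[of 1 \<omega> z] T_add_\<omega> by simp

lemma T''_add_\<omega>: "T'' (z + \<omega>) = - exp (- z) * (T z - 2 * T' z + T'' z)"
  using T'_affine(2)[of 1 \<omega> z] T_add_\<omega> by simp

lemma T'_uminus: "T' (- z) = - exp (- z) * (T z - T' z)"
  using T'_affine(1)[of "-1" 0 z] T_uminus by (simp add: minus_equation_iff algebra_simps)

lemma T''_uminus: "T'' (- z) = - exp (- z) * (T z - 2 * T' z + T'' z)"
  using T'_affine(2)[of "-1" 0 z] T_uminus by simp

text \<open>Every zero is a lattice translate of 0. The transported property includes
  \<open>T z = 0\<close> because translating \<open>T'\<close> by \<open>\<omega>\<close> also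
  brings in \<open>T\<close>.\<close>

lemma T_simple_zero:
  assumes "T z = 0"
  shows "T' z \<noteq> 0"
proof -
  obtain k m :: int where z: "z = of_int k * \<omega> + of_int m * \<tau>"
    using assms T_eq_0_iff by blast
  define P where "P = (\<lambda>z. T z = 0 \<and> T' z \<noteq> 0)"
  have "P z \<longleftrightarrow> P (z + \<omega>)" "P z \<longleftrightarrow> P (z + \<tau>)" for z
    by (auto simp: P_def T_add_\<omega> T_add_\<tau> T'_add_\<omega> T'_add_\<tau>)
  hence "P (0 + of_int k * \<omega> + of_int m * \<tau>) \<longleftrightarrow> P 0" by (rule lattice_induct)
  moreover have "P 0" using T'_0 qpoch_q_nonzero by (simp add: P_def)
  ultimately show ?thesis using z by (simp add: P_def)
qed

section \<open>Liouville's theorem for quotients with equal multipliers\<close>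

lemma Re_\<omega>: "Re \<omega> < 0"
  using lt1 by (simp flip: exp_\<omega>)

text \<open>The real part is reduced first: adding \<open>\<omega>\<close> also moves the imaginary
  part, whereas \<open>\<tau>\<close> leaves the real part alone.\<close>

lemma fundamental_domain:
  obtains k m :: int where "z + of_int k * \<omega> + of_int m * \<tau> \<in> cbox (Complex (Re \<omega>) 0) (Complex 0 (2 * pi))"
proof -
  define k where "k = - \<lfloor>Re z / Re \<omega>\<rfloor>"
  define z' where "z' = z + of_int k * \<omega>"
  define m where "m = - \<lfloor>Im z' / (2 * pi)\<rfloor>"
  have "Re z' = Re \<omega> * frac (Re z / Re \<omega>)"
    using Re_\<omega> by (simp add: z'_def k_def frac_def field_simps)
  moreover have "Im z' + of_int m * (2 * pi) = 2 * pi * frac (Im z' / (2 * pi))"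
    by (simp add: m_def frac_def field_simps)
  moreover have "frac t \<ge> 0" "frac t \<le> 1" for t :: real
    using frac_lt_1[of t] by (auto simp: less_imp_le)
  ultimately have "Re \<omega> \<le> Re z'" "Re z' \<le> 0" "0 \<le> Im z' + of_int m * (2 * pi)"
      "Im z' + of_int m * (2 * pi) \<le> 2 * pi"
    using Re_\<omega> by (auto simp: mult_le_0_iff mult_le_cancel_left1 mult_le_cancel_left2 simp del: Re_Ln)
  hence "z' + of_int m * \<tau> \<in> cbox (Complex (Re \<omega>) 0) (Complex 0 (2 * pi))"
    by (auto simp: in_cbox_complex_iff)
  thus ?thesis using that unfolding z'_def by blast
qed

text \<open>Equal multipliers make N / D doubly periodic. The zeros of \<open>D\<close> are simple
  and are zeros of \<open>N\<close>, so the quotient extends to an entire function, which is bounded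
  because it is bounded on a period rectangle.\<close>

lemma elliptic_quotient_const:
  assumes hol: "N holomorphic_on UNIV" "D holomorphic_on UNIV"
    and \<omega>: "\<And>z. N (z + \<omega>) = a z * N z" "\<And>z. D (z + \<omega>) = a z * D z" "\<And>z. a z \<noteq> 0"
    and \<tau>: "\<And>z. N (z + \<tau>) = b z * N z" "\<And>z. D (z + \<tau>) = b z * D z" "\<And>z. b z \<noteq> 0"
    and zero: "\<And>z. D z = 0 \<Longrightarrow> N z = 0" "\<And>z. D z = 0 \<Longrightarrow> deriv D z \<noteq> 0"
  obtains c where "\<And>z. N z = c * D z"
proof -
  \<comment> \<open>At a zero of \<open>D\<close> the value is the limit of the quotient, by de
    l'Hospital's rule.\<close>
  define f where "f = (\<lambda>z. if D z = 0 then deriv N z / deriv D z else N z / D z)"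
  have DN: "(N has_field_derivative deriv N z) (at z)" "(D has_field_derivative deriv D z) (at z)" for z
    using hol holomorphic_derivI by blast+
  have nzev: "eventually (\<lambda>w. D w \<noteq> 0) (at z)" for z
  proof -
    have "\<exists>w. D w \<noteq> 0"
    proof (rule ccontr)
      assume "\<nexists>w. D w \<noteq> 0"
      hence "D = (\<lambda>_. 0)" by auto
      hence "deriv D 0 = 0" "D 0 = 0" by auto
      thus False using zero(2) by blast
    qed
    then obtain w where "D w \<noteq> 0" by blast
    from non_zero_neighbour_alt[OF hol(2) _ _ _ _ this, of z] show ?thesis
      by (auto elim: eventually_mono)
  qed
  have lim: "((\<lambda>w. N w / D w) \<longlongrightarrow> f z) (at z)" for z
  proof (cases "D z = 0")
    case False
    hence "isCont (\<lambda>w. N w / D w) z"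
      using DN by (intro continuous_intros) (auto dest: DERIV_isCont)
    thus ?thesis using False by (simp add: f_def isCont_def)
  next
    case True
    have "((\<lambda>w. ((N w - N z) / (w - z)) / ((D w - D z) / (w - z))) \<longlongrightarrow> deriv N z / deriv D z) (at z)"
      using DN zero(2)[OF True] unfolding has_field_derivative_iff by (intro tendsto_divide)
    moreover have "eventually (\<lambda>w. ((N w - N z) / (w - z)) / ((D w - D z) / (w - z)) = N w / D w) (at z)"
      unfolding eventually_at_filter
      by (intro always_eventually) (simp add: zero(1)[OF True] True)
    ultimately show ?thesis using True zero(1)[OF True]
      by (simp add: f_def Lim_transform_eventually)
  qed
  have limf: "(f \<longlongrightarrow> f z) (at z)" for z
    using lim by (rule Lim_transform_eventually) (use nzev[of z] in \<open>auto elim!: eventually_mono simp: f_def\<close>)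
  have "f holomorphic_on UNIV"
  proof -
    have "\<exists>e>0. f holomorphic_on ball z e" for z
    proof -
      obtain e where e: "e > 0" "\<And>w. w \<noteq> z \<Longrightarrow> dist w z < e \<Longrightarrow> D w \<noteq> 0"
        using nzev[of z] by (auto simp: eventually_at)
      have "f holomorphic_on ball z e"
      proof (rule no_isolated_singularity')
        show "(f \<longlongrightarrow> f y) (at y within ball z e)" if "y \<in> {z}" for y
          using limf[of y] by (rule tendsto_within_subset) auto
        have "(\<lambda>w. N w / D w) holomorphic_on (ball z e - {z})"
          using e hol by (intro holomorphic_intros holomorphic_on_subset[OF hol(1)] holomorphic_on_subset[OF hol(2)])
            (auto simp: dist_commute)
        thus "f holomorphic_on (ball z e - {z})"
          by (rule holomorphic_transform) (use e in \<open>auto simp: f_def dist_commute\<close>)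
      qed auto
      thus ?thesis using e by blast
    qed
    thus ?thesis unfolding holomorphic_on_def
      by (metis UNIV_I at_within_open centre_in_ball open_ball open_UNIV)
  qed
  moreover have "bounded (range f)"
  proof -
    define K where "K = cbox (Complex (Re \<omega>) 0) (Complex 0 (2 * pi))"
    have "bounded (f ` K)"
      using \<open>f holomorphic_on UNIV\<close> unfolding K_def
      by (intro compact_imp_bounded compact_continuous_image compact_cbox)
        (meson holomorphic_on_imp_continuous_on holomorphic_on_subset subset_UNIV)
    then obtain B where B: "\<And>z. z \<in> K \<Longrightarrow> norm (f z) \<le> B" by (auto simp: bounded_iff)
    \<comment> \<open>Periodicity is at hand only off the zeros of \<open>D\<close>; the bound is
      proved there and then carried to the zeros by a limit.\<close>
    have bd: "norm (N z / D z) \<le> B" if "D z \<noteq> 0" for z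
    proof -
      define P where "P = (\<lambda>w. D w \<noteq> 0 \<and> N w / D w = N z / D z)"
      obtain k m :: int where km: "z + of_int k * \<omega> + of_int m * \<tau> \<in> K"
        unfolding K_def using fundamental_domain .
      have "P w \<longleftrightarrow> P (w + \<omega>)" "P w \<longleftrightarrow> P (w + \<tau>)" for w
        using \<omega> \<tau> by (auto simp: P_def)
      hence "P (z + of_int k * \<omega> + of_int m * \<tau>) \<longleftrightarrow> P z" by (rule lattice_induct)
      hence "P (z + of_int k * \<omega> + of_int m * \<tau>)" using that by (simp add: P_def)
      thus ?thesis using B[OF km] by (auto simp: P_def f_def)
    qed
    have "norm (f z) \<le> B" for z
    proof (rule tendsto_upperbound)
      show "((\<lambda>w. norm (N w / D w)) \<longlongrightarrow> norm (f z)) (at z)" by (intro tendsto_norm lim)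
      show "\<forall>\<^sub>F w in at z. norm (N w / D w) \<le> B"
        using nzev[of z] by eventually_elim (rule bd)
    qed auto
    thus ?thesis by (auto simp: bounded_iff)
  qed
  ultimately have "f constant_on UNIV" by (rule Liouville_theorem)
  then obtain c where c: "\<And>z. f z = c" by (auto simp: constant_on_def)
  have "N z = c * D z" for z
    using c[of z] zero(1)[of z] by (cases "D z = 0") (auto simp: f_def field_simps)
  thus ?thesis by (rule that)
qed

section \<open>The addition formula for the second logarithmic derivative\<close>

definition wrT :: "complex \<Rightarrow> complex" where
  "wrT z = T z * T'' z - (T' z)\<^sup>2"

lemma holomorphic_wrT: "wrT holomorphic_on A"
  unfolding wrT_def by (intro holomorphic_intros holomorphic_T holomorphic_T' holomorphic_T'')

lemma wrT_add_\<tau>: "wrT (z + \<tau>) = wrT z"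
  by (simp add: wrT_def T_add_\<tau> T'_add_\<tau> T''_add_\<tau>)

lemma wrT_add_\<omega>: "wrT (z + \<omega>) = exp (- z) ^ 2 * wrT z"
  unfolding wrT_def T_add_\<omega> T'_add_\<omega> T''_add_\<omega> by algebra

lemma wrT_uminus: "wrT (- z) = exp (- z) ^ 2 * wrT z"
  unfolding wrT_def T_uminus T'_uminus T''_uminus by algebra

text \<open>Divided by the squares of T(z) and T(w) this is the addition formula of (log T)'', whose
  numerator \<open>wrT\<close> is used because it is entire. In \<open>z\<close> both sides have the
  same multipliers, and the zeros of the right side, which are \<open>w\<close> and
  \<open>- w\<close> modulo the lattice, are zeros of the left. The constant is read off at z =
  0.\<close>

lemma T_add_diff:
  "wrT z * (T w)\<^sup>2 - wrT w * (T z)\<^sup>2 = qpoch q q ^ 4 * exp w * (T (z + w) * T (z - w))"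
proof -
  \<comment> \<open>If 2w is a lattice point, the zeros \<open>w\<close> and \<open>- w\<close>
    coincide modulo the lattice and are no longer simple. Such \<open>w\<close> are isolated and are
    reached by continuity at the end.\<close>
  have generic: "wrT z * (T w)\<^sup>2 - wrT w * (T z)\<^sup>2 = qpoch q q ^ 4 * exp w * (T (z + w) * T (z - w))"
    if w: "T (2 * w) \<noteq> 0" for w z
  proof -
    define N where "N = (\<lambda>z. wrT z * (T w)\<^sup>2 - wrT w * (T z)\<^sup>2)"
    define D where "D = (\<lambda>z. T (z + w) * T (z - w))"
    have N_\<omega>: "N (z + \<omega>) = exp (- z) ^ 2 * N z" for z
      unfolding N_def wrT_add_\<omega> T_add_\<omega> by algebra
    have D_\<omega>: "D (z + \<omega>) = exp (- z) ^ 2 * D z" for z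
    proof -
      have "D (z + \<omega>) = T (z + w + \<omega>) * T (z - w + \<omega>)" by (simp add: D_def algebra_simps)
      also have "\<dots> = exp (- (z + w)) * exp (- (z - w)) * D z" by (simp add: T_add_\<omega> D_def)
      also have "exp (- (z + w)) * exp (- (z - w)) = exp (- z) ^ 2"
        by (simp add: power2_eq_square flip: exp_add)
      finally show ?thesis .
    qed
    have N_\<tau>: "N (z + \<tau>) = 1 * N z" for z
      by (simp add: N_def wrT_add_\<tau> T_add_\<tau>)
    have D_\<tau>: "D (z + \<tau>) = 1 * D z" for z
      using T_add_\<tau>[of "z + w"] T_add_\<tau>[of "z - w"] by (simp add: D_def algebra_simps)
    have lat: "N (z + of_int k * \<omega> + of_int m * \<tau>) = 0 \<longleftrightarrow> N z = 0" for z and k m :: int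
      by (rule lattice_induct[of "\<lambda>z. N z = 0"]) (simp_all add: N_\<omega> N_\<tau>)
    have zero: "N z = 0 \<and> deriv D z \<noteq> 0" if z: "D z = 0" for z
    proof -
      have nb: "\<not> (T (z + w) = 0 \<and> T (z - w) = 0)"
      proof
        assume "T (z + w) = 0 \<and> T (z - w) = 0"
        then obtain k m k' m' :: int where "z + w = of_int k * \<omega> + of_int m * \<tau>"
          "z - w = of_int k' * \<omega> + of_int m' * \<tau>" unfolding T_eq_0_iff by blast
        hence "2 * w = of_int (k - k') * \<omega> + of_int (m - m') * \<tau>"
          by (simp add: algebra_simps)
        hence "T (2 * w) = 0" unfolding T_eq_0_iff by blast
        with w show False by simp
      qed
      have "(D has_field_derivative T' (z + w) * T (z - w) + T (z + w) * T' (z - w)) (at z)"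
        unfolding D_def by (auto intro!: derivative_eq_intros)
      hence dD: "deriv D z = T' (z + w) * T (z - w) + T (z + w) * T' (z - w)"
        by (rule DERIV_imp_deriv)
      consider "T (z - w) = 0" | "T (z + w) = 0" using z by (auto simp: D_def)
      thus ?thesis
      proof cases
        case 1
        then obtain k m :: int where "z - w = of_int k * \<omega> + of_int m * \<tau>" unfolding T_eq_0_iff by blast
        hence zw: "z = w + of_int k * \<omega> + of_int m * \<tau>" by (simp add: algebra_simps)
        have "N z = 0 \<longleftrightarrow> N w = 0" unfolding zw by (rule lat)
        moreover have "N w = 0" by (simp add: N_def)
        ultimately show ?thesis using dD 1 nb T_simple_zero[OF 1] by auto
      next
        case 2
        then obtain k m :: int where "z + w = of_int k * \<omega> + of_int m * \<tau>" unfolding T_eq_0_iff by blast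
        hence zw: "z = - w + of_int k * \<omega> + of_int m * \<tau>" by (simp add: algebra_simps)
        have "N z = 0 \<longleftrightarrow> N (- w) = 0" unfolding zw by (rule lat)
        moreover have "N (- w) = 0"
          unfolding N_def wrT_uminus T_uminus by algebra
        ultimately show ?thesis using dD 2 nb T_simple_zero[OF 2] by auto
      qed
    qed
    have "N holomorphic_on UNIV" unfolding N_def by (intro holomorphic_intros holomorphic_wrT holomorphic_T)
    moreover have "D holomorphic_on UNIV" unfolding D_def
      by (intro holomorphic_intros holomorphic_on_compose_gen[OF _ holomorphic_T[of UNIV], unfolded o_def]) auto
    ultimately obtain c where c: "\<And>z. N z = c * D z"
      using elliptic_quotient_const[OF _ _ N_\<omega> D_\<omega> _ N_\<tau> D_\<tau>] zero by auto
    have "T w \<noteq> 0"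
    proof
      assume "T w = 0"
      then obtain k m :: int where "w = of_int k * \<omega> + of_int m * \<tau>" unfolding T_eq_0_iff by blast
      hence "2 * w = of_int (2 * k) * \<omega> + of_int (2 * m) * \<tau>" by (simp add: algebra_simps)
      hence "T (2 * w) = 0" unfolding T_eq_0_iff by blast
      with w show False by simp
    qed
    moreover have "N 0 = - (qpoch q q ^ 4) * (T w)\<^sup>2"
      by (simp add: N_def wrT_def T'_0 flip: power_mult)
    moreover have "D 0 = - exp (- w) * (T w)\<^sup>2"
      by (simp add: D_def T_uminus power2_eq_square)
    ultimately have "c = qpoch q q ^ 4 * exp w"
      using c[of 0] by (simp add: exp_minus field_simps)
    thus ?thesis using c[of z] by (simp add: N_def D_def)
  qed
  show ?thesis
  proof (rule LIM_unique)
    have cont: "isCont T w" "isCont wrT w" for w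
      using holomorphic_T[of UNIV] holomorphic_wrT[of UNIV]
      by (meson holomorphic_on_imp_continuous_on continuous_on_eq_continuous_at open_UNIV UNIV_I)+
    have cont2: "isCont (\<lambda>w. T (z + w)) w" "isCont (\<lambda>w. T (z - w)) w"
      by (rule isCont_o2[where g = T, OF _ cont(1)], simp)+
    define R where "R = (\<lambda>w. qpoch q q ^ 4 * exp w * (T (z + w) * T (z - w)))"
    have "isCont R w"
      unfolding R_def by (intro continuous_intros cont2)
    thus "R \<midarrow>w\<rightarrow> qpoch q q ^ 4 * exp w * (T (z + w) * T (z - w))"
      unfolding isCont_def R_def .
    have "isCont (\<lambda>w. wrT z * (T w)\<^sup>2 - wrT w * (T z)\<^sup>2) w"
      by (intro continuous_intros cont)
    hence lim: "(\<lambda>w. wrT z * (T w)\<^sup>2 - wrT w * (T z)\<^sup>2) \<midarrow>w\<rightarrow> wrT z * (T w)\<^sup>2 - wrT w * (T z)\<^sup>2"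
      by (simp add: isCont_def)
    have "T' 0 \<noteq> 0" using T_simple_zero[of 0] by simp
    hence "\<exists>b. T (2 * b) \<noteq> 0"
    proof (rule contrapos_np)
      assume "\<nexists>b. T (2 * b) \<noteq> 0"
      hence "T b = 0" for b using spec[of "\<lambda>b. T (2 * b) = 0" "b / 2"] by auto
      hence "T = (\<lambda>_. 0)" by auto
      thus "T' 0 = 0" by simp
    qed
    then obtain b where b: "T (2 * b) \<noteq> 0" by blast
    have "(\<lambda>w. T (2 * w)) holomorphic_on UNIV"
      by (intro holomorphic_on_compose_gen[OF _ holomorphic_T[of UNIV], unfolded o_def] holomorphic_intros) auto
    from non_zero_neighbour_alt[OF this _ _ _ _ b, of w]
    have "eventually (\<lambda>w. T (2 * w) \<noteq> 0) (at w)" by (auto elim: eventually_mono)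
    hence "eventually (\<lambda>w. wrT z * (T w)\<^sup>2 - wrT w * (T z)\<^sup>2 = R w) (at w)"
      by eventually_elim (use generic in \<open>simp add: R_def\<close>)
    with lim show "R \<midarrow>w\<rightarrow> wrT z * (T w)\<^sup>2 - wrT w * (T z)\<^sup>2"
      by (rule Lim_transform_eventually)
  qed
qed

end

section \<open>The Lambert series of a theta quotient\<close>

text \<open>Polylogarithms of order 0, -1 and -2, that is, the sums of n^k v^n over n \<ge> 1 for k
  = 0, 1, 2. Each is v d/dv of its predecessor.\<close>

definition li0 :: "complex \<Rightarrow> complex" where "li0 v = v / (1 - v)"
definition li1 :: "complex \<Rightarrow> complex" where "li1 v = v / (1 - v)\<^sup>2"
definition li2 :: "complex \<Rightarrow> complex" where "li2 v = v * (1 + v) / (1 - v) ^ 3"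

lemma DERIV_li0: "v \<noteq> 1 \<Longrightarrow> (li0 has_field_derivative 1 / (1 - v)\<^sup>2) (at v)"
  unfolding li0_def by (auto intro!: derivative_eq_intros simp: power2_eq_square divide_simps)

lemma DERIV_li1: "v \<noteq> 1 \<Longrightarrow> (li1 has_field_derivative (1 + v) / (1 - v) ^ 3) (at v)"
  unfolding li1_def
  by (auto intro!: derivative_eq_intros simp: divide_simps) (simp add: power2_eq_square power3_eq_cube power4_eq_xxxx algebra_simps)

lemma deriv_li: "v \<noteq> 1 \<Longrightarrow> v * deriv li0 v = li1 v" "v \<noteq> 1 \<Longrightarrow> v * deriv li1 v = li2 v"
  using DERIV_imp_deriv[OF DERIV_li0, of v] DERIV_imp_deriv[OF DERIV_li1, of v]
  by (simp_all add: li1_def li2_def)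

lemma holomorphic_li: "li0 holomorphic_on - {1}" "li1 holomorphic_on - {1}" "li2 holomorphic_on - {1}"
  unfolding li0_def li1_def li2_def by (intro holomorphic_intros; simp)+

lemma li_0 [simp]: "li0 0 = 0" "li1 0 = 0" "li2 0 = 0"
  by (simp_all add: li0_def li1_def li2_def)

lemma DERIV_eventually_eq:
  "(f has_field_derivative d) (at z) \<Longrightarrow> eventually (\<lambda>w. g w = f w) (nhds z) \<Longrightarrow>
     (g has_field_derivative d) (at z)"
  using DERIV_cong_ev[of z z g f d d] by simp

context nome
begin

lemma T_nonzero_iff: "T z \<noteq> 0 \<longleftrightarrow> (\<forall>k. exp z * q ^ k \<noteq> 1) \<and> (\<forall>k. q ^ Suc k * exp (- z) \<noteq> 1)"
  by (auto simp: T_eq qpoch_eq_0_iff[OF lt1] mult_ac)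

lemma logderiv_sums:
  assumes "T z \<noteq> 0"
  shows "(\<lambda>k. li0 (q ^ Suc k * exp (- z)) - li0 (exp z * q ^ k)) sums (T' z / T z)"
proof -
  define Q' where "Q' = deriv (\<lambda>a. qpoch a q)"
  have nz1: "qpoch (exp z) q \<noteq> 0" "qpoch (q * exp (- z)) q \<noteq> 0"
    using assms by (auto simp: T_eq)
  have "((\<lambda>a. qpoch a q) has_field_derivative Q' a) (at a)" for a
    unfolding Q'_def using holomorphic_derivI[OF holomorphic_qpoch[OF lt1]] by blast
  note D = DERIV_chain2[OF this]
  have "(T has_field_derivative Q' (exp z) * exp z * qpoch (q * exp (- z)) q +
      Q' (q * exp (- z)) * (- q * exp (- z)) * qpoch (exp z) q) (at z)"
    unfolding T_eq by (auto intro!: derivative_eq_intros D)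
  hence "T' z = Q' (exp z) * exp z * qpoch (q * exp (- z)) q +
      Q' (q * exp (- z)) * (- q * exp (- z)) * qpoch (exp z) q"
    by (rule DERIV_imp_deriv)
  hence eq: "T' z / T z = exp z * (Q' (exp z) / qpoch (exp z) q) -
      q * exp (- z) * (Q' (q * exp (- z)) / qpoch (q * exp (- z)) q)"
    using nz1 by (simp add: T_eq divide_simps)
  have "(\<lambda>k. exp z * (- (q ^ k) / (1 - exp z * q ^ k)) -
            q * exp (- z) * (- (q ^ k) / (1 - q * exp (- z) * q ^ k))) sums (T' z / T z)"
    unfolding eq Q'_def using nz1 by (intro sums_diff sums_mult qpoch_logderiv lt1)
  thus ?thesis by (simp add: li0_def mult_ac)
qed

text \<open>The two halves of a bilateral series. The arguments are multiples of exp z or exp (- z),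
  so d/dz acts as v d/dv up to sign.\<close>

lemma DERIV_series:
  assumes K: "K holomorphic_on - {1}" "K 0 = 0" and "T z \<noteq> 0"
  shows "summable (\<lambda>k. K (exp z * q ^ k))"
    "((\<lambda>z. \<Sum>k. K (exp z * q ^ k)) has_field_derivative
       (\<Sum>k. (exp z * q ^ k) * deriv K (exp z * q ^ k))) (at z)"
    "summable (\<lambda>k. (exp z * q ^ k) * deriv K (exp z * q ^ k))"
    "summable (\<lambda>k. K (q ^ Suc k * exp (- z)))"
    "((\<lambda>z. \<Sum>k. K (q ^ Suc k * exp (- z))) has_field_derivative
       - (\<Sum>k. (q ^ Suc k * exp (- z)) * deriv K (q ^ Suc k * exp (- z)))) (at z)"
    "summable (\<lambda>k. (q ^ Suc k * exp (- z)) * deriv K (q ^ Suc k * exp (- z)))"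
proof -
  have re: "Re u \<le> \<bar>Re z\<bar> + 1" "- Re u \<le> \<bar>Re z\<bar> + 1" if "u \<in> ball z 1" for u
    using abs_Re_le_cmod[of "u - z"] that by (auto simp: dist_norm norm_minus_commute)
  have M: "summable (\<lambda>k. exp (\<bar>Re z\<bar> + 1) * norm q ^ k)"
    using lt1 by (intro summable_mult summable_geometric) auto
  have S: "open (- {1::complex})" "(0::complex) \<in> - {1}" by auto
  have b1: "norm (exp u * q ^ k) \<le> exp (\<bar>Re z\<bar> + 1) * norm q ^ k" if "u \<in> ball z 1" for u k
    using re[OF that] by (auto simp: norm_mult norm_power intro!: mult_right_mono)
  have b2: "norm (q ^ Suc k * exp (- u)) \<le> exp (\<bar>Re z\<bar> + 1) * norm q ^ k" if "u \<in> ball z 1" for u k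
  proof -
    have "norm (q ^ Suc k * exp (- u)) = exp (- Re u) * norm q ^ Suc k"
      by (simp add: norm_mult norm_power mult_ac)
    also have "\<dots> \<le> exp (\<bar>Re z\<bar> + 1) * norm q ^ k"
      using re[OF that] lt1 by (intro mult_mono power_decreasing) auto
    finally show ?thesis .
  qed
  have d1: "deriv (\<lambda>z. exp z * q ^ k) z = exp z * q ^ k" for k
    by (rule DERIV_imp_deriv) (auto intro!: derivative_eq_intros)
  have d2: "deriv (\<lambda>z. q ^ Suc k * exp (- z)) z = - (q ^ Suc k * exp (- z))" for k
    by (rule DERIV_imp_deriv) (auto intro!: derivative_eq_intros)
  have n: "exp z * q ^ k \<in> - {1}" "q ^ Suc k * exp (- z) \<in> - {1}" for k
    using assms T_nonzero_iff by auto
  have h: "(\<lambda>z. exp z * q ^ k) holomorphic_on ball z 1" "(\<lambda>z. q ^ Suc k * exp (- z)) holomorphic_on ball z 1" for k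
    by (intro holomorphic_intros)+
  have c: "norm ((\<lambda>_. 1) k :: complex) \<le> 1" for k :: nat by simp
  have z1: "z \<in> ball z 1" by simp
  note A = has_field_derivative_series_compose[OF K(1) S K(2) h(1) open_ball z1 n(1) b1 M c, unfolded d1]
  note B = has_field_derivative_series_compose[OF K(1) S K(2) h(2) open_ball z1 n(2) b2 M c, unfolded d2]
  show "summable (\<lambda>k. K (exp z * q ^ k))"
    "((\<lambda>z. \<Sum>k. K (exp z * q ^ k)) has_field_derivative
       (\<Sum>k. (exp z * q ^ k) * deriv K (exp z * q ^ k))) (at z)"
    "summable (\<lambda>k. (exp z * q ^ k) * deriv K (exp z * q ^ k))"
    using A by simp_all
  show "summable (\<lambda>k. K (q ^ Suc k * exp (- z)))"
    using B by simp
  have s: "summable (\<lambda>k. - (q ^ Suc k * exp (- z)) * deriv K (q ^ Suc k * exp (- z)))"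
    using B(2) by simp
  from summable_minus[OF this] 
  show s': "summable (\<lambda>k. (q ^ Suc k * exp (- z)) * deriv K (q ^ Suc k * exp (- z)))"
    by simp
  have "(\<Sum>k. - (q ^ Suc k * exp (- z)) * deriv K (q ^ Suc k * exp (- z))) = 
       - (\<Sum>k. (q ^ Suc k * exp (- z)) * deriv K (q ^ Suc k * exp (- z)))"
    using suminf_minus[OF s'] by simp
  thus "((\<lambda>z. \<Sum>k. K (q ^ Suc k * exp (- z))) has_field_derivative
       - (\<Sum>k. (q ^ Suc k * exp (- z)) * deriv K (q ^ Suc k * exp (- z)))) (at z)"
    using B(3) by simp
qed

lemma eventually_T_nonzero: "T z \<noteq> 0 \<Longrightarrow> eventually (\<lambda>w. T w \<noteq> 0) (nhds z)"
  using eventually_nhds_in_open[OF open_Collect_neq[OF holomorphic_on_imp_continuous_on[OF holomorphic_T[of UNIV]] continuous_on_const[of UNIV 0]], of z]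
  by simp

lemma logderiv_eq:
  assumes "T z \<noteq> 0"
  shows "T' z / T z = (\<Sum>k. li0 (q ^ Suc k * exp (- z))) - (\<Sum>k. li0 (exp z * q ^ k))"
  using logderiv_sums[OF assms] suminf_diff[OF DERIV_series(4,1)[OF holomorphic_li(1) _ assms]]
  by (simp add: sums_iff)

lemma DERIV_logderiv:
  assumes "T z \<noteq> 0"
  shows "((\<lambda>z. T' z / T z) has_field_derivative wrT z / (T z)\<^sup>2) (at z)"
  using assms by (auto intro!: derivative_eq_intros simp: wrT_def power2_eq_square)

lemma wrT_div_eq:
  assumes "T z \<noteq> 0"
  shows "wrT z / (T z)\<^sup>2 = - (\<Sum>k. li1 (q ^ Suc k * exp (- z))) - (\<Sum>k. li1 (exp z * q ^ k))"
proof (rule DERIV_unique[OF DERIV_logderiv[OF assms]])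
  have n: "q ^ Suc k * exp (- z) \<noteq> 1" "exp z * q ^ k \<noteq> 1" for k
    using assms T_nonzero_iff by blast+
  have "((\<lambda>z. (\<Sum>k. li0 (q ^ Suc k * exp (- z))) - (\<Sum>k. li0 (exp z * q ^ k))) has_field_derivative
      - (\<Sum>k. li1 (q ^ Suc k * exp (- z))) - (\<Sum>k. li1 (exp z * q ^ k))) (at z)"
    using DERIV_diff[OF DERIV_series(5,2)[OF holomorphic_li(1) _ assms]]
    by (simp only: deriv_li(1)[OF n(1)] deriv_li(1)[OF n(2)] li_0)
  moreover have "eventually (\<lambda>z. T' z / T z = (\<Sum>k. li0 (q ^ Suc k * exp (- z))) - (\<Sum>k. li0 (exp z * q ^ k))) (nhds z)"
    using eventually_T_nonzero[OF assms] by eventually_elim (rule logderiv_eq)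
  ultimately show "((\<lambda>z. T' z / T z) has_field_derivative
      - (\<Sum>k. li1 (q ^ Suc k * exp (- z))) - (\<Sum>k. li1 (exp z * q ^ k))) (at z)"
    by (rule DERIV_eventually_eq)
qed

text \<open>Since \<open>li2 (1 / v) = - li2 v\<close>, this is the bilateral sum of
  \<open>li2 (exp z * q powi n)\<close> over all integers n.\<close>

definition li2_series :: "complex \<Rightarrow> complex" where
  "li2_series z = (\<Sum>k. li2 (exp z * q ^ k)) - (\<Sum>k. li2 (q ^ Suc k * exp (- z)))"

lemma li2_series_sums:
  assumes "T z \<noteq> 0"
  shows "summable (\<lambda>k. li2 (exp z * q ^ k))" "summable (\<lambda>k. li2 (q ^ Suc k * exp (- z)))"
    "(\<lambda>k. li2 (exp z * q ^ k) - li2 (q ^ Suc k * exp (- z))) sums li2_series z"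
proof -
  show *: "summable (\<lambda>k. li2 (exp z * q ^ k))" "summable (\<lambda>k. li2 (q ^ Suc k * exp (- z)))"
    using DERIV_series(1,4)[OF holomorphic_li(3) _ assms] by simp_all
  thus "(\<lambda>k. li2 (exp z * q ^ k) - li2 (q ^ Suc k * exp (- z))) sums li2_series z"
    unfolding li2_series_def by (intro sums_diff summable_sums)
qed

lemma DERIV_wrT_div:
  assumes "T z \<noteq> 0"
  shows "((\<lambda>z. wrT z / (T z)\<^sup>2) has_field_derivative - li2_series z) (at z)"
proof -
  have n: "q ^ Suc k * exp (- z) \<noteq> 1" "exp z * q ^ k \<noteq> 1" for k
    using assms T_nonzero_iff by blast+
  have "((\<lambda>z. - (\<Sum>k. li1 (q ^ Suc k * exp (- z))) - (\<Sum>k. li1 (exp z * q ^ k))) has_field_derivative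
      - (- (\<Sum>k. li2 (q ^ Suc k * exp (- z)))) - (\<Sum>k. li2 (exp z * q ^ k))) (at z)"
    using DERIV_diff[OF DERIV_minus[OF DERIV_series(5)[OF holomorphic_li(2) _ assms]]
        DERIV_series(2)[OF holomorphic_li(2) _ assms]]
    by (simp only: deriv_li(2)[OF n(1)] deriv_li(2)[OF n(2)] li_0)
  moreover have "eventually (\<lambda>z. wrT z / (T z)\<^sup>2 = - (\<Sum>k. li1 (q ^ Suc k * exp (- z))) - (\<Sum>k. li1 (exp z * q ^ k))) (nhds z)"
    using eventually_T_nonzero[OF assms] by eventually_elim (rule wrT_div_eq)
  ultimately have "((\<lambda>z. wrT z / (T z)\<^sup>2) has_field_derivative
      - (- (\<Sum>k. li2 (q ^ Suc k * exp (- z)))) - (\<Sum>k. li2 (exp z * q ^ k))) (at z)"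
    by (rule DERIV_eventually_eq)
  thus ?thesis by (simp add: li2_series_def)
qed

text \<open>The addition formula expresses the difference of (log T)'' at \<open>w\<close> and
  \<open>z\<close> with a factor T(w - z). Differentiating in \<open>w\<close> at w = z keeps only
  the term in which this factor is differentiated, which leaves T(2z) T'(0).\<close>

theorem li2_series_eq:
  assumes "T z \<noteq> 0"
  shows "li2_series z = qpoch q q ^ 6 * exp z * T (2 * z) / T z ^ 4"
proof -
  define B where "B = (\<lambda>z. wrT z / (T z)\<^sup>2)"
  have "((\<lambda>w. B z + qpoch q q ^ 4 * exp z * (T (w + z) * T (w - z)) / ((T w)\<^sup>2 * (T z)\<^sup>2)) has_field_derivative
      qpoch q q ^ 4 * exp z * (T (2 * z) * T' 0) / ((T z)\<^sup>2 * (T z)\<^sup>2)) (at z)"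
  proof -
    have D: "((\<lambda>w. qpoch q q ^ 4 * exp z * (T (w + z) * T (w - z))) has_field_derivative
        qpoch q q ^ 4 * exp z * (T (2 * z) * T' 0)) (at z)"
      by (rule derivative_eq_intros refl | simp)+ 
    have E: "((\<lambda>w. (T w)\<^sup>2 * (T z)\<^sup>2) has_field_derivative (2 * T z * T' z) * (T z)\<^sup>2) (at z)"
      by (auto intro!: derivative_eq_intros)
    have "X * T z ^ 4 / T z ^ 8 = X / T z ^ 4" for X
      using assms by (simp add: field_simps flip: power_add)
    with DERIV_divide[OF D E] assms
    have "((\<lambda>w. qpoch q q ^ 4 * exp z * (T (w + z) * T (w - z)) / ((T w)\<^sup>2 * (T z)\<^sup>2)) has_field_derivative
        qpoch q q ^ 4 * exp z * (T (2 * z) * T' 0) / ((T z)\<^sup>2 * (T z)\<^sup>2)) (at z)"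
      by simp
    from DERIV_add[OF DERIV_const this] show ?thesis by simp
  qed
  moreover have "eventually (\<lambda>w. B w = B z + qpoch q q ^ 4 * exp z * (T (w + z) * T (w - z)) / ((T w)\<^sup>2 * (T z)\<^sup>2)) (nhds z)"
    using eventually_T_nonzero[OF assms]
  proof eventually_elim
    case (elim w)
    have "wrT w * (T z)\<^sup>2 = wrT z * (T w)\<^sup>2 + qpoch q q ^ 4 * exp z * (T (w + z) * T (w - z))"
      using T_add_diff[of w z] by (simp add: algebra_simps)
    thus ?case using elim assms by (simp add: B_def divide_simps)
  qed
  ultimately have "(B has_field_derivative
      qpoch q q ^ 4 * exp z * (T (2 * z) * T' 0) / ((T z)\<^sup>2 * (T z)\<^sup>2)) (at z)"
    by (rule DERIV_eventually_eq)
  from DERIV_unique[OF DERIV_wrT_div[OF assms, folded B_def] this]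
  have "li2_series z = - (qpoch q q ^ 4 * exp z * (T (2 * z) * T' 0) / ((T z)\<^sup>2 * (T z)\<^sup>2))"
    by (metis minus_minus)
  also have "\<dots> = qpoch q q ^ 6 * exp z * T (2 * z) / T z ^ 4"
    unfolding T'_0 by (simp add: power2_eq_square eval_nat_numeral mult_ac)
  finally show ?thesis .
qed

end

section \<open>The alternating Lambert series\<close>

context nome
begin

abbreviation \<eta> :: complex where "\<eta> \<equiv> \<omega> / 2 + complex_of_real pi * \<i>"

text \<open>Real parts decide: that of \<open>\<eta>\<close> is half of \<open>Re \<omega>\<close>,
  while lattice points have integer multiples of \<open>Re \<omega>\<close>.\<close>

lemma T_lattice_\<eta>: "T (2 * z) = 0 \<Longrightarrow> T (2 * z + \<eta>) \<noteq> 0"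
proof
  assume "T (2 * z) = 0" "T (2 * z + \<eta>) = 0"
  then obtain k m k' m' :: int where *: "2 * z = of_int k * \<omega> + of_int m * \<tau>"
    "2 * z + \<eta> = of_int k' * \<omega> + of_int m' * \<tau>" unfolding T_eq_0_iff by blast
  hence "\<eta> = of_int (k' - k) * \<omega> + of_int (m' - m) * \<tau>"
    by (simp add: algebra_simps)
  from arg_cong[OF this, of Re] have "Re \<omega> / 2 = of_int (k' - k) * Re \<omega>" by simp
  hence "of_int (2 * (k' - k)) = (1 :: real)" using Re_\<omega> by simp
  hence "2 * (k' - k) = 1" by linarith
  thus False by presburger
qed

text \<open>Let \<open>r\<close> be the chosen square root of \<open>q\<close>. Parity of the
  exponent of \<open>r\<close> merges the arguments x and x r, and the difference of squares then
  merges x with - x.\<close>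

lemma T_double: "T (2 * z) = T z * T (z + pi * \<i>) * T (z + \<omega> / 2) * T (z + \<eta>)"
proof -
  define r where "r = exp (\<omega> / 2)"
  define x where "x = exp z"
  have r2: "r\<^sup>2 = q" unfolding r_def exp_\<omega>[symmetric] by (simp add: power2_eq_square flip: exp_add)
  have "norm r ^ 2 < 1" using lt1 by (simp flip: r2 norm_power)
  hence r1: "norm r < 1" by (simp add: abs_square_less_1)
  have nz: "x \<noteq> 0" "r \<noteq> 0" by (simp_all add: x_def r_def)
  have e: "exp (z + pi * \<i>) = - x" "exp (z + \<omega> / 2) = x * r" "exp (z + \<eta>) = - (x * r)" "exp (2 * z) = x\<^sup>2"
  proof -
    show "exp (z + \<omega> / 2) = x * r" "exp (z + pi * \<i>) = - x" by (simp_all only: exp_add x_def r_def exp_pi_i) simp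
    show "exp (2 * z) = x\<^sup>2" by (simp only: x_def exp_double)
    show "exp (z + \<eta>) = - (x * r)" by (simp only: exp_add x_def r_def exp_pi_i) simp
  qed
  have "theta x q * theta (x * r) q = qpoch x r * qpoch (r / x) r" for x
  proof -
    have "theta x q * theta (x * r) q = (qpoch x (r\<^sup>2) * qpoch (x * r) (r\<^sup>2)) * (qpoch (r / x) (r\<^sup>2) * qpoch (r / x * r) (r\<^sup>2))"
      using nz by (simp add: theta_def r2[symmetric] power2_eq_square mult_ac)
    thus ?thesis by (simp only: qpoch_split2[OF r1, symmetric])
  qed
  hence *: "theta x q * theta (x * r) q = qpoch x r * qpoch (r / x) r"
       "theta (-x) q * theta (- x * r) q = qpoch (- x) r * qpoch (r / - x) r" by blast+
  have "T z * T (z + pi * \<i>) * T (z + \<omega> / 2) * T (z + \<eta>) =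
     (theta x q * theta (x * r) q) * (theta (-x) q * theta (- x * r) q)"
    unfolding Theta_def e by (simp add: x_def)
  also have "\<dots> = (qpoch x r * qpoch (- x) r) * (qpoch (r / x) r * qpoch (- (r / x)) r)"
    unfolding * by simp
  also have "\<dots> = theta (x\<^sup>2) q"
    unfolding qpoch_mult_minus[OF r1] r2 theta_def by (simp add: power_divide r2)
  finally show ?thesis by (simp add: Theta_def e)
qed

definition lg :: "complex \<Rightarrow> complex" where
  "lg z = T' z / T z"

text \<open>The sum of \<open>(- 1) ^ n * v / (1 - v\<^sup>2)\<close> over \<open>v = exp z * r ^ n\<close>, where \<open>n\<close> ranges over all
  integers and \<open>r = exp (\<omega> / 2)\<close>, written with logarithmic derivatives of theta functions.\<close>

definition alt :: "complex \<Rightarrow> complex" where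
  "alt z = (- lg z + lg (z + pi * \<i>) + lg (z + \<omega> / 2) - lg (z + \<eta>)) / 2"

lemma logderiv_add_\<omega>: "T z \<noteq> 0 \<Longrightarrow> lg (z + \<omega>) = lg z - 1"
  unfolding lg_def T_add_\<omega> T'_add_\<omega> by (simp add: divide_simps)

lemma logderiv_uminus: "T z \<noteq> 0 \<Longrightarrow> lg (- z) = 1 - lg z"
  by (simp add: lg_def T_uminus T'_uminus field_simps)

lemma logderiv_add_\<tau>: "lg (z + \<tau>) = lg z"
  by (simp add: lg_def T_add_\<tau> T'_add_\<tau>)

text \<open>\<open>alt\<close> changes sign under the translations by \<open>\<omega> / 2\<close>
  and \<open>pi * \<i>\<close>, and the zeros of T(2z + \<eta>) are the translates of - \<eta> / 2
  by these. At that point the reflection pairs the four logarithmic derivatives, and lg(- z) = 1 -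
  lg(z) makes them cancel.\<close>

lemma alt_eq_0:
  assumes "T (2 * z + \<eta>) = 0"
  shows "alt z = 0"
proof -
  \<comment> \<open>\<open>T (2 * z) \<noteq> 0\<close> is carried along because the translation
    rule of \<open>lg\<close> fails at zeros of \<open>T\<close>, where the quotient defaults to
    0.\<close>
  define P where "P = (\<lambda>z. T (2 * z) \<noteq> 0 \<and> alt z = 0)"
  obtain k m :: int where "2 * z + \<eta> = of_int k * \<omega> + of_int m * \<tau>"
    using assms T_eq_0_iff by blast
  hence z: "z = - \<eta> / 2 + of_int k * (\<omega> / 2) + of_int m * (pi * \<i>)"
    by (simp add: field_simps)
  have "P z \<longleftrightarrow> P (z + \<omega> / 2)" for z
  proof -
    have "T (2 * (z + \<omega> / 2)) \<noteq> 0 \<longleftrightarrow> T (2 * z) \<noteq> 0"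
      using T_add_\<omega>[of "2 * z"] by (simp add: algebra_simps)
    moreover have "alt (z + \<omega> / 2) = - alt z" if "T (2 * z) \<noteq> 0"
    proof -
      have nz: "T z \<noteq> 0" "T (z + pi * \<i>) \<noteq> 0" using that by (auto simp: T_double)
      have sh: "z + \<omega> / 2 + \<omega> / 2 = z + \<omega>" "z + \<omega> / 2 + \<eta> = (z + pi * \<i>) + \<omega>"
        "z + \<omega> / 2 + pi * \<i> = z + \<eta>" by simp_all
      show ?thesis unfolding alt_def sh logderiv_add_\<omega>[OF nz(1)] logderiv_add_\<omega>[OF nz(2)]
        by (simp add: field_simps)
    qed
    ultimately show ?thesis by (auto simp: P_def)
  qed
  moreover have "P z \<longleftrightarrow> P (z + pi * \<i>)" for z
  proof -
    have "T (2 * (z + pi * \<i>)) \<noteq> 0 \<longleftrightarrow> T (2 * z) \<noteq> 0"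
      using T_add_\<tau>[of "2 * z"] by (simp add: algebra_simps)
    moreover have "alt (z + pi * \<i>) = - alt z"
    proof -
      have sh: "z + pi * \<i> + pi * \<i> = z + \<tau>" "z + pi * \<i> + \<eta> = (z + \<omega> / 2) + \<tau>"
        "z + pi * \<i> + \<omega> / 2 = z + \<eta>" by simp_all
      show ?thesis unfolding alt_def sh logderiv_add_\<tau>
        by (simp add: field_simps)
    qed
    ultimately show ?thesis by (auto simp: P_def)
  qed
  ultimately have "P z \<longleftrightarrow> P (- \<eta> / 2)" unfolding z by (rule lattice_induct)
  moreover have "P (- \<eta> / 2)"
  proof -
    have "2 * (- \<eta> / 2) + \<eta> = 0" by (simp add: field_simps)
    hence "T (2 * (- \<eta> / 2) + \<eta>) = 0" by (simp only: T_0)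
    hence nz: "T (2 * (- \<eta> / 2)) \<noteq> 0" using T_lattice_\<eta> by blast
    define s where "s = - \<eta> / 2 + \<omega> / 2"
    have "T (- \<eta> / 2) \<noteq> 0" "T s \<noteq> 0" using nz unfolding T_double s_def by auto
    note L = logderiv_uminus[OF this(1)] logderiv_uminus[OF this(2)]
    have sh: "- \<eta> / 2 + pi * \<i> = - s" "- \<eta> / 2 + \<eta> = - (- \<eta> / 2)" "- \<eta> / 2 + \<omega> / 2 = s"
      by (simp_all add: s_def field_simps)
    have "alt (- \<eta> / 2) = 0" unfolding alt_def sh L by simp
    with nz show ?thesis by (simp add: P_def)
  qed
  ultimately show ?thesis by (simp add: P_def)
qed

text \<open>Multiplying by the four theta factors of T(2z) turns \<open>alt\<close> into an entire
  function \<open>N\<close>, which is compared with \<open>D\<close> by means of Liouville's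
  theorem.\<close>

lemma alt_eq:
  assumes z: "T (2 * z) \<noteq> 0"
  shows "alt z = (qpoch q q)\<^sup>2 / T \<eta> * exp z * T (2 * z + \<eta>) / T (2 * z)"
proof -
  define N where "N = (\<lambda>z. (- T' z * T (z + pi * \<i>) * T (z + \<omega> / 2) * T (z + \<eta>)
     + T z * T' (z + pi * \<i>) * T (z + \<omega> / 2) * T (z + \<eta>)
     + T z * T (z + pi * \<i>) * T' (z + \<omega> / 2) * T (z + \<eta>)
     - T z * T (z + pi * \<i>) * T (z + \<omega> / 2) * T' (z + \<eta>)))"
  define D where "D = (\<lambda>z. exp z * T (2 * z + \<eta>))"
  have Nalt: "N z = 2 * alt z * T (2 * z)" if "T (2 * z) \<noteq> 0" for z
    using that unfolding T_double N_def alt_def lg_def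
    by (simp add: divide_simps) (simp add: algebra_simps)
  define E where "E = (\<lambda>z. exp (- z) * exp (- (z + pi * \<i>)) * exp (- (z + \<omega> / 2)) * exp (- (z + \<eta>)))"
  have sh: "z + \<omega> + t = z + t + \<omega>" "z + \<tau> + t = z + t + \<tau>" for z t by simp_all
  have N\<omega>: "N (z + \<omega>) = E z * N z" for z
    unfolding N_def E_def sh[of z] T_add_\<omega> T'_add_\<omega> by algebra
  have N\<tau>: "N (z + \<tau>) = 1 * N z" for z
    unfolding N_def sh[of z] T_add_\<tau> T'_add_\<tau> by simp
  have D\<tau>: "D (z + \<tau>) = 1 * D z" for z
  proof -
    have "D (z + \<tau>) = exp (z + \<tau>) * T (2 * z + \<eta> + \<tau> + \<tau>)" by (simp add: D_def algebra_simps)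
    thus ?thesis unfolding T_add_\<tau> exp_add_\<tau> by (simp add: D_def)
  qed
  have D\<omega>: "D (z + \<omega>) = E z * D z" for z
  proof -
    have "D (z + \<omega>) = exp (z + \<omega>) * T (2 * z + \<eta> + \<omega> + \<omega>)" by (simp add: D_def algebra_simps)
    also have "\<dots> = exp z * (exp \<omega> * exp (- (2 * z + \<eta> + \<omega>)) * exp (- (2 * z + \<eta>))) * T (2 * z + \<eta>)"
      unfolding T_add_\<omega> by (simp add: exp_add)
    also have "exp \<omega> * exp (- (2 * z + \<eta> + \<omega>)) * exp (- (2 * z + \<eta>)) = E z"
      unfolding E_def exp_add[symmetric] by (rule arg_cong[of _ _ exp]) (simp add: field_simps)
    finally show ?thesis by (simp add: D_def)
  qed
  have zero: "N z = 0 \<and> deriv D z \<noteq> 0" if "D z = 0" for z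
  proof -
    have z: "T (2 * z + \<eta>) = 0" using that by (simp add: D_def)
    have "(D has_field_derivative exp z * T (2 * z + \<eta>) + exp z * (2 * T' (2 * z + \<eta>))) (at z)"
      unfolding D_def by (auto intro!: derivative_eq_intros)
    hence "deriv D z = 2 * exp z * T' (2 * z + \<eta>)"
      using z by (simp add: DERIV_imp_deriv)
    hence "deriv D z \<noteq> 0" using T_simple_zero[OF z] by simp
    moreover have "T (2 * z) \<noteq> 0" using z T_lattice_\<eta> by blast
    moreover have "alt z = 0" using z by (rule alt_eq_0)
    ultimately show ?thesis using Nalt by simp
  qed
  have "N holomorphic_on UNIV" unfolding N_def
    by (intro holomorphic_intros holomorphic_T holomorphic_T' 
        holomorphic_on_compose_gen[OF _ holomorphic_T[of UNIV], unfolded o_def]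
        holomorphic_on_compose_gen[OF _ holomorphic_T'[of UNIV], unfolded o_def]) auto
  moreover have "D holomorphic_on UNIV" unfolding D_def
    by (intro holomorphic_intros holomorphic_on_compose_gen[OF _ holomorphic_T[of UNIV], unfolded o_def]) auto
  moreover have "E z \<noteq> 0" for z by (simp add: E_def)
  ultimately obtain c where c: "\<And>z. N z = c * D z"
    using elliptic_quotient_const[OF _ _ N\<omega> D\<omega> _ N\<tau> D\<tau>] zero by auto
  \<comment> \<open>Differentiating \<open>T_double\<close> at 0 in two ways shows that the values
    of \<open>T\<close> at the three half periods multiply to 2; this fixes the constant.\<close>
  have "c = 2 * (qpoch q q)\<^sup>2 / T \<eta>"
  proof -
    have "((\<lambda>z. T (2 * z)) has_field_derivative 2 * T' 0) (at 0)"
      by (auto intro!: derivative_eq_intros)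
    moreover have "((\<lambda>z. T (2 * z)) has_field_derivative T' 0 * (T (pi * \<i>) * T (\<omega> / 2) * T \<eta>)) (at 0)"
      unfolding T_double by (auto intro!: derivative_eq_intros)
    ultimately have "2 * T' 0 = T' 0 * (T (pi * \<i>) * T (\<omega> / 2) * T \<eta>)" by (rule DERIV_unique)
    moreover have "T' 0 \<noteq> 0" using T_simple_zero[of 0] by simp
    ultimately have R: "T (pi * \<i>) * T (\<omega> / 2) * T \<eta> = 2" by (simp add: mult.assoc)
    have "N 0 = - T' 0 * (T (pi * \<i>) * T (\<omega> / 2) * T \<eta>)" by (simp add: N_def)
    also have "\<dots> = 2 * (qpoch q q)\<^sup>2" unfolding R T'_0 by simp
    finally have "N 0 = 2 * (qpoch q q)\<^sup>2" .
    moreover have "N 0 = c * T \<eta>" using c[of 0] unfolding D_def by simp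
    moreover have "T \<eta> \<noteq> 0" using R by (metis mult_zero_right zero_neq_numeral)
    ultimately show ?thesis by (metis nonzero_mult_div_cancel_right)
  qed
  hence "2 * (alt z * T (2 * z)) = 2 * ((qpoch q q)\<^sup>2 / T \<eta> * exp z * T (2 * z + \<eta>))"
    using c[of z] Nalt[OF z] unfolding D_def by (simp add: mult.assoc)
  hence "alt z * T (2 * z) = (qpoch q q)\<^sup>2 / T \<eta> * exp z * T (2 * z + \<eta>)"
    by (metis mult_left_cancel zero_neq_numeral)
  thus ?thesis using z by (metis nonzero_mult_div_cancel_right)
qed

section \<open>Logarithmic derivatives at a half period, and the second derivative of
  \<open>alt\<close>\<close>

lemma T'_eq: "T z \<noteq> 0 \<Longrightarrow> T' z = T z * lg z"
  by (simp add: lg_def)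

text \<open>As \<open>2 * \<eta>\<close> is a lattice point, T(w - \<eta>) is a multiple of T(w +
  \<eta>). The addition formula with \<eta> thus makes (log T)'' an affine function of R = exp w T(w
  + \<eta>)^2 / T(w)^2. The left side is R' / R, and the derivative of (log T)'' is known from
  \<open>li2_series_eq\<close>.\<close>

lemma logderiv_half_period:
  assumes Z: "T Z \<noteq> 0" "T (Z + \<eta>) \<noteq> 0"
  shows "1 + 2 * lg (Z + \<eta>) - 2 * lg Z =
         (qpoch q q)\<^sup>2 * T (2 * Z) * (T \<eta>)\<^sup>2 / ((T Z)\<^sup>2 * (T (Z + \<eta>))\<^sup>2)"
proof -
  define E where "E = qpoch q q"
  have E: "E \<noteq> 0" using qpoch_q_nonzero by (simp add: E_def)
  have \<eta>: "T \<eta> \<noteq> 0" using T_lattice_\<eta>[of 0] by simp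
  have *: "wrT w / (T w)\<^sup>2 = wrT \<eta> / (T \<eta>)\<^sup>2 - E ^ 4 / (T \<eta>)\<^sup>2 * (exp w * (T (w + \<eta>))\<^sup>2 / (T w)\<^sup>2)"
    if "T w \<noteq> 0" for w
  proof -
    have "T (w + \<eta>) = T (w - \<eta> + \<omega> + \<tau>)" by (rule arg_cong[of _ _ T]) (simp add: field_simps)
    also have "\<dots> = - exp (- (w - \<eta>)) * T (w - \<eta>)" unfolding T_add_\<tau> T_add_\<omega> ..
    finally have t: "T (w + \<eta>) = - exp (- (w - \<eta>)) * T (w - \<eta>)" .
    have "exp (w - \<eta>) * exp (- (w - \<eta>)) = 1" by (simp flip: exp_add)
    hence "T (w - \<eta>) = - (exp (w - \<eta>) * T (w + \<eta>))"
      unfolding t by (metis minus_mult_minus mult.assoc mult.left_neutral mult_minus_right)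
    hence "exp \<eta> * (T (w + \<eta>) * T (w - \<eta>)) = - (exp \<eta> * exp (w - \<eta>)) * (T (w + \<eta>))\<^sup>2"
      by (simp add: power2_eq_square)
    also have "exp \<eta> * exp (w - \<eta>) = exp w" by (simp flip: exp_add)
    finally have "wrT w * (T \<eta>)\<^sup>2 - wrT \<eta> * (T w)\<^sup>2 = - (E ^ 4 * exp w * (T (w + \<eta>))\<^sup>2)"
      using T_add_diff[of w \<eta>] by (simp add: E_def mult.assoc)
    hence "wrT w * (T \<eta>)\<^sup>2 = wrT \<eta> * (T w)\<^sup>2 - E ^ 4 * exp w * (T (w + \<eta>))\<^sup>2"
      by (simp add: algebra_simps)
    thus ?thesis using that \<eta> by (simp add: divide_simps mult_ac)
  qed
  define R where "R = exp Z * (T (Z + \<eta>))\<^sup>2 / (T Z)\<^sup>2"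
  have "((\<lambda>w. exp w * (T (w + \<eta>))\<^sup>2) has_field_derivative
      exp Z * (T (Z + \<eta>))\<^sup>2 * (1 + 2 * lg (Z + \<eta>))) (at Z)"
  proof -
    have "((\<lambda>w. T (w + \<eta>)) has_field_derivative T' (Z + \<eta>) * 1) (at Z)"
      by (rule DERIV_T) (auto intro!: derivative_eq_intros)
    from DERIV_mult'[OF DERIV_exp DERIV_power[OF this, of 2]]
    show ?thesis unfolding T'_eq[OF Z(2)] by (rule DERIV_cong) (simp add: power2_eq_square, algebra)
  qed
  moreover have "((\<lambda>w. (T w)\<^sup>2) has_field_derivative (T Z)\<^sup>2 * (2 * lg Z)) (at Z)"
    by (auto intro!: derivative_eq_intros simp: T'_eq[OF Z(1)] power2_eq_square mult_ac)
  ultimately have "((\<lambda>w. exp w * (T (w + \<eta>))\<^sup>2 / (T w)\<^sup>2) has_field_derivative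
     (exp Z * (T (Z + \<eta>))\<^sup>2 * (1 + 2 * lg (Z + \<eta>)) * (T Z)\<^sup>2 -
      exp Z * (T (Z + \<eta>))\<^sup>2 * ((T Z)\<^sup>2 * (2 * lg Z))) / ((T Z)\<^sup>2 * (T Z)\<^sup>2)) (at Z)"
    using Z by (intro DERIV_divide) auto
  also have "(exp Z * (T (Z + \<eta>))\<^sup>2 * (1 + 2 * lg (Z + \<eta>)) * (T Z)\<^sup>2 -
      exp Z * (T (Z + \<eta>))\<^sup>2 * ((T Z)\<^sup>2 * (2 * lg Z))) / ((T Z)\<^sup>2 * (T Z)\<^sup>2) =
      R * (1 + 2 * lg (Z + \<eta>) - 2 * lg Z)"
  proof -
    have "(X * (1 + 2 * l) * t\<^sup>2 - X * (t\<^sup>2 * (2 * m))) / (t\<^sup>2 * t\<^sup>2) = X / t\<^sup>2 * (1 + 2 * l - 2 * m)"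
      if "t \<noteq> 0" for X l m t :: complex
      using that by (simp add: field_simps)
    from this[OF Z(1)] show ?thesis unfolding R_def .
  qed
  finally have "((\<lambda>w. wrT \<eta> / (T \<eta>)\<^sup>2 - E ^ 4 / (T \<eta>)\<^sup>2 * (exp w * (T (w + \<eta>))\<^sup>2 / (T w)\<^sup>2)) has_field_derivative
      0 - E ^ 4 / (T \<eta>)\<^sup>2 * (R * (1 + 2 * lg (Z + \<eta>) - 2 * lg Z))) (at Z)"
    by (intro DERIV_diff DERIV_const DERIV_cmult)
  moreover have "eventually (\<lambda>w. wrT w / (T w)\<^sup>2 = wrT \<eta> / (T \<eta>)\<^sup>2 -
      E ^ 4 / (T \<eta>)\<^sup>2 * (exp w * (T (w + \<eta>))\<^sup>2 / (T w)\<^sup>2)) (nhds Z)"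
    using eventually_T_nonzero[OF Z(1)] by eventually_elim (rule *)
  ultimately have "((\<lambda>w. wrT w / (T w)\<^sup>2) has_field_derivative
      0 - E ^ 4 / (T \<eta>)\<^sup>2 * (R * (1 + 2 * lg (Z + \<eta>) - 2 * lg Z))) (at Z)"
    by (rule DERIV_eventually_eq)
  from DERIV_unique[OF DERIV_wrT_div[OF Z(1)] this]
  have "E ^ 4 / (T \<eta>)\<^sup>2 * R * (1 + 2 * lg (Z + \<eta>) - 2 * lg Z) = E ^ 6 * exp Z * T (2 * Z) / T Z ^ 4"
    unfolding li2_series_eq[OF Z(1)] E_def by simp
  moreover have "E ^ 6 * exp Z * T (2 * Z) / T Z ^ 4 =
      E ^ 4 / (T \<eta>)\<^sup>2 * R * (E\<^sup>2 * T (2 * Z) * (T \<eta>)\<^sup>2 / ((T Z)\<^sup>2 * (T (Z + \<eta>))\<^sup>2))"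
    using Z \<eta> by (simp add: R_def divide_simps)
  moreover have "E ^ 4 / (T \<eta>)\<^sup>2 * R \<noteq> 0" using E \<eta> Z by (simp add: R_def)
  ultimately show ?thesis unfolding E_def by (metis mult_left_cancel)
qed

text \<open>Both sides are the second derivative of \<open>alt\<close>: the left one term by term,
  the right one as G (\<Phi>^2 + \<Phi>') from the product form \<open>G\<close> of
  \<open>alt_eq\<close> with \<Phi> = G' / G. Here \<open>logderiv_half_period\<close> gives \<Phi>,
  and the addition formula at two arguments differing by \<eta> gives \<Phi>'.\<close>

lemma alt_second_deriv:
  assumes "T (2 * z) \<noteq> 0" "T (2 * z + \<eta>) \<noteq> 0"
  shows "(li2_series z - li2_series (z + pi * \<i>) - li2_series (z + \<omega> / 2) + li2_series (z + \<eta>)) / 2 =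
    (qpoch q q)\<^sup>2 / T \<eta> * exp z * T (2 * z + \<eta>) / T (2 * z) *
      (((qpoch q q)\<^sup>2 * T (4 * z) * (T \<eta>)\<^sup>2 / ((T (2 * z))\<^sup>2 * (T (2 * z + \<eta>))\<^sup>2))\<^sup>2 +
       4 * (qpoch q q ^ 4 * exp (2 * z) * T (4 * z + \<eta>) * T \<eta> / ((T (2 * z + \<eta>))\<^sup>2 * (T (2 * z))\<^sup>2)))"
proof -
  define E where "E = qpoch q q"
  define B where "B = (\<lambda>z. wrT z / (T z)\<^sup>2)"
  have lg: "(lg has_field_derivative B z) (at z)" if "T z \<noteq> 0" for z
    using DERIV_logderiv[OF that] by (simp add: lg_def[abs_def] B_def)
  have B: "(B has_field_derivative - li2_series z) (at z)" if "T z \<noteq> 0" for z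
    using DERIV_wrT_div[OF that] by (simp add: B_def)
  have lg': "((\<lambda>z. lg (z + t)) has_field_derivative B (z + t)) (at z)" if "T (z + t) \<noteq> 0" for z t
    using lg[OF that] by (simp add: DERIV_shift)
  have B': "((\<lambda>z. B (z + t)) has_field_derivative - li2_series (z + t)) (at z)" if "T (z + t) \<noteq> 0" for z t
    using B[OF that] by (simp add: DERIV_shift)
  define B4 where "B4 = (\<lambda>z. (- B z + B (z + pi * \<i>) + B (z + \<omega> / 2) - B (z + \<eta>)) / 2)"
  define \<Phi> where "\<Phi> = (\<lambda>z. 1 + 2 * lg (2 * z + \<eta>) - 2 * lg (2 * z))"
  have nz: "T z \<noteq> 0" "T (z + pi * \<i>) \<noteq> 0" "T (z + \<omega> / 2) \<noteq> 0" "T (z + \<eta>) \<noteq> 0" if "T (2 * z) \<noteq> 0" for z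
    using that by (auto simp: T_double)
  have alt': "(alt has_field_derivative B4 z) (at z)" if "T (2 * z) \<noteq> 0" for z
    using DERIV_cdivide[OF DERIV_diff[OF DERIV_add[OF DERIV_add[OF DERIV_minus[OF lg[OF nz(1)]]
        lg'[OF nz(2)]] lg'[OF nz(3)]] lg'[OF nz(4)]], OF that that that that, of 2]
    unfolding alt_def[abs_def] B4_def by simp
  have B4': "(B4 has_field_derivative (li2_series z - li2_series (z + pi * \<i>) - li2_series (z + \<omega> / 2) + li2_series (z + \<eta>)) / 2) (at z)"
    if "T (2 * z) \<noteq> 0" for z
    using DERIV_cdivide[OF DERIV_diff[OF DERIV_add[OF DERIV_add[OF DERIV_minus[OF B[OF nz(1)]]
        B'[OF nz(2)]] B'[OF nz(3)]] B'[OF nz(4)]], OF that that that that, of 2]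
    unfolding B4_def by simp
  define c where "c = E\<^sup>2 / T \<eta>"
  define G where "G = (\<lambda>z. c * exp z * T (2 * z + \<eta>) / T (2 * z))"
  define U where "U = {z. T (2 * z) \<noteq> 0} \<inter> {z. T (2 * z + \<eta>) \<noteq> 0}"
  have "open U" unfolding U_def
    by (intro open_Int open_Collect_neq holomorphic_on_imp_continuous_on continuous_on_const
        holomorphic_on_compose_gen[OF _ holomorphic_T[of UNIV], unfolded o_def] holomorphic_intros) auto
  hence evU: "eventually (\<lambda>w. w \<in> U) (nhds w)" if "w \<in> U" for w
    using that by (rule eventually_nhds_in_open)
  have altG: "alt w = G w" if "w \<in> U" for w
    using alt_eq[of w] that by (simp add: G_def c_def E_def U_def)
  have G': "(G has_field_derivative G w * \<Phi> w) (at w)" if "w \<in> U" for w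
  proof -
    have n: "T (2 * w) \<noteq> 0" "T (2 * w + \<eta>) \<noteq> 0" using that by (auto simp: U_def)
    have "((\<lambda>z. c * exp z * T (2 * z + \<eta>)) has_field_derivative 
       c * exp w * T (2 * w + \<eta>) * (1 + 2 * lg (2 * w + \<eta>))) (at w)"
    proof -
      have "((\<lambda>z. c * exp z * T (2 * z + \<eta>)) has_field_derivative
          c * exp w * T (2 * w + \<eta>) + c * exp w * (T' (2 * w + \<eta>) * 2)) (at w)"
      proof -
        have "((\<lambda>z. 2 * z + \<eta>) has_field_derivative 2) (at w)" by (auto intro!: derivative_eq_intros)
        from DERIV_mult'[OF DERIV_cmult[OF DERIV_exp, of c] DERIV_T[OF this]]
        show ?thesis by (simp only: add.commute)
      qed
      thus ?thesis unfolding T'_eq[OF n(2)] by (rule DERIV_cong) algebra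
    qed
    moreover have "((\<lambda>z. T (2 * z)) has_field_derivative T (2 * w) * (2 * lg (2 * w))) (at w)"
      by (auto intro!: derivative_eq_intros simp: T'_eq[OF n(1)])
    ultimately have "(G has_field_derivative (c * exp w * T (2 * w + \<eta>) * (1 + 2 * lg (2 * w + \<eta>)) * T (2 * w) - 
         c * exp w * T (2 * w + \<eta>) * (T (2 * w) * (2 * lg (2 * w)))) / (T (2 * w) * T (2 * w))) (at w)"
      unfolding G_def using n by (intro DERIV_divide)
    also have "(c * exp w * T (2 * w + \<eta>) * (1 + 2 * lg (2 * w + \<eta>)) * T (2 * w) - 
         c * exp w * T (2 * w + \<eta>) * (T (2 * w) * (2 * lg (2 * w)))) / (T (2 * w) * T (2 * w)) = G w * \<Phi> w"
      using n by (simp add: G_def \<Phi>_def divide_simps) (simp add: algebra_simps)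
    finally show ?thesis .
  qed
  have B4G: "B4 w = G w * \<Phi> w" if "w \<in> U" for w
  proof (rule DERIV_unique)
    show "(alt has_field_derivative B4 w) (at w)" using that by (intro alt') (auto simp: U_def)
    show "(alt has_field_derivative G w * \<Phi> w) (at w)"
      using G'[OF that] by (rule DERIV_eventually_eq) (use evU[OF that] altG in \<open>auto elim: eventually_mono\<close>)
  qed
  have z: "z \<in> U" using assms by (simp add: U_def)
  have \<Phi>': "(\<Phi> has_field_derivative 4 * (B (2 * z + \<eta>) - B (2 * z))) (at z)"
  proof -
    have "((\<lambda>z. lg (2 * z + \<eta>)) has_field_derivative B (2 * z + \<eta>) * 2) (at z)"
      by (rule DERIV_chain2[where g = "\<lambda>z. 2 * z + \<eta>", OF lg[OF assms(2)]]) (auto intro!: derivative_eq_intros)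
    moreover have "((\<lambda>z. lg (2 * z)) has_field_derivative B (2 * z) * 2) (at z)"
      by (rule DERIV_chain2[where g = "\<lambda>z. 2 * z", OF lg[OF assms(1)]]) (auto intro!: derivative_eq_intros)
    ultimately have "(\<Phi> has_field_derivative 0 + 2 * (B (2 * z + \<eta>) * 2) - 2 * (B (2 * z) * 2)) (at z)"
      unfolding \<Phi>_def by (intro DERIV_diff DERIV_add DERIV_const DERIV_cmult)
    thus ?thesis by (simp add: algebra_simps)
  qed
  have "(B4 has_field_derivative G z * \<Phi> z * \<Phi> z + 4 * (B (2 * z + \<eta>) - B (2 * z)) * G z) (at z)"
    by (rule DERIV_eventually_eq[OF DERIV_mult[OF G'[OF z] \<Phi>']])
       (use evU[OF z] B4G in \<open>auto elim: eventually_mono\<close>)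
  note eq = DERIV_unique[OF B4'[OF assms(1)] this]
  have "(li2_series z - li2_series (z + pi * \<i>) - li2_series (z + \<omega> / 2) + li2_series (z + \<eta>)) / 2 =
     G z * ((\<Phi> z)\<^sup>2 + 4 * (B (2 * z + \<eta>) - B (2 * z)))"
    unfolding eq by algebra
  moreover have "\<Phi> z = E\<^sup>2 * T (4 * z) * (T \<eta>)\<^sup>2 / ((T (2 * z))\<^sup>2 * (T (2 * z + \<eta>))\<^sup>2)"
    using logderiv_half_period[OF assms] by (simp add: \<Phi>_def E_def)
  moreover have "B (2 * z + \<eta>) - B (2 * z) =
      E ^ 4 * exp (2 * z) * T (4 * z + \<eta>) * T \<eta> / ((T (2 * z + \<eta>))\<^sup>2 * (T (2 * z))\<^sup>2)"
  proof -
    have "2 * z + \<eta> + 2 * z = 4 * z + \<eta>" "2 * z + \<eta> - 2 * z = \<eta>" by simp_all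
    with T_add_diff[of "2 * z + \<eta>" "2 * z"]
    have "wrT (2 * z + \<eta>) * (T (2 * z))\<^sup>2 = wrT (2 * z) * (T (2 * z + \<eta>))\<^sup>2 +
       E ^ 4 * exp (2 * z) * T (4 * z + \<eta>) * T \<eta>" by (simp add: E_def algebra_simps)
    thus ?thesis using assms unfolding B_def by (simp add: divide_simps)
  qed
  ultimately show ?thesis by (simp add: G_def c_def E_def)
qed

end

section \<open>The triple product and Jacobi's identity\<close>

definition tri :: "nat \<Rightarrow> nat" where "tri n = n * (n + 1) div 2"

lemma two_tri: "2 * tri n = n * (n + 1)"
  by (simp add: tri_def)

lemma tri_0 [simp]: "tri 0 = 0" and tri_Suc [simp]: "tri (Suc n) = tri n + Suc n"
  using two_tri[of n] two_tri[of "Suc n"] by (simp_all add: tri_def)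

text \<open>Together with \<open>tri_diff\<close> this matches the exponents of the terms N + k and
  N - k in the finite triple product.\<close>

lemma tri_add: "tri (N + k) + tri N = N * (N + Suc k) + tri k"
proof -
  have "2 * (tri (N + k) + tri N) = 2 * (N * (N + Suc k) + tri k)"
    unfolding distrib_left two_tri by (simp add: algebra_simps)
  thus ?thesis by simp
qed

lemma tri_diff: "k \<le> N \<Longrightarrow> tri (N - k) + tri N + k = N * (N - k + 1) + tri k"
proof -
  assume "k \<le> N"
  then obtain d where d: "N = d + k" by (metis le_add_diff_inverse2)
  have "2 * (tri d + tri (d + k) + k) = 2 * ((d + k) * (d + 1) + tri k)"
    unfolding distrib_left two_tri by (simp add: algebra_simps)
  thus ?thesis by (simp add: d)
qed

lemma tri_ge: "n \<le> tri n"
  by (induction n) auto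

definition fin_qpoch :: "complex \<Rightarrow> nat \<Rightarrow> complex" where
  "fin_qpoch q n = (\<Prod>i<n. 1 - q ^ Suc i)"

section \<open>Gaussian binomials and the finite triple product\<close>

context nome
begin

abbreviation Q :: "nat \<Rightarrow> complex" where "Q \<equiv> fin_qpoch q"

lemma Q_0 [simp]: "Q 0 = 1" and Q_Suc [simp]: "Q (Suc n) = Q n * (1 - q ^ Suc n)"
  by (simp_all add: fin_qpoch_def)

lemma Q_nonzero: "Q n \<noteq> 0"
  using power_ne_1 by (auto simp: fin_qpoch_def simp del: power_Suc)

lemma Q_LIMSEQ: "Q \<longlonglongrightarrow> qpoch q q"
  using qpoch_LIMSEQ[OF lt1, of q] by (simp add: fin_qpoch_def[abs_def])

text \<open>The Gaussian binomial coefficient, the coefficient in Rothe's q-binomial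
  theorem.\<close>

definition qbinom :: "nat \<Rightarrow> nat \<Rightarrow> complex" where
  "qbinom M j = (if j \<le> M then Q M / (Q j * Q (M - j)) else 0)"

lemma qbinom_Suc_Suc:
  "qbinom (Suc M) (Suc j) = qbinom M (Suc j) + (if j \<le> M then q ^ (M - j) else 0) * qbinom M j"
proof -
  consider "j > M" | "j = M" | d where "M = Suc (j + d)"
    by (metis add_Suc_right less_imp_Suc_add linorder_neqE_nat)
  thus ?thesis
  proof cases
    case 3
    define a b where "a = q ^ Suc j" and "b = q ^ Suc d"
    have ab: "a \<noteq> 1" "b \<noteq> 1" using power_ne_1 by (simp_all add: a_def b_def del: power_Suc)
    have "a * b = q ^ Suc (Suc (j + d))" by (simp add: a_def b_def power_add)
    hence Q: "Q (Suc M) = Q M * (1 - a * b)" "Q (Suc j) = Q j * (1 - a)" "Q (Suc d) = Q d * (1 - b)"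
      by (simp_all only: Q_Suc 3 a_def b_def)
    have m: "M - j = Suc d" "Suc M - Suc j = Suc d" "M - Suc j = d" "Suc j \<le> Suc M" "Suc j \<le> M" "j \<le> M"
      using 3 by auto
    have "Q M * (1 - a * b) / (Q j * (1 - a) * (Q d * (1 - b))) =
        Q M / (Q j * (1 - a) * Q d) + b * (Q M / (Q j * (Q d * (1 - b))))"
      using ab Q_nonzero[of j] Q_nonzero[of d] by (simp add: divide_simps) (simp add: algebra_simps)
    thus ?thesis unfolding qbinom_def m Q if_True using m by (simp add: b_def)
  qed (use Q_nonzero power_ne_1[of M] in \<open>auto simp: qbinom_def\<close>)
qed

text \<open>Induction by the q-Pascal rule. The exponent \<open>tri j - j\<close> is j (j - 1) / 2
  and becomes \<open>tri j\<close> when the index is shifted by one.\<close>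

lemma Rothe: "(\<Prod>k<M. 1 + y * q ^ k) = (\<Sum>j\<le>M. qbinom M j * q ^ (tri j - j) * y ^ j)"
proof (induction M)
  case (Suc M)
  have "(\<Prod>k<Suc M. 1 + y * q ^ k) =
      (\<Sum>j\<le>M. qbinom M j * q ^ (tri j - j) * y ^ j) +
      (\<Sum>j\<le>M. qbinom M j * q ^ (tri j - j) * y ^ j * (y * q ^ M))"
    by (simp add: Suc.IH algebra_simps sum_distrib_left sum_distrib_right sum.distrib)
  also have "(\<Sum>j\<le>M. qbinom M j * q ^ (tri j - j) * y ^ j) =
      qbinom (Suc M) 0 + (\<Sum>j\<le>M. qbinom M (Suc j) * q ^ tri j * y ^ Suc j)"
  proof -
    have "(\<Sum>j\<le>M. qbinom M j * q ^ (tri j - j) * y ^ j) = (\<Sum>j\<le>Suc M. qbinom M j * q ^ (tri j - j) * y ^ j)"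
      by (simp add: qbinom_def)
    also have "\<dots> = qbinom M 0 + (\<Sum>j\<le>M. qbinom M (Suc j) * q ^ tri j * y ^ Suc j)"
      by (subst sum.atMost_Suc_shift) simp
    finally show ?thesis using Q_nonzero by (simp add: qbinom_def del: Q_Suc)
  qed
  also have "(\<Sum>j\<le>M. qbinom M j * q ^ (tri j - j) * y ^ j * (y * q ^ M)) =
      (\<Sum>j\<le>M. q ^ (M - j) * qbinom M j * q ^ tri j * y ^ Suc j)"
  proof (intro sum.cong refl)
    fix j assume "j \<in> {..M}"
    hence "tri j - j + M = M - j + tri j" using tri_ge[of j] by simp
    hence "q ^ (tri j - j) * q ^ M = q ^ (M - j) * q ^ tri j" by (metis power_add)
    thus "qbinom M j * q ^ (tri j - j) * y ^ j * (y * q ^ M) = q ^ (M - j) * qbinom M j * q ^ tri j * y ^ Suc j"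
      by (simp add: algebra_simps)
  qed
  also have "qbinom (Suc M) 0 + (\<Sum>j\<le>M. qbinom M (Suc j) * q ^ tri j * y ^ Suc j) +
     (\<Sum>j\<le>M. q ^ (M - j) * qbinom M j * q ^ tri j * y ^ Suc j) =
     qbinom (Suc M) 0 + (\<Sum>j\<le>M. qbinom (Suc M) (Suc j) * q ^ tri j * y ^ Suc j)"
    by (simp add: qbinom_Suc_Suc sum.distrib algebra_simps)
  also have "\<dots> = (\<Sum>j\<le>Suc M. qbinom (Suc M) j * q ^ (tri j - j) * y ^ j)"
    by (subst sum.atMost_Suc_shift) simp
  finally show ?case .
qed (simp add: qbinom_def)

definition jcoeff :: "nat \<Rightarrow> nat \<Rightarrow> complex" where
  "jcoeff N k = (if k \<le> N then Q (2 * N) / (Q (N + k) * Q (N - k)) else 0)"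

text \<open>The terms \<open>k\<close> and \<open>- k\<close> of the bilateral theta series taken
  together, as the coefficients \<open>jcoeff\<close> are symmetric about the middle.\<close>

definition jterm :: "complex \<Rightarrow> nat \<Rightarrow> complex" where
  "jterm x k = (if k = 0 then 1 else (- x) ^ k * q ^ (tri k - k) + (- 1 / x) ^ k * q ^ tri k)"

text \<open>Rothe's formula for 2N factors, with the variable scaled by q^(-N) and the index
  recentred at N. The upper half of the factors is the first product; the lower half becomes the
  second after the monomial 1 / \<open>c\<close> is extracted.\<close>

lemma finite_triple_product:
  assumes "x \<noteq> 0"
  shows "(\<Prod>k<N. 1 - x * q ^ k) * (\<Prod>k<N. 1 - q / x * q ^ k) = (\<Sum>k\<le>N. jcoeff N k * jterm x k)"
proof -
  define y where "y = - x / q ^ N"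
  define g where "g = (\<lambda>j. qbinom (2 * N) j * q ^ (tri j - j) * y ^ j)"
  define c where "c = q ^ tri N / (- x) ^ N"
  have y: "y ^ j = (- x) ^ j / (q ^ N) ^ j" for j
    unfolding y_def by (rule power_divide)
  have c1: "c * g (N + k) = jcoeff N k * ((- x) ^ k * q ^ (tri k - k))" if "k \<le> N" for k
  proof -
    have e: "tri N + (tri (N + k) - (N + k)) = N * (N + k) + (tri k - k)"
      using tri_add[of N k] tri_ge[of "N + k"] tri_ge[of k] by simp
    have "q ^ tri N * q ^ (tri (N + k) - (N + k)) = (q ^ N) ^ (N + k) * q ^ (tri k - k)"
      by (metis e power_add power_mult)
    hence "c * g (N + k) * ((- x) ^ N * (q ^ N) ^ (N + k)) = 
       jcoeff N k * ((- x) ^ k * q ^ (tri k - k)) * ((- x) ^ N * (q ^ N) ^ (N + k))"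
      using that assms nz by (simp add: c_def g_def y jcoeff_def qbinom_def power_add[of "- x"] mult_ac mult_2)
    thus ?thesis using assms nz by simp
  qed
  have c2: "c * g (N - k) = jcoeff N k * ((- 1 / x) ^ k * q ^ tri k)" if "k \<le> N" for k
  proof -
    have e: "tri N + (tri (N - k) - (N - k)) = N * (N - k) + tri k"
      using tri_diff[OF that] tri_ge[of "N - k"] that by simp
    have "q ^ tri N * q ^ (tri (N - k) - (N - k)) = (q ^ N) ^ (N - k) * q ^ tri k"
      by (metis e power_add power_mult)
    moreover have "(- x) ^ (N - k) = (- x) ^ N * (- 1 / x) ^ k"
    proof -
      have "(- x) ^ N = (- x) ^ (N - k) * (- x) ^ k" using that by (simp flip: power_add)
      moreover have "(- x) ^ k * (- 1 / x) ^ k = 1" using assms by (simp flip: power_mult_distrib)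
      ultimately show ?thesis by (simp add: mult.assoc)
    qed
    ultimately have "c * g (N - k) * ((- x) ^ N * (q ^ N) ^ (N - k)) = 
       jcoeff N k * ((- 1 / x) ^ k * q ^ tri k) * ((- x) ^ N * (q ^ N) ^ (N - k))"
      using that assms nz by (simp add: c_def g_def y jcoeff_def qbinom_def mult_ac mult_2)
    thus ?thesis using assms nz by simp
  qed
  have "(\<Prod>k<2*N. 1 + y * q ^ k) = (\<Prod>k<N. 1 + y * q ^ k) * (\<Prod>k<N. 1 + y * q ^ (k + N))"
    using prod.atLeastLessThan_concat[of 0 N "N + N" "\<lambda>k. 1 + y * q ^ k"]
      prod.shift_bounds_nat_ivl[of "\<lambda>k. 1 + y * q ^ k" 0 N N]
    by (simp add: mult_2 lessThan_atLeast0)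
  also have "(\<Prod>k<N. 1 + y * q ^ (k + N)) = (\<Prod>k<N. 1 - x * q ^ k)"
    using nz by (simp add: y_def power_add)
  also have "(\<Prod>k<N. 1 + y * q ^ k) = (\<Prod>k<N. (- x / q ^ Suc k) * (1 - q / x * q ^ k))"
  proof (subst prod.nat_diff_reindex[symmetric], intro prod.cong refl)
    fix k assume "k \<in> {..<N}"
    hence "q ^ N = q ^ (N - Suc k) * q ^ Suc k" by (simp only: power_add[symmetric]) simp
    thus "1 + y * q ^ (N - Suc k) = (- x / q ^ Suc k) * (1 - q / x * q ^ k)"
      using nz assms by (simp add: y_def field_simps)
  qed
  also have "\<dots> = (\<Prod>k<N. - x / q ^ Suc k) * (\<Prod>k<N. 1 - q / x * q ^ k)"
    by (rule prod.distrib)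
  also have "(\<Prod>k<N. - x / q ^ Suc k) = 1 / c"
  proof -
    have "(\<Prod>k<n. - x / q ^ Suc k) = (- x) ^ n / q ^ tri n" for n
      by (induction n) (simp_all add: power_add mult_ac)
    thus ?thesis by (simp add: c_def)
  qed
  finally have "(\<Prod>k<N. 1 - x * q ^ k) * (\<Prod>k<N. 1 - q / x * q ^ k) = c * (\<Prod>k<2*N. 1 + y * q ^ k)"
    using nz assms by (simp add: c_def)
  also have "(\<Prod>k<2*N. 1 + y * q ^ k) = (\<Sum>j\<le>2*N. g j)"
    unfolding g_def by (rule Rothe)
  also have "(\<Sum>j\<le>2*N. g j) = g N + (\<Sum>k=1..N. g (N + k) + g (N - k))"
  proof -
    have "{..2*N} = {..<N} \<union> {N} \<union> {N<..2*N}" by auto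
    hence "(\<Sum>j\<le>2*N. g j) = (\<Sum>j<N. g j) + g N + (\<Sum>j\<in>{N<..2*N}. g j)"
      by (simp only:) (subst sum.union_disjoint; auto)+
    also have "(\<Sum>j\<in>{N<..2*N}. g j) = (\<Sum>k=1..N. g (N + k))"
      by (rule sum.reindex_bij_witness[of _ "\<lambda>k. N + k" "\<lambda>j. j - N"]) auto
    also have "(\<Sum>j<N. g j) = (\<Sum>k=1..N. g (N - k))"
      by (rule sum.reindex_bij_witness[of _ "\<lambda>k. N - k" "\<lambda>j. N - j"]) auto
    finally show ?thesis by (simp add: sum.distrib)
  qed
  also have "c * (g N + (\<Sum>k=1..N. g (N + k) + g (N - k))) = c * g N + (\<Sum>k=1..N. c * g (N + k) + c * g (N - k))"
    by (simp add: algebra_simps sum_distrib_left sum.distrib)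
  also have "c * g N = jcoeff N 0 * jterm x 0"
    using c1[of 0] by (simp add: jterm_def)
  also have "(\<Sum>k=1..N. c * g (N + k) + c * g (N - k)) = (\<Sum>k=1..N. jcoeff N k * jterm x k)"
    by (intro sum.cong) (auto simp: jterm_def distrib_left c1 c2)
  also have "jcoeff N 0 * jterm x 0 + \<dots> = (\<Sum>k\<le>N. jcoeff N k * jterm x k)"
    by (simp add: atMost_atLeast0 sum.atLeast_Suc_atMost)
  finally show ?thesis .
qed

section \<open>Passage to the infinite triple product\<close>

lemma jcoeff_LIMSEQ: "(\<lambda>N. jcoeff N k) \<longlonglongrightarrow> 1 / qpoch q q"
proof -
  have "filterlim (\<lambda>N. 2 * N) sequentially sequentially" "filterlim (\<lambda>N. N + k) sequentially sequentially"
     "filterlim (\<lambda>N. N - k) sequentially sequentially"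
    by real_asymp+
  from this[THEN filterlim_compose[OF Q_LIMSEQ]]
  have "(\<lambda>N. Q (2 * N) / (Q (N + k) * Q (N - k))) \<longlonglongrightarrow> qpoch q q / (qpoch q q * qpoch q q)"
    using qpoch_q_nonzero by (intro tendsto_intros) auto
  moreover have "eventually (\<lambda>N. Q (2 * N) / (Q (N + k) * Q (N - k)) = jcoeff N k) sequentially"
    using eventually_ge_at_top[of k] by eventually_elim (simp add: jcoeff_def)
  ultimately show ?thesis using qpoch_q_nonzero by (simp add: Lim_transform_eventually)
qed

lemma jcoeff_bounded: obtains B where "\<And>N k. norm (jcoeff N k) \<le> B"
proof -
  have "Bseq Q" using Q_LIMSEQ by (rule convergent_imp_Bseq[OF convergentI])
  then obtain B1 where B1: "B1 > 0" "\<And>n. norm (Q n) \<le> B1" by (auto simp: Bseq_def)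
  have "(\<lambda>n. inverse (Q n)) \<longlonglongrightarrow> inverse (qpoch q q)"
    using Q_LIMSEQ qpoch_q_nonzero by (rule tendsto_inverse)
  hence "Bseq (\<lambda>n. inverse (Q n))" by (rule convergent_imp_Bseq[OF convergentI])
  then obtain B2 where B2: "B2 > 0" "\<And>n. norm (inverse (Q n)) \<le> B2" by (auto simp: Bseq_def)
  have "norm (jcoeff N k) \<le> B1 * (B2 * B2)" for N k
  proof (cases "k \<le> N")
    case True
    hence "norm (jcoeff N k) = norm (Q (2 * N)) * (norm (inverse (Q (N + k))) * norm (inverse (Q (N - k))))"
      by (simp add: jcoeff_def norm_divide norm_mult norm_inverse divide_inverse)
    also have "\<dots> \<le> B1 * (B2 * B2)" using B1 B2 by (intro mult_mono) auto
    finally show ?thesis .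
  qed (use B1 B2 in \<open>simp add: jcoeff_def\<close>)
  thus ?thesis by (rule that)
qed

text \<open>Tannery's theorem. The sequence \<open>v\<close> is arbitrary because the lemma serves
  both the triple product and its derivative at 1.\<close>

lemma jcoeff_sum_LIMSEQ:
  assumes "summable (\<lambda>k. norm (v k))"
  shows "(\<lambda>N. \<Sum>k\<le>N. jcoeff N k * v k) \<longlonglongrightarrow> (\<Sum>k. v k) / qpoch q q"
proof -
  obtain B where B: "\<And>N k. norm (jcoeff N k) \<le> B" using jcoeff_bounded by blast
  have "(\<lambda>N. suminf (\<lambda>k. jcoeff N k * v k)) \<longlonglongrightarrow> suminf (\<lambda>k. 1 / qpoch q q * v k)"
  proof (rule tannerys_theorem[THEN conjunct2, THEN conjunct2])
    show "(\<lambda>N. jcoeff N k * v k) \<longlonglongrightarrow> 1 / qpoch q q * v k" for k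
      by (intro tendsto_intros jcoeff_LIMSEQ)
    show "\<forall>\<^sub>F (k, N) in at_top \<times>\<^sub>F sequentially. norm (jcoeff N k * v k) \<le> B * norm (v k)"
      by (rule always_eventually) (auto simp: norm_mult intro!: mult_right_mono B)
    show "summable (\<lambda>k. B * norm (v k))" using assms by (rule summable_mult)
  qed auto
  moreover have "suminf (\<lambda>k. jcoeff N k * v k) = (\<Sum>k\<le>N. jcoeff N k * v k)" for N
    by (rule suminf_finite) (auto simp: jcoeff_def)
  ultimately show ?thesis
    using suminf_mult[OF summable_norm_cancel[OF assms], of "1 / qpoch q q"] by simp
qed

text \<open>The factor \<open>k\<close> provides for the differentiated series. From
  \<open>K\<close> on the ratio is at most 2 * 1/4, since quadratic exponents beat the growth of
  A^k.\<close>

lemma summable_tri: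
  assumes "0 \<le> A"
  shows "summable (\<lambda>k. real k * (A ^ k * norm q ^ tri k))"
proof -
  define r where "r = norm q"
  have r: "0 < r" "r < 1" using nz lt1 by (auto simp: r_def)
  have "(\<lambda>k. A * r ^ k) \<longlonglongrightarrow> A * 0"
    using r by (intro tendsto_intros LIMSEQ_power_zero) auto
  hence "eventually (\<lambda>k. A * r ^ k < 1 / 4) sequentially"
    by (rule order_tendstoD) simp
  then obtain K where K: "\<And>k. k \<ge> K \<Longrightarrow> A * r ^ k < 1 / 4" by (auto simp: eventually_at_top_linorder)
  show ?thesis unfolding r_def[symmetric]
  proof (rule summable_ratio_test[where c = "1/2" and N = "max 1 K"])
    fix k assume k: "max 1 K \<le> k"
    have "real (Suc k) * (A ^ Suc k * r ^ tri (Suc k)) = real (Suc k) * (A * r ^ Suc k) * (A ^ k * r ^ tri k)"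
      by (simp add: power_add mult_ac)
    also have "\<dots> \<le> (2 * real k) * (1 / 4) * (A ^ k * r ^ tri k)"
      using k K[of "Suc k"] r assms by (intro mult_mono mult_nonneg_nonneg) auto
    finally show "norm (real (Suc k) * (A ^ Suc k * r ^ tri (Suc k))) \<le> 1 / 2 * norm (real k * (A ^ k * r ^ tri k))"
      using r assms by (simp add: abs_mult)
  qed simp
qed

lemma summable_jterm:
  shows "summable (\<lambda>k. real k * norm (a ^ k * q ^ tri k))" "summable (\<lambda>k. norm (a ^ k * q ^ tri k))"
    "summable (\<lambda>k. real k * norm (a ^ k * q ^ (tri k - k)))" "summable (\<lambda>k. norm (a ^ k * q ^ (tri k - k)))"
proof -
  have 1: "summable (\<lambda>k. real k * norm (a ^ k * q ^ tri k))" for a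
    using summable_tri[of "norm a"] by (simp add: norm_mult norm_power)
  have 2: "summable (\<lambda>k. norm (a ^ k * q ^ tri k))" for a
    by (rule summable_comparison_test_ev[OF _ 1[of a]], rule eventually_mono[OF eventually_ge_at_top[of 1]])
       (auto simp: mult_le_cancel_right1)
  have eq: "a ^ k * q ^ (tri k - k) = (a / q) ^ k * q ^ tri k" for k
  proof -
    have "q ^ tri k = q ^ (tri k - k) * q ^ k" using tri_ge[of k] by (simp flip: power_add)
    thus ?thesis using nz by (simp add: power_divide)
  qed
  show "summable (\<lambda>k. real k * norm (a ^ k * q ^ tri k))" "summable (\<lambda>k. norm (a ^ k * q ^ tri k))"
    "summable (\<lambda>k. real k * norm (a ^ k * q ^ (tri k - k)))" "summable (\<lambda>k. norm (a ^ k * q ^ (tri k - k)))"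
    unfolding eq by (rule 1 2)+
qed

lemma jterm_altdef: "jterm x k = (- x) ^ k * q ^ (tri k - k) + (if k = 0 then 0 else (- 1 / x) ^ k * q ^ tri k)"
  by (simp add: jterm_def)

theorem triple_product:
  assumes "x \<noteq> 0"
  shows "(\<Sum>k. (- x) ^ k * q ^ (tri k - k)) + (\<Sum>k. (- 1 / x) ^ Suc k * q ^ tri (Suc k)) = qpoch q q * theta x q"
proof -
  define A where "A = (\<lambda>k. (- x) ^ k * q ^ (tri k - k))"
  define B where "B = (\<lambda>k. if k = 0 then 0 else (- 1 / x) ^ k * q ^ tri k)"
  have sA: "summable (\<lambda>k. norm (A k))" unfolding A_def by (rule summable_jterm)
  have sB: "summable (\<lambda>k. norm (B k))"
    by (rule summable_comparison_test'[OF summable_jterm(2)[of "- 1 / x"], of 0]) (simp add: B_def)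
  have sj: "summable (\<lambda>k. norm (jterm x k))"
    by (rule summable_comparison_test'[OF summable_add[OF sA sB], of 0])
       (unfold jterm_altdef, auto simp: A_def B_def intro: norm_triangle_ineq)
  have "(\<lambda>N. (\<Prod>k<N. 1 - x * q ^ k) * (\<Prod>k<N. 1 - q / x * q ^ k)) \<longlonglongrightarrow> theta x q"
    unfolding theta_def by (intro tendsto_mult qpoch_LIMSEQ lt1)
  moreover have "(\<lambda>N. (\<Prod>k<N. 1 - x * q ^ k) * (\<Prod>k<N. 1 - q / x * q ^ k)) \<longlonglongrightarrow> (\<Sum>k. jterm x k) / qpoch q q"
    unfolding finite_triple_product[OF assms] by (rule jcoeff_sum_LIMSEQ[OF sj])
  ultimately have "theta x q = (\<Sum>k. jterm x k) / qpoch q q" by (rule LIMSEQ_unique)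
  moreover have "(\<Sum>k. jterm x k) = (\<Sum>k. A k) + (\<Sum>k. B k)"
    using suminf_add[OF summable_norm_cancel[OF sA] summable_norm_cancel[OF sB]]
    by (simp add: jterm_altdef[abs_def] A_def B_def)
  moreover have "(\<Sum>k. B k) = (\<Sum>k. B (Suc k))"
    using suminf_split_head[OF summable_norm_cancel[OF sB]] by (simp add: B_def)
  ultimately show ?thesis using qpoch_q_nonzero by (simp add: A_def B_def)
qed

lemma has_sum_triple_product:
  assumes "x \<noteq> 0"
  shows "((\<lambda>n::int. (- x) powi n * q ^ nat (n * (n - 1) div 2)) has_sum qpoch q q * theta x q) UNIV"
proof -
  define f where "f = (\<lambda>n::int. (- x) powi n * q ^ nat (n * (n - 1) div 2))"
  have fA: "f (int k) = (- x) ^ k * q ^ (tri k - k)" for k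
  proof -
    have "2 * int (tri k) = int k * (int k + 1)"
      using arg_cong[OF two_tri[of k], of int] by (simp add: algebra_simps)
    hence "int k * (int k - 1) = 2 * (int (tri k) - int k)" by (simp add: algebra_simps)
    hence "nat (int k * (int k - 1) div 2) = tri k - k" using tri_ge[of k] by simp
    thus ?thesis by (simp add: f_def)
  qed
  have fB: "f (- int (Suc k)) = (- 1 / x) ^ Suc k * q ^ tri (Suc k)" for k
  proof -
    have "2 * int (tri (Suc k)) = int (Suc k) * (int (Suc k) + 1)"
      using arg_cong[OF two_tri[of "Suc k"], of int] by (simp add: algebra_simps)
    hence "(- int (Suc k)) * (- int (Suc k) - 1) = 2 * int (tri (Suc k))" by (simp add: algebra_simps)
    hence "nat ((- int (Suc k)) * (- int (Suc k) - 1) div 2) = tri (Suc k)" by simp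
    moreover have "(- x) powi (- int (Suc k)) = (- 1 / x) ^ Suc k"
    proof -
      have "- 1 / x = inverse (- x)" by (simp add: divide_inverse)
      thus ?thesis by (simp only: power_int_minus power_int_of_nat power_inverse)
    qed
    ultimately show ?thesis unfolding f_def by simp
  qed
  have sB: "summable (\<lambda>k. norm ((- 1 / x) ^ Suc k * q ^ tri (Suc k)))"
    by (rule iffD2[OF summable_Suc_iff[of "\<lambda>k. norm ((- 1 / x) ^ k * q ^ tri k)"] summable_jterm(2)])
  have "((\<lambda>k. f (- int (Suc k))) has_sum (\<Sum>k. f (- int (Suc k)))) UNIV"
    unfolding fB by (rule norm_summable_imp_has_sum[OF sB summable_sums[OF summable_norm_cancel[OF sB]]])
  hence B: "(f has_sum (\<Sum>k. f (- int (Suc k)))) (range (\<lambda>k. - int (Suc k)))"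
    by (subst has_sum_reindex) (simp_all add: inj_def o_def del: of_nat_Suc)
  have "((\<lambda>k. f (int k)) has_sum (\<Sum>k. f (int k))) UNIV"
    unfolding fA
    by (rule norm_summable_imp_has_sum[OF summable_jterm(4) summable_sums[OF summable_norm_cancel[OF summable_jterm(4)]]])
  hence "(f has_sum (\<Sum>k. f (int k))) (range int)"
    by (subst has_sum_reindex) (simp_all add: inj_def o_def)
  hence "(f has_sum (\<Sum>k. f (int k)) + (\<Sum>k. f (- int (Suc k)))) (range int \<union> range (\<lambda>k. - int (Suc k)))"
    using B
  proof (rule has_sum_Un_disjoint)
    have "int k \<noteq> - int (Suc j)" for k j by linarith
    thus "range int \<inter> range (\<lambda>k. - int (Suc k)) = {}" by blast
  qed
  also have "range int \<union> range (\<lambda>k. - int (Suc k)) = UNIV"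
  proof -
    have "n \<in> range int \<union> range (\<lambda>k. - int (Suc k))" for n
      by (cases n rule: int_cases) (auto simp del: of_nat_Suc)
    thus ?thesis by blast
  qed
  also have "(\<Sum>k. f (int k)) + (\<Sum>k. f (- int (Suc k))) = qpoch q q * theta x q"
    unfolding fA fB by (rule triple_product[OF assms])
  finally show ?thesis unfolding f_def .
qed

text \<open>The triple product has a simple zero at x = 1. Its derivative there is taken in the
  finite identity, so that no infinite series has to be differentiated, and N tends to infinity only
  afterwards.\<close>

theorem jacobi_cube: "(\<lambda>k. (- 1) ^ k * of_nat (2 * k + 1) * q ^ tri k) sums (qpoch q q ^ 3)"
proof -
  \<comment> \<open>The derivative of \<open>jterm x k\<close> with respect to x at x = 1.\<close>
  define v where "v = (\<lambda>k. of_nat k * (- 1) ^ k * (q ^ (tri k - k) - q ^ tri k))"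
  have fin: "- (Q (N - 1) * Q N) = (\<Sum>k\<le>N. jcoeff N k * v k)" if "N > 0" for N
  proof (rule DERIV_unique)
    have "((\<lambda>x. \<Sum>k\<le>N. jcoeff N k * jterm x k) has_field_derivative (\<Sum>k\<le>N. jcoeff N k * v k)) (at 1)"
    proof (intro DERIV_sum DERIV_cmult)
      fix k
      have p: "((\<lambda>x::complex. (- x) ^ k) has_field_derivative of_nat k * (- 1) ^ k) (at 1)"
        by (rule DERIV_cong[OF DERIV_power[of _ "- 1"]]) (auto intro!: derivative_eq_intros, cases k, auto)
      have m: "((\<lambda>x::complex. (- 1 / x) ^ k) has_field_derivative - (of_nat k * (- 1) ^ k)) (at 1)"
        by (rule DERIV_cong[OF DERIV_power[of _ 1]]) (auto intro!: derivative_eq_intros, cases k, auto)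
      show "((\<lambda>x. jterm x k) has_field_derivative v k) (at 1)"
        using DERIV_add[OF DERIV_cmult_right[OF p, of "q ^ (tri k - k)"] DERIV_cmult_right[OF m, of "q ^ tri k"]]
        unfolding jterm_altdef v_def by (cases "k = 0") (simp_all add: algebra_simps)
    qed
    moreover have "eventually (\<lambda>x. (\<Prod>k<N. 1 - x * q ^ k) * (\<Prod>k<N. 1 - q / x * q ^ k) =
       (\<Sum>k\<le>N. jcoeff N k * jterm x k)) (nhds 1)"
    proof -
      have "eventually (\<lambda>x::complex. x \<noteq> 0) (nhds 1)" by (rule t1_space_nhds) simp
      thus ?thesis by (rule eventually_mono) (rule finite_triple_product)
    qed
    ultimately show "((\<lambda>x. (\<Prod>k<N. 1 - x * q ^ k) * (\<Prod>k<N. 1 - q / x * q ^ k)) has_field_derivative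
        (\<Sum>k\<le>N. jcoeff N k * v k)) (at 1)"
      by (rule DERIV_eventually_eq)
    obtain M where N: "N = Suc M" using \<open>N > 0\<close> by (auto simp: gr0_conv_Suc)
    define g where "g = (\<lambda>x. (\<Prod>k<M. 1 - x * q ^ Suc k) * (\<Prod>k<N. 1 - q / x * q ^ k))"
    have "g holomorphic_on - {0}" unfolding g_def by (intro holomorphic_intros) auto
    hence "(g has_field_derivative deriv g 1) (at 1)" by (rule holomorphic_derivI) auto
    moreover have "((\<lambda>x. 1 - x) has_field_derivative - 1) (at (1::complex))"
      by (auto intro!: derivative_eq_intros)
    ultimately have "((\<lambda>x. (1 - x) * g x) has_field_derivative - g 1) (at 1)"
      using DERIV_mult'[of "\<lambda>x. 1 - x" "- 1" 1 UNIV g "deriv g 1"] by simp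
    moreover have "(\<lambda>x. (1 - x) * g x) = (\<lambda>x. (\<Prod>k<N. 1 - x * q ^ k) * (\<Prod>k<N. 1 - q / x * q ^ k))"
      unfolding N g_def by (subst (2) prod.lessThan_Suc_shift) (simp add: mult_ac)
    moreover have "g 1 = Q (N - 1) * Q N" by (simp add: g_def N fin_qpoch_def)
    ultimately show "((\<lambda>x. (\<Prod>k<N. 1 - x * q ^ k) * (\<Prod>k<N. 1 - q / x * q ^ k)) has_field_derivative
        - (Q (N - 1) * Q N)) (at 1)" by simp
  qed
  define a where "a = (\<lambda>k. of_nat k * ((- 1) ^ k * q ^ (tri k - k)))"
  define b where "b = (\<lambda>k. of_nat k * ((- 1) ^ k * q ^ tri k))"
  have sa: "summable (\<lambda>k. norm (a k))" and sb: "summable (\<lambda>k. norm (b k))"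
    using summable_jterm(1,3)[of "-1"] by (simp_all add: a_def b_def norm_mult)
  have v: "v k = a k - b k" for k by (simp add: v_def a_def b_def algebra_simps)
  have sv: "summable (\<lambda>k. norm (v k))"
    by (rule summable_comparison_test'[OF summable_add[OF sa sb], of 0]) (auto simp: v intro: norm_triangle_ineq4)
  have "(\<lambda>N. - (Q (N - 1) * Q N)) \<longlonglongrightarrow> - (qpoch q q * qpoch q q)"
  proof -
    have "filterlim (\<lambda>N. N - 1) sequentially sequentially" by real_asymp
    from filterlim_compose[OF Q_LIMSEQ this] show ?thesis by (intro tendsto_intros Q_LIMSEQ)
  qed
  moreover have "eventually (\<lambda>N. - (Q (N - 1) * Q N) = (\<Sum>k\<le>N. jcoeff N k * v k)) sequentially"
    using eventually_gt_at_top[of 0] by eventually_elim (rule fin)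
  ultimately have "(\<lambda>N. \<Sum>k\<le>N. jcoeff N k * v k) \<longlonglongrightarrow> - (qpoch q q * qpoch q q)"
    by (rule Lim_transform_eventually)
  from LIMSEQ_unique[OF this jcoeff_sum_LIMSEQ[OF sv]]
  have "- (qpoch q q * qpoch q q) = (\<Sum>k. v k) / qpoch q q" .
  hence "(\<Sum>k. v k) = - (qpoch q q * qpoch q q) * qpoch q q"
    using qpoch_q_nonzero by (metis nonzero_eq_divide_eq)
  hence "(\<Sum>k. v k) = - (qpoch q q ^ 3)" by (simp add: power3_eq_cube)
  moreover have "(\<lambda>k. a k - b k) sums ((\<Sum>k. a k) - (\<Sum>k. b k))"
    using sums_diff[OF summable_sums[OF summable_norm_cancel[OF sa]] summable_sums[OF summable_norm_cancel[OF sb]]] .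
  ultimately have "- (qpoch q q ^ 3) = (\<Sum>k. a k) - (\<Sum>k. b k)"
    by (simp add: sums_iff v[abs_def])
  hence *: "(\<Sum>k. b k) - (\<Sum>k. a k) = qpoch q q ^ 3"
    by (metis minus_diff_eq minus_minus)
  have "(\<Sum>k. a k) = (\<Sum>k. a (Suc k))"
    using suminf_split_head[OF summable_norm_cancel[OF sa]] by (simp add: a_def)
  moreover have "(\<lambda>k. b k - a (Suc k)) sums ((\<Sum>k. b k) - (\<Sum>k. a (Suc k)))"
    using sums_diff[OF summable_sums[OF summable_norm_cancel[OF sb]]
      summable_sums[OF iffD2[OF summable_Suc_iff summable_norm_cancel[OF sa]]]] .
  \<comment> \<open>\<open>tri (Suc k) - Suc k = tri k\<close>, so after the shift both series have
    the same powers of \<open>q\<close>, and the factors k and k + 1 add up to 2k + 1.\<close>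
  moreover have "b k - a (Suc k) = (- 1) ^ k * of_nat (2 * k + 1) * q ^ tri k" for k
    by (simp add: a_def b_def algebra_simps)
  ultimately show ?thesis using * by simp
qed

end

section \<open>Theta values as products\<close>

lemma summable_on_product_real:
  fixes f :: "'a \<Rightarrow> real" and g :: "'b \<Rightarrow> real"
  assumes "f summable_on A" "g summable_on B" "\<And>x. x \<in> A \<Longrightarrow> f x \<ge> 0" "\<And>y. y \<in> B \<Longrightarrow> g y \<ge> 0"
  shows "(\<lambda>(x, y). f x * g y) summable_on (A \<times> B)"
proof (rule summable_on_SigmaI)
  show "((\<lambda>y. case (x, y) of (x, y) \<Rightarrow> f x * g y) has_sum f x * infsum g B) B" for x
    using assms(2) by (simp add: has_sum_cmult_right)
  show "(\<lambda>x. f x * infsum g B) summable_on A"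
    using assms(1) by (rule summable_on_cmult_left)
qed (use assms in auto)

lemma has_sum_product:
  fixes f :: "'a \<Rightarrow> complex" and g :: "'b \<Rightarrow> complex"
  assumes "(f has_sum F) A" "(g has_sum G) B"
  shows "((\<lambda>(x, y). f x * g y) has_sum F * G) (A \<times> B)"
proof (rule has_sum_SigmaI)
  show "((\<lambda>y. case (x, y) of (x, y) \<Rightarrow> f x * g y) has_sum f x * G) B" for x
    using assms(2) by (simp add: has_sum_cmult_right)
  show "((\<lambda>x. f x * G) has_sum F * G) A"
    using assms(1) by (rule has_sum_cmult_left)
  have "(\<lambda>x. norm (f x)) summable_on A" "(\<lambda>y. norm (g y)) summable_on B"
    using assms by (auto simp flip: summable_on_iff_abs_summable_on_complex intro: has_sum_imp_summable)
  hence "(\<lambda>(x, y). norm (f x) * norm (g y)) summable_on (A \<times> B)"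
    by (rule summable_on_product_real) auto
  also have "(\<lambda>(x, y). norm (f x) * norm (g y)) = (\<lambda>p. norm (case p of (x, y) \<Rightarrow> f x * g y))"
    by (auto simp: norm_mult)
  finally show "(\<lambda>(x, y). f x * g y) summable_on (A \<times> B)"
    by (subst summable_on_iff_abs_summable_on_complex)
qed

lemma ram_f_eq: "ram_f (- u) = qpoch u u"
  by (simp add: ram_f_def qpoch_def)

text \<open>Every theta value below is a quotient of the functions \<open>eul k\<close>.\<close>

locale unit_disc =
  fixes u :: complex
  assumes u0: "u \<noteq> 0" and u1: "norm u < 1"
begin

lemma norm_power_lt_1: "n > 0 \<Longrightarrow> norm (u ^ n) < 1"
  using u1 by (simp add: norm_power power_less_one_iff)

definition eul :: "nat \<Rightarrow> complex" where "eul k = qpoch (u ^ k) (u ^ k)"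

lemma nome_power: "n > 0 \<Longrightarrow> nome (u ^ n) (of_nat n * Ln u)"
  using u0 norm_power_lt_1 by unfold_locales (auto simp: exp_of_nat_mult)

lemma eul_nonzero [simp]: "k > 0 \<Longrightarrow> eul k \<noteq> 0"
  using nome.qpoch_q_nonzero[OF nome_power] by (simp add: eul_def)

lemma qpoch_odd: "k > 0 \<Longrightarrow> qpoch (u ^ k) (u ^ (2 * k)) = eul k / eul (2 * k)"
  using qpoch_split2[OF norm_power_lt_1, of k "u ^ k"] eul_nonzero[of "2 * k"]
  by (simp add: eul_def field_simps power_mult[symmetric] power_add[symmetric] mult_2 mult_2_right)

lemma qpoch_minus: "k > 0 \<Longrightarrow> qpoch (- (u ^ k)) (u ^ k) = eul (2 * k) / eul k"
  using qpoch_mult_minus[OF norm_power_lt_1, of k "u ^ k"] eul_nonzero[of k]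
  by (simp add: eul_def field_simps power_mult[symmetric] mult_2_right mult.commute)

lemma qpoch_minus_odd:
  assumes "k > 0"
  shows "qpoch (- (u ^ k)) (u ^ (2 * k)) = (eul (2 * k))\<^sup>2 / (eul k * eul (4 * k))"
proof -
  have "qpoch (u ^ k) (u ^ (2 * k)) * qpoch (- (u ^ k)) (u ^ (2 * k)) = qpoch ((u ^ k)\<^sup>2) ((u ^ (2 * k))\<^sup>2)"
    using assms by (intro qpoch_mult_minus norm_power_lt_1) auto
  also have "\<dots> = qpoch (u ^ (2 * k)) (u ^ (2 * (2 * k)))"
    by (simp only: power_mult[symmetric] mult.commute)
  also have "\<dots> = eul (2 * k) / eul (4 * k)"
    using qpoch_odd[of "2 * k"] assms by simp
  finally have "eul k / eul (2 * k) * qpoch (- (u ^ k)) (u ^ (2 * k)) = eul (2 * k) / eul (4 * k)"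
    using qpoch_odd[of k] assms by simp
  thus ?thesis using eul_nonzero[of k] eul_nonzero[of "2 * k"] eul_nonzero[of "4 * k"] assms
    by (simp add: field_simps power2_eq_square del: eul_nonzero)
qed

lemma mult_square_quotient: "(a::complex) * (a\<^sup>2 / (b * c))\<^sup>2 = a ^ 5 / (b\<^sup>2 * c\<^sup>2)"
  by (simp add: eval_nat_numeral mult_ac)

text \<open>Triple product for the nome u^2 at x = - u, where the two factors of
  \<open>theta\<close> coincide.\<close>

lemma ram_phi_has_sum: "((\<lambda>n::int. u ^ nat (n\<^sup>2)) has_sum ram_phi u) UNIV"
  and ram_phi_eq: "ram_phi u = eul 2 ^ 5 / (eul 1 ^ 2 * eul 4 ^ 2)"
proof -
  interpret nome "u\<^sup>2" "of_nat 2 * Ln u" by (rule nome_power) simp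
  have "(- (- u)) powi n * u\<^sup>2 ^ nat (n * (n - 1) div 2) = u ^ nat (n\<^sup>2)" for n :: int
  proof -
    have "n * (n - 1) div 2 \<ge> 0"
      by (cases "n \<le> 0") (auto simp: mult_nonpos_nonpos)
    then obtain j where j: "n * (n - 1) div 2 = int j" by (metis nonneg_int_cases)
    have "even (n * (n - 1))" by simp
    hence "int (2 * j) = n * (n - 1)" using j by (metis dvd_mult_div_cancel of_nat_mult of_nat_numeral)
    hence "u\<^sup>2 ^ nat (n * (n - 1) div 2) = u powi (n * (n - 1))"
      unfolding j by (metis nat_int power_int_of_nat power_mult)
    hence "(- (- u)) powi n * u\<^sup>2 ^ nat (n * (n - 1) div 2) = u powi (n + n * (n - 1))"
      using u0 by (simp add: power_int_add)
    also have "n + n * (n - 1) = n\<^sup>2" by (simp add: power2_eq_square algebra_simps)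
    finally show ?thesis by (simp add: power_int_def)
  qed
  with has_sum_triple_product[of "- u"] u0
  have *: "((\<lambda>n::int. u ^ nat (n\<^sup>2)) has_sum qpoch (u\<^sup>2) (u\<^sup>2) * theta (- u) (u\<^sup>2)) UNIV" by simp
  thus "((\<lambda>n::int. u ^ nat (n\<^sup>2)) has_sum ram_phi u) UNIV"
    by (simp add: ram_phi_def infsumI)
  have "u\<^sup>2 / - u = - u" using u0 by (simp add: power2_eq_square)
  with infsumI[OF *] have "ram_phi u = qpoch (u\<^sup>2) (u\<^sup>2) * (qpoch (- u) (u\<^sup>2))\<^sup>2"
    by (simp add: ram_phi_def theta_def power2_eq_square)
  thus "ram_phi u = eul 2 ^ 5 / (eul 1 ^ 2 * eul 4 ^ 2)"
    using qpoch_minus_odd[of 1] mult_square_quotient[of "eul 2" "eul 1" "eul 4"] by (simp add: eul_def)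
qed

text \<open>The triple product at x = -1 runs through every triangular number twice.\<close>

lemma ram_psi_eq: "ram_psi u = eul 2 ^ 2 / eul 1"
proof -
  interpret nome u "of_nat 1 * Ln u" using nome_power[of 1] by simp
  have s: "summable (\<lambda>k. u ^ tri k)" "summable (\<lambda>k. u ^ (tri k - k))"
    using summable_norm_cancel[OF summable_jterm(2)[of 1]] summable_norm_cancel[OF summable_jterm(4)[of 1]] by simp_all
  have psi: "ram_psi u = (\<Sum>k. u ^ tri k)" by (simp add: ram_psi_def tri_def)
  have "(\<Sum>k. u ^ (tri k - k)) = (\<Sum>k. u ^ (tri (Suc k) - Suc k)) + 1"
    using suminf_split_head[OF s(2)] by simp
  moreover have "(\<Sum>k. u ^ tri (Suc k)) = ram_psi u - 1"
    using suminf_split_head[OF s(1)] psi by simp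
  moreover have "(\<Sum>k. u ^ (tri k - k)) + (\<Sum>k. u ^ tri (Suc k)) = qpoch u u * theta (- 1) u"
    using triple_product[of "- 1"] by (simp del: tri_Suc)
  ultimately have "2 * ram_psi u = qpoch u u * theta (- 1) u"
    using psi by simp
  also have "theta (- 1) u = 2 * (qpoch (- u) u)\<^sup>2"
    using qpoch_shift[OF u1, of "- 1"] by (simp add: theta_def power2_eq_square)
  also have "qpoch (- u) u = eul 2 / eul 1" using qpoch_minus[of 1] by simp
  also have "qpoch u u = eul 1" by (simp add: eul_def)
  finally show ?thesis using eul_nonzero[of 1] by (simp add: field_simps power2_eq_square)
qed

text \<open>The product for \<open>ram_phi\<close> is used with - u in place of u; Euler products of
  even index do not see the sign.\<close>

lemma ram_phi_minus_eq: "ram_phi (- u) = eul 1 ^ 2 / eul 2"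
proof -
  interpret m: unit_disc "- u" using u0 u1 by unfold_locales auto
  have "ram_phi (- u) = m.eul 2 * (m.eul 2 ^ 2 / (m.eul 1 * m.eul 4)) ^ 2"
    unfolding m.ram_phi_eq mult_square_quotient ..
  also have "m.eul 2 ^ 2 / (m.eul 1 * m.eul 4) = qpoch u (u\<^sup>2)"
    using m.qpoch_minus_odd[of 1] by simp
  also have "\<dots> = eul 1 / eul 2" using qpoch_odd[of 1] by simp
  also have "m.eul 2 = eul 2" by (simp add: eul_def m.eul_def)
  finally show ?thesis using eul_nonzero[of 2] by (simp add: field_simps power2_eq_square)
qed

lemma ram_psi_minus_eq: "ram_psi (- u) = eul 1 * eul 4 / eul 2"
proof -
  interpret m: unit_disc "- u" using u0 u1 by unfold_locales auto
  have "m.eul 1 = eul 2 ^ 3 / (eul 1 * eul 4)"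
  proof -
    have "m.eul 2 ^ 2 / (m.eul 1 * m.eul 4) = eul 1 / eul 2"
      using m.qpoch_minus_odd[of 1] qpoch_odd[of 1] by simp
    moreover have "m.eul 2 = eul 2" "m.eul 4 = eul 4" by (simp_all add: eul_def m.eul_def)
    ultimately have "eul 2 ^ 2 / (m.eul 1 * eul 4) = eul 1 / eul 2" by simp
    thus ?thesis using eul_nonzero[of 1] eul_nonzero[of 2] eul_nonzero[of 4] m.eul_nonzero[of 1]
      by (simp add: field_simps power2_eq_square power3_eq_cube)
  qed
  moreover have "m.eul 2 = eul 2" by (simp add: eul_def m.eul_def)
  ultimately show ?thesis unfolding m.ram_psi_eq using eul_nonzero[of 1] eul_nonzero[of 2] eul_nonzero[of 4]
    by (simp add: field_simps power2_eq_square power3_eq_cube)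
qed

lemma eul_power: "n > 0 \<Longrightarrow> unit_disc.eul (u ^ n) k = eul (n * k)"
  using unit_disc.eul_def[of "u ^ n"] norm_power_lt_1 u0
  by (simp add: unit_disc_def eul_def power_mult)

lemma unit_disc_power: "n > 0 \<Longrightarrow> unit_disc (u ^ n)"
  using norm_power_lt_1 u0 by (simp add: unit_disc_def)

lemma ram_power:
  assumes "n > 0"
  shows "ram_phi (u ^ n) = eul (2 * n) ^ 5 / (eul n ^ 2 * eul (4 * n) ^ 2)"
    "ram_psi (u ^ n) = eul (2 * n) ^ 2 / eul n"
    "ram_phi (- (u ^ n)) = eul n ^ 2 / eul (2 * n)"
    "ram_psi (- (u ^ n)) = eul n * eul (4 * n) / eul (2 * n)"
  using unit_disc.ram_phi_eq[OF unit_disc_power[OF assms]] unit_disc.ram_psi_eq[OF unit_disc_power[OF assms]]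
    unit_disc.ram_phi_minus_eq[OF unit_disc_power[OF assms]] unit_disc.ram_psi_minus_eq[OF unit_disc_power[OF assms]]
  by (simp_all add: eul_power[OF assms] mult.commute)

section \<open>Quadratic theta identities\<close>

lemma ram_psi_square: "ram_psi u ^ 2 = ram_phi u * ram_psi (u ^ 2)"
  unfolding ram_power(2)[OF zero_less_numeral] ram_phi_eq ram_psi_eq
  using eul_nonzero[of 1] eul_nonzero[of 2] eul_nonzero[of 4]
  by (simp add: divide_simps) (simp add: eval_nat_numeral)

text \<open>In the sum of the two double series only pairs (m, n) with m + n even survive, and m = s
  + t, n = s - t turns m^2 + n^2 into 2 (s^2 + t^2).\<close>

lemma ram_phi_squares: "ram_phi u ^ 2 + ram_phi (- u) ^ 2 = 2 * ram_phi (u ^ 2) ^ 2"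
proof -
  interpret m: unit_disc "- u" using u0 u1 by unfold_locales auto
  interpret s: unit_disc "u ^ 2" by (rule unit_disc_power) simp
  have mu: "(- u) ^ nat (n\<^sup>2) = (if even n then 1 else - 1) * u ^ nat (n\<^sup>2)" for n :: int
    by (cases "even n") (auto simp: even_nat_iff)
  define c where "c = (\<lambda>p. if even (fst p + snd p :: int) then 2 * u ^ nat ((fst p)\<^sup>2) * u ^ nat ((snd p)\<^sup>2) else 0)"
  have "((\<lambda>p. (case p of (m, n) \<Rightarrow> u ^ nat (m\<^sup>2) * u ^ nat (n\<^sup>2)) +
      (case p of (m, n) \<Rightarrow> (- u) ^ nat (m\<^sup>2) * (- u) ^ nat (n\<^sup>2))) has_sum
       ram_phi u * ram_phi u + ram_phi (- u) * ram_phi (- u)) (UNIV \<times> UNIV)"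
    by (intro has_sum_add has_sum_product ram_phi_has_sum m.ram_phi_has_sum)
  also have "(\<lambda>p. (case p of (m, n) \<Rightarrow> u ^ nat (m\<^sup>2) * u ^ nat (n\<^sup>2)) +
      (case p of (m, n) \<Rightarrow> (- u) ^ nat (m\<^sup>2) * (- u) ^ nat (n\<^sup>2))) = c"
    by (auto simp: c_def mu)
  finally have "(c has_sum ram_phi u * ram_phi u + ram_phi (- u) * ram_phi (- u)) {p. even (fst p + snd p)}"
    by (rule has_sum_cong_neutral[THEN iffD1, rotated 3]) (auto simp: c_def)
  moreover have "bij_betw (\<lambda>(s, t). (s + t, s - t)) UNIV {p :: int \<times> int. even (fst p + snd p)}"
    by (rule bij_betwI[where g = "\<lambda>(a, b). ((a + b) div 2, (a - b) div 2)"])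
       (auto elim!: evenE simp: algebra_simps, presburger+)
  ultimately have "((\<lambda>p. c (case p of (s, t) \<Rightarrow> (s + t, s - t))) has_sum
       ram_phi u * ram_phi u + ram_phi (- u) * ram_phi (- u)) UNIV"
    by (subst has_sum_reindex_bij_betw)
  moreover have "c (case p of (s, t) \<Rightarrow> (s + t, s - t)) = 2 * (case p of (m, n) \<Rightarrow> (u ^ 2) ^ nat (m\<^sup>2) * (u ^ 2) ^ nat (n\<^sup>2))" for p
  proof -
    obtain s t where p: "p = (s, t)" by (cases p)
    have "nat ((s + t)\<^sup>2) + nat ((s - t)\<^sup>2) = 2 * nat (s\<^sup>2) + 2 * nat (t\<^sup>2)"
    proof -
      have "int (nat ((s + t)\<^sup>2) + nat ((s - t)\<^sup>2)) = int (2 * nat (s\<^sup>2) + 2 * nat (t\<^sup>2))"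
        by simp (simp add: power2_eq_square algebra_simps)
      thus ?thesis by (simp only: of_nat_eq_iff)
    qed
    thus ?thesis by (simp add: p c_def mult.assoc flip: power_add power_mult)
  qed
  ultimately have "((\<lambda>p. 2 * (case p of (m, n) \<Rightarrow> (u ^ 2) ^ nat (m\<^sup>2) * (u ^ 2) ^ nat (n\<^sup>2))) has_sum
       ram_phi u * ram_phi u + ram_phi (- u) * ram_phi (- u)) (UNIV \<times> UNIV)" by simp
  moreover have "((\<lambda>p. 2 * (case p of (m, n) \<Rightarrow> (u ^ 2) ^ nat (m\<^sup>2) * (u ^ 2) ^ nat (n\<^sup>2))) has_sum
       2 * (ram_phi (u ^ 2) * ram_phi (u ^ 2))) (UNIV \<times> UNIV)"
    by (intro has_sum_cmult_right has_sum_product s.ram_phi_has_sum)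
  ultimately show ?thesis unfolding power2_eq_square[of "ram_phi _"] by (rule has_sum_unique)
qed

end

section \<open>The integrands as Lambert series\<close>

text \<open>At real \<open>v\<close> this is the imaginary part of \<open>li1 (\<i> * v)\<close>,
  written so that it is holomorphic in \<open>v\<close>.\<close>

definition odd_li1 :: "complex \<Rightarrow> complex" where
  "odd_li1 v = (li1 (\<i> * v) - li1 (- (\<i> * v))) / (2 * \<i>)"

definition odd_li2 :: "complex \<Rightarrow> complex" where
  "odd_li2 v = (li2 (\<i> * v) - li2 (- (\<i> * v))) / (2 * \<i>)"

lemma odd_li2_minus: "odd_li2 (- v) = - odd_li2 v"
  by (simp add: odd_li2_def field_simps)

lemma exp_half_pi_i: "exp (complex_of_real pi / 2 * \<i>) = \<i>"
  using cis_pi_half by (simp add: cis_conv_exp mult.commute)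

context unit_disc
begin

text \<open>At a division point the arguments of the bilateral series are powers of u up to a
  constant: exponents congruent to m modulo n in one half, and to - m in the inverted half.\<close>

lemma li2_series_power:
  assumes n: "n > 0" "m \<le> n" and z: "exp z = s * u ^ m" and T: "Theta (u ^ n) z \<noteq> 0"
  shows "(\<lambda>k. li2 (s * u ^ (n * k + m)) - li2 (inverse s * u ^ (n * k + (n - m)))) sums
     (eul n ^ 6 * exp z * Theta (u ^ n) (2 * z) / Theta (u ^ n) z ^ 4)"
    and "summable (\<lambda>k. li2 (s * u ^ (n * k + m)))"
    and "(\<lambda>k. li2 (s * u ^ (n * k + m)) - li2 (inverse s * u ^ (n * k + (n - m)))) sums nome.li2_series (u ^ n) z"
proof -
  interpret nome "u ^ n" "of_nat n * Ln u" by (rule nome_power[OF n(1)])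
  have "s \<noteq> 0" using z exp_not_eq_zero[of z] by auto
  have "exp z * (u ^ n) ^ k = s * u ^ (n * k + m)" for k
    by (simp add: z power_add power_mult)
  moreover have "(u ^ n) ^ Suc k * exp (- z) = inverse s * u ^ (n * k + (n - m))" for k
  proof -
    have "u ^ (n * k + (n - m)) * u ^ m = (u ^ n) ^ Suc k"
      using n by (simp add: add.commute flip: power_add power_mult)
    thus ?thesis using u0 \<open>s \<noteq> 0\<close> by (simp add: exp_minus z field_simps del: power_Suc)
  qed
  ultimately have eq: "exp z * (u ^ n) ^ k = s * u ^ (n * k + m)"
    "(u ^ n) ^ Suc k * exp (- z) = inverse s * u ^ (n * k + (n - m))" for k by blast+
  show "(\<lambda>k. li2 (s * u ^ (n * k + m)) - li2 (inverse s * u ^ (n * k + (n - m)))) sums li2_series z"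
    using li2_series_sums(3)[OF T] unfolding eq .
  thus "(\<lambda>k. li2 (s * u ^ (n * k + m)) - li2 (inverse s * u ^ (n * k + (n - m)))) sums
     (eul n ^ 6 * exp z * Theta (u ^ n) (2 * z) / Theta (u ^ n) z ^ 4)"
    unfolding li2_series_eq[OF T] eul_def .
  show "summable (\<lambda>k. li2 (s * u ^ (n * k + m)))"
    using li2_series_sums(1)[OF T] unfolding eq .
qed

lemma exp_of_nat_Ln: "exp (of_nat n * Ln u) = u ^ n"
  using u0 by (simp add: exp_of_nat_mult)

lemma exp_numeral_Ln: "exp (numeral n * Ln u) = u ^ numeral n"
  using exp_of_nat_Ln[of "numeral n"] by simp

text \<open>Nome u^3 and exp z = u. The map x -> q / x exchanges u and u^2, hence T(2z) = T(z) and
  the quotient is T(z)^(-3).\<close>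

lemma f_sums: "(\<lambda>k. li2 (u ^ (3 * k + 1)) - li2 (u ^ (3 * k + 2))) sums (u * ram_f (- (u ^ 3)) ^ 9 / ram_f (- u) ^ 3)"
proof -
  have "qpoch u u = qpoch u (u ^ 3) * qpoch (u\<^sup>2) (u ^ 3) * qpoch (u ^ 3) (u ^ 3)"
    using qpoch_split[OF u1, of 3 u] by (simp add: eval_nat_numeral mult_ac)
  hence th: "qpoch u (u ^ 3) * qpoch (u\<^sup>2) (u ^ 3) = eul 1 / eul 3"
    using eul_nonzero[of 3] by (simp add: eul_def field_simps del: eul_nonzero)
  have T1: "Theta (u ^ 3) (Ln u) = eul 1 / eul 3"
    using u0 th by (simp add: Theta_def theta_def eval_nat_numeral)
  have T2: "Theta (u ^ 3) (2 * Ln u) = eul 1 / eul 3"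
    using u0 th by (simp add: Theta_def theta_def exp_numeral_Ln) (simp add: eval_nat_numeral mult.commute)
  have "(\<lambda>k. li2 (1 * u ^ (3 * k + 1)) - li2 (inverse 1 * u ^ (3 * k + (3 - 1)))) sums
     (eul 3 ^ 6 * exp (Ln u) * Theta (u ^ 3) (2 * Ln u) / Theta (u ^ 3) (Ln u) ^ 4)"
    using u0 T1 by (intro li2_series_power(1)) auto
  also have "eul 3 ^ 6 * exp (Ln u) * Theta (u ^ 3) (2 * Ln u) / Theta (u ^ 3) (Ln u) ^ 4 = u * eul 3 ^ 9 / eul 1 ^ 3"
    unfolding T1 T2 using u0 eul_nonzero[of 1] eul_nonzero[of 3]
    by (simp add: divide_simps del: eul_nonzero) (simp add: eval_nat_numeral)
  finally show ?thesis
    by (simp add: ram_f_eq eul_def eval_nat_numeral)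
qed

text \<open>Two residue classes modulo 4k that differ by 2k merge into one product with step 2k,
  which is a quotient of Euler products.\<close>

lemma theta_values:
  assumes "k > 0"
  shows "theta (u ^ k) (u ^ (4 * k)) = eul k / eul (2 * k)"
    "theta (- (u ^ k)) (u ^ (4 * k)) = (eul (2 * k))\<^sup>2 / (eul k * eul (4 * k))"
    "theta (u ^ (2 * k)) (u ^ (4 * k)) = (eul (2 * k) / eul (4 * k))\<^sup>2"
    "theta (- (u ^ (2 * k))) (u ^ (4 * k)) = ((eul (4 * k))\<^sup>2 / (eul (2 * k) * eul (8 * k)))\<^sup>2"
    "theta (- 1) (u ^ k) = 2 * (eul (2 * k) / eul k)\<^sup>2"
proof -
  have e: "u ^ (4 * k) = u ^ k * u ^ (3 * k)" "u ^ (4 * k) = u ^ (2 * k) * u ^ (2 * k)"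
    "u ^ (3 * k) = u ^ k * u ^ (2 * k)" "u ^ (4 * k) = (u ^ (2 * k))\<^sup>2"
    by (simp_all flip: power_add power_mult)
  have d: "u ^ (4 * k) / u ^ k = u ^ k * u ^ (2 * k)" "u ^ (4 * k) / u ^ (2 * k) = u ^ (2 * k)"
    using u0 e by simp_all
  have s: "qpoch a (u ^ (2 * k)) = qpoch a (u ^ (4 * k)) * qpoch (a * u ^ (2 * k)) (u ^ (4 * k))" for a
    using qpoch_split2[OF norm_power_lt_1, of "2 * k" a] assms e(4) by simp
  show "theta (u ^ k) (u ^ (4 * k)) = eul k / eul (2 * k)"
    unfolding theta_def d s[symmetric] by (rule qpoch_odd[OF assms])
  have "theta (- (u ^ k)) (u ^ (4 * k)) = qpoch (- (u ^ k)) (u ^ (2 * k))"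
    unfolding theta_def s using d by simp
  thus "theta (- (u ^ k)) (u ^ (4 * k)) = (eul (2 * k))\<^sup>2 / (eul k * eul (4 * k))"
    using qpoch_minus_odd[OF assms] by simp
  show "theta (u ^ (2 * k)) (u ^ (4 * k)) = (eul (2 * k) / eul (4 * k))\<^sup>2"
    unfolding theta_def d using qpoch_odd[of "2 * k"] assms by (simp add: power2_eq_square)
  show "theta (- (u ^ (2 * k))) (u ^ (4 * k)) = ((eul (4 * k))\<^sup>2 / (eul (2 * k) * eul (8 * k)))\<^sup>2"
    unfolding theta_def using d qpoch_minus_odd[of "2 * k"] assms by (simp add: power2_eq_square)
  show "theta (- 1) (u ^ k) = 2 * (eul (2 * k) / eul k)\<^sup>2"
    unfolding theta_def using qpoch_shift[OF norm_power_lt_1[OF assms], of "- 1"] qpoch_minus[OF assms]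
    by (simp add: power2_eq_square)
qed

lemma phi2_psi4_sums:
  "(\<lambda>k. li2 (u ^ (4 * k + 1)) - li2 (u ^ (4 * k + 3))) sums (u * (ram_phi u ^ 2 * ram_psi (u ^ 2) ^ 4))"
proof -
  have T1: "Theta (u ^ 4) (Ln u) = eul 1 / eul 2"
    using theta_values(1)[of 1] u0 by (simp add: Theta_def)
  have T2: "Theta (u ^ 4) (2 * Ln u) = (eul 2 / eul 4)\<^sup>2"
    using theta_values(3)[of 1] by (simp add: Theta_def exp_numeral_Ln)
  have "(\<lambda>k. li2 (1 * u ^ (4 * k + 1)) - li2 (inverse 1 * u ^ (4 * k + (4 - 1)))) sums
     (eul 4 ^ 6 * exp (Ln u) * Theta (u ^ 4) (2 * Ln u) / Theta (u ^ 4) (Ln u) ^ 4)"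
    using u0 T1 by (intro li2_series_power(1)) auto
  also have "eul 4 ^ 6 * exp (Ln u) * Theta (u ^ 4) (2 * Ln u) / Theta (u ^ 4) (Ln u) ^ 4 =
      u * (ram_phi u ^ 2 * ram_psi (u ^ 2) ^ 4)"
    unfolding T1 T2 ram_phi_eq ram_power(2)[OF zero_less_numeral]
    using u0 eul_nonzero[of 1] eul_nonzero[of 2] eul_nonzero[of 4]
    by (simp add: divide_simps del: eul_nonzero) (simp add: eval_nat_numeral)
  finally show ?thesis by (simp add: eval_nat_numeral)
qed

text \<open>Nome - u and z = pi \<i> / 2, so that exp z = \<i> and exp (2z) = -1.\<close>

lemma phi2_phi4_sums:
  "(\<lambda>k. - 4 * (- 1) ^ Suc k * odd_li2 (u ^ Suc k)) sums (ram_phi (- u) ^ 2 * ram_phi u ^ 4 - 1)"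
proof -
  interpret m: unit_disc "- u" using u0 u1 by unfold_locales auto
  define z where "z = pi / 2 * \<i>"
  have ez: "exp z = \<i>" "exp (2 * z) = - 1"
  proof -
    show "exp z = \<i>" unfolding z_def using exp_half_pi_i by simp
    thus "exp (2 * z) = - 1" by (simp add: exp_double)
  qed
  have "qpoch \<i> (- u) * qpoch (- \<i>) (- u) = 2 * (m.eul 4 / m.eul 2)"
  proof -
    have "qpoch \<i> (- u) * qpoch (- \<i>) (- u) = qpoch (- 1) (u ^ 2)"
      using qpoch_mult_minus[OF m.u1, of \<i>] by simp
    also have "\<dots> = 2 * qpoch (- (u ^ 2)) (u ^ 2)"
      using qpoch_shift[of "u ^ 2" "- 1"] norm_power_lt_1[of 2] by simp
    also have "qpoch (- (u ^ 2)) (u ^ 2) = m.eul 4 / m.eul 2"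
      using m.qpoch_minus[of 2] by simp
    finally show ?thesis .
  qed
  moreover have "qpoch (- \<i>) (- u) = (1 + \<i>) * qpoch (\<i> * u) (- u)"
    using qpoch_shift[OF m.u1, of "- \<i>"] by simp
  ultimately have "(1 + \<i>) * (qpoch \<i> (- u) * qpoch (\<i> * u) (- u)) = 2 * (m.eul 4 / m.eul 2)"
    by (simp add: mult_ac)
  hence "(1 - \<i>) * (1 + \<i>) * (qpoch \<i> (- u) * qpoch (\<i> * u) (- u)) = (1 - \<i>) * (2 * (m.eul 4 / m.eul 2))"
    by (simp only: mult.assoc)
  moreover have "(1 - \<i>) * (1 + \<i>) = 2" by (simp add: complex_eq_iff)
  ultimately have "qpoch \<i> (- u) * qpoch (\<i> * u) (- u) = (1 - \<i>) * (m.eul 4 / m.eul 2)"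
    by (metis mult.left_commute mult_left_cancel zero_neq_numeral)
  moreover have "- u / \<i> = \<i> * u" by (simp add: complex_eq_iff)
  ultimately have T1: "Theta (- u) z = (1 - \<i>) * (m.eul 4 / m.eul 2)"
    by (simp add: Theta_def theta_def ez)
  have T2: "Theta (- u) (2 * z) = 2 * (m.eul 2 / m.eul 1)\<^sup>2"
    using m.theta_values(5)[of 1] by (simp add: Theta_def ez)
  have n: "(1 - \<i>) ^ 4 = - 4" by (simp add: eval_nat_numeral complex_eq_iff)
  have n0: "1 - \<i> \<noteq> 0" by (simp add: complex_eq_iff)
  have "(\<lambda>k. li2 (\<i> * (- u) ^ (1 * k + 0)) - li2 (inverse \<i> * (- u) ^ (1 * k + (1 - 0)))) sums
     (m.eul 1 ^ 6 * exp z * Theta ((- u) ^ 1) (2 * z) / Theta ((- u) ^ 1) z ^ 4)"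
    using T1 n0 by (intro m.li2_series_power(1)) (auto simp: ez)
  also have "m.eul 1 ^ 6 * exp z * Theta ((- u) ^ 1) (2 * z) / Theta ((- u) ^ 1) z ^ 4 =
      - (\<i> / 2) * (ram_phi (- u) ^ 2 * ram_phi u ^ 4)"
  proof -
    have ph: "ram_phi u = m.eul 1 ^ 2 / m.eul 2" using m.ram_phi_minus_eq by simp
    show ?thesis unfolding ph m.ram_phi_eq power_one_right T1 T2 ez power_mult_distrib[of "1 - \<i>"] n
      using m.eul_nonzero[of 1] m.eul_nonzero[of 2] m.eul_nonzero[of 4]
      by (simp add: divide_simps del: m.eul_nonzero) (simp add: eval_nat_numeral)
  qed
  finally have S: "(\<lambda>k. li2 (\<i> * (- u) ^ k) - li2 (- (\<i> * (- u) ^ Suc k))) sums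
      (- (\<i> / 2) * (ram_phi (- u) ^ 2 * ram_phi u ^ 4))" by simp
  have "summable (\<lambda>k. li2 (\<i> * (- u) ^ (1 * k + 0)))"
    using T1 n0 by (intro m.li2_series_power(2)[where z = z]) (auto simp: ez)
  hence A: "(\<lambda>k. li2 (\<i> * (- u) ^ k)) sums (\<Sum>k. li2 (\<i> * (- u) ^ k))" by (simp add: summable_sums)
  hence A': "(\<lambda>k. li2 (\<i> * (- u) ^ Suc k)) sums ((\<Sum>k. li2 (\<i> * (- u) ^ k)) - li2 \<i>)"
    by (subst sums_Suc_iff) simp
  \<comment> \<open>The first half of the series starts at the power 0; removing its term
    \<open>li2 \<i>\<close> produces the - 1 of the integrand.\<close>
  have "li2 \<i> = - (\<i> / 2)"
  proof -
    have "\<i> * (1 + \<i>) = - (\<i> / 2) * (1 - \<i>) ^ 3" by (simp add: power3_eq_cube complex_eq_iff)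
    thus ?thesis unfolding li2_def using n0 by (metis nonzero_mult_div_cancel_right power_not_zero)
  qed
  with sums_add[OF sums_diff[OF A' A] S]
  have "(\<lambda>k. li2 (\<i> * (- u) ^ Suc k) - li2 (- (\<i> * (- u) ^ Suc k))) sums
      (\<i> / 2 * (1 - ram_phi (- u) ^ 2 * ram_phi u ^ 4))"
    by (simp add: algebra_simps)
  from sums_mult[OF this, of "2 * \<i>"]
  have sums: "(\<lambda>k. 2 * \<i> * (li2 (\<i> * (- u) ^ Suc k) - li2 (- (\<i> * (- u) ^ Suc k)))) sums
      (ram_phi (- u) ^ 2 * ram_phi u ^ 4 - 1)"
    by (simp add: algebra_simps)
  have eq: "2 * \<i> * (li2 (\<i> * (- u) ^ Suc k) - li2 (- (\<i> * (- u) ^ Suc k))) =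
      - 4 * (- 1) ^ Suc k * odd_li2 (u ^ Suc k)" for k
  proof -
    have "2 * \<i> * (li2 (\<i> * v) - li2 (- (\<i> * v))) = - 4 * odd_li2 v" for v
      by (simp add: odd_li2_def field_simps)
    hence "2 * \<i> * (li2 (\<i> * (- u) ^ Suc k) - li2 (- (\<i> * (- u) ^ Suc k))) = - 4 * odd_li2 ((- u) ^ Suc k)"
      by blast
    also have "odd_li2 ((- u) ^ Suc k) = (- 1) ^ Suc k * odd_li2 (u ^ Suc k)"
      by (cases "even k") (simp_all add: odd_li2_minus del: power_Suc)
    finally show ?thesis by (simp only: mult.assoc)
  qed
  show ?thesis using sums unfolding eq .
qed

text \<open>Jacobi's quartic identity. The three differences of (log T)'' between the half periods
  for the nome u^2 add up to 0, and the addition formula turns each of them into theta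
  values.\<close>

lemma phi_fourth_diff: "ram_phi u ^ 4 - ram_phi (- u) ^ 4 = 16 * u * ram_psi (u ^ 2) ^ 4"
proof -
  interpret nome "u ^ 2" "of_nat 2 * Ln u" by (rule nome_power) simp
  define a where "a = theta (- u) (u ^ 2)"
  define b where "b = theta u (u ^ 2)"
  define c where "c = theta (- 1) (u ^ 2)"
  define L where "L = Ln u"
  define W where "W = wrT (pi * \<i>)"
  have q2: "u ^ 2 / u = u" using u0 by (simp add: power2_eq_square)
  have b: "b = (eul 1 / eul 2)\<^sup>2" and a: "a = (eul 2 ^ 2 / (eul 1 * eul 4))\<^sup>2" and c: "c = 2 * (eul 4 / eul 2)\<^sup>2"
    using qpoch_odd[of 1] qpoch_minus_odd[of 1] theta_values(5)[of 2] q2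
    by (simp_all add: a_def b_def c_def theta_def power2_eq_square)
  have nz: "a \<noteq> 0" "b \<noteq> 0" "c \<noteq> 0" unfolding a b c by simp_all
  have e: "exp L = u" "exp (pi * \<i>) = - 1" "exp (- L) = 1 / u" using u0 by (simp_all add: L_def exp_minus inverse_eq_divide)
  have "theta (- 1 / u) (u ^ 2) = a / u"
    using theta_inverse[of "- u"] u0 by (simp add: a_def)
  moreover have "theta (u ^ 2 * - 1) (u ^ 2) = c" using theta_mult_q[of "- 1"] by (simp add: c_def)
  moreover have "exp (L + pi * \<i>) = - u" "exp (pi * \<i> + L) = - u" "exp (pi * \<i> - L) = - 1 / u"
    "exp (L + (L + pi * \<i>)) = u ^ 2 * - 1" "exp (L - (L + pi * \<i>)) = - 1" "exp (L + pi * \<i> + pi * \<i>) = u"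
    "exp (L + pi * \<i> - pi * \<i>) = u"
    using u0 by (simp_all only: exp_add exp_diff e) (simp_all add: power2_eq_square)
  ultimately have V: "T L = b" "T (pi * \<i>) = c" "T (L + pi * \<i>) = a" "T (pi * \<i> + L) = a" "T (pi * \<i> - L) = a / u"
    "T (L + (L + pi * \<i>)) = c" "T (L - (L + pi * \<i>)) = c" "T (L + pi * \<i> + pi * \<i>) = b" "T (L + pi * \<i> - pi * \<i>) = b"
    by (simp_all only: Theta_def e a_def b_def c_def)
  have *: "wrT (pi * \<i>) * b\<^sup>2 - wrT L * c\<^sup>2 = eul 2 ^ 4 * a\<^sup>2"
    using T_add_diff[of "pi * \<i>" L] u0 unfolding V e exp_add eul_def[of 2, symmetric]
    by (simp add: power2_eq_square)
  have **: "wrT L * a\<^sup>2 - wrT (L + pi * \<i>) * b\<^sup>2 = - (eul 2 ^ 4 * u * c\<^sup>2)"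
    using T_add_diff[of L "L + pi * \<i>"] unfolding V e exp_add eul_def[of 2, symmetric]
    by (simp add: power2_eq_square)
  have ***: "wrT (L + pi * \<i>) * c\<^sup>2 - wrT (pi * \<i>) * a\<^sup>2 = - (eul 2 ^ 4 * b\<^sup>2)"
    using T_add_diff[of "L + pi * \<i>" "pi * \<i>"] unfolding V e exp_add eul_def[of 2, symmetric]
    by (simp add: power2_eq_square)
  have "eul 2 ^ 4 * (a ^ 4 - u * c ^ 4 - b ^ 4) = 0"
    using * ** *** by algebra
  hence "a ^ 4 - u * c ^ 4 - b ^ 4 = 0" by simp
  hence "a ^ 4 - b ^ 4 = u * c ^ 4" by (simp add: algebra_simps)
  moreover have "ram_phi u = eul 2 * a" "ram_phi (- u) = eul 2 * b" "2 * ram_psi (u ^ 2) = eul 2 * c"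
    unfolding ram_phi_eq ram_phi_minus_eq ram_power(2)[OF zero_less_numeral] a b c
    by (simp_all add: divide_simps) (simp_all add: eval_nat_numeral)
  moreover have "16 * ram_psi (u ^ 2) ^ 4 = (2 * ram_psi (u ^ 2)) ^ 4"
    by (simp add: power_mult_distrib)
  ultimately show ?thesis
    by (simp only: mult.assoc power_mult_distrib) algebra
qed

text \<open>Nome u^8 and exp z = \<i> u. The half-period shifts give the arguments \<i> u, - \<i> u,
  \<i> u^5, - \<i> u^5, and the inverted halves of the four series contribute the exponents 7 and
  3.\<close>

lemma odd_li2_sums:
  "(\<lambda>k. odd_li2 (u ^ (8 * k + 1)) - odd_li2 (u ^ (8 * k + 3)) - odd_li2 (u ^ (8 * k + 5)) + odd_li2 (u ^ (8 * k + 7))) sums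
     (u * (ram_phi (- (u\<^sup>2)) * ram_phi (u ^ 4) * (3 * ram_psi (- (u\<^sup>2)) ^ 4 - ram_psi (u\<^sup>2) ^ 4)) / 2)"
proof -
  interpret nome "u ^ 8" "of_nat 8 * Ln u" by (rule nome_power) simp
  define z where "z = Ln u + pi / 2 * \<i>"
  have \<eta>: "of_nat 8 * Ln u / 2 = 4 * Ln u" by simp
  have e: "exp (z + pi * \<i>) = - \<i> * u ^ 1" "exp z = \<i> * u ^ 1" "exp (z + 4 * Ln u) = \<i> * u ^ 5"
     "exp (z + (4 * Ln u + pi * \<i>)) = - \<i> * u ^ 5" "exp (2 * z) = - (u ^ 2)"
     "exp (4 * z) = u ^ 4" "exp (4 * Ln u + pi * \<i>) = - (u ^ 4)"
  proof -
    show z: "exp z = \<i> * u ^ 1" unfolding z_def exp_add using exp_half_pi_i u0 by simp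
    have p: "exp (pi * \<i>) = - 1" by (rule exp_pi_i)
    have u4: "exp (4 * Ln u) = u ^ 4" by (rule exp_numeral_Ln)
    show "exp (z + pi * \<i>) = - \<i> * u ^ 1" "exp (z + 4 * Ln u) = \<i> * u ^ 5"
     "exp (z + (4 * Ln u + pi * \<i>)) = - \<i> * u ^ 5" "exp (4 * Ln u + pi * \<i>) = - (u ^ 4)"
      unfolding exp_add z p u4 by (simp_all add: eval_nat_numeral)
    have "exp (2 * z) = (exp z) ^ 2" by (rule exp_double)
    thus z2: "exp (2 * z) = - (u ^ 2)" unfolding z by (simp add: power_mult_distrib)
    have "exp (4 * z) = (exp (2 * z)) ^ 2" by (simp flip: exp_double)
    thus "exp (4 * z) = u ^ 4" unfolding z2 by simp
  qed
  have e': "exp (2 * z + (4 * Ln u + pi * \<i>)) = u ^ 6" "exp (4 * z + (4 * Ln u + pi * \<i>)) = u ^ 8 * (- 1)"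
    by (simp_all only: exp_add[of "2 * z"] exp_add[of "4 * z"] e) (simp_all add: eval_nat_numeral)
  have V: "T (2 * z) = (eul 4)\<^sup>2 / (eul 2 * eul 8)" "T (2 * z + (4 * Ln u + pi * \<i>)) = eul 2 / eul 4"
    "T (4 * z) = (eul 4 / eul 8)\<^sup>2" "T (4 * z + (4 * Ln u + pi * \<i>)) = 2 * (eul 16 / eul 8)\<^sup>2"
    "T (4 * Ln u + pi * \<i>) = ((eul 8)\<^sup>2 / (eul 4 * eul 16))\<^sup>2"
  proof -
    show "T (2 * z) = (eul 4)\<^sup>2 / (eul 2 * eul 8)" "T (4 * z) = (eul 4 / eul 8)\<^sup>2"
      "T (4 * Ln u + pi * \<i>) = ((eul 8)\<^sup>2 / (eul 4 * eul 16))\<^sup>2"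
      using theta_values[of 2] by (simp_all add: Theta_def e)
    have "u ^ 8 / u ^ 2 = u ^ 6" using u0 by (simp add: eval_nat_numeral)
    hence "theta (u ^ 6) (u ^ 8) = theta (u ^ 2) (u ^ 8)" using theta_q_div[of "u ^ 2"] u0 by simp
    thus "T (2 * z + (4 * Ln u + pi * \<i>)) = eul 2 / eul 4"
      using theta_values(1)[of 2] by (simp add: Theta_def e')
    show "T (4 * z + (4 * Ln u + pi * \<i>)) = 2 * (eul 16 / eul 8)\<^sup>2"
      unfolding Theta_def e' using theta_values(5)[of 8] theta_mult_q[of "- 1"] by simp
  qed
  have nz2: "T (2 * z) \<noteq> 0" "T (2 * z + (4 * Ln u + pi * \<i>)) \<noteq> 0" unfolding V by simp_all
  have nz: "T z \<noteq> 0" "T (z + pi * \<i>) \<noteq> 0" "T (z + 4 * Ln u) \<noteq> 0" "T (z + (4 * Ln u + pi * \<i>)) \<noteq> 0"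
    using nz2(1) unfolding T_double \<eta> by auto
  note S = li2_series_power(3)[OF _ _ e(2) nz(1)] li2_series_power(3)[OF _ _ e(1) nz(2)]
    li2_series_power(3)[OF _ _ e(3) nz(3)] li2_series_power(3)[OF _ _ e(4) nz(4)]
  define A where "A = (li2_series z - li2_series (z + pi * \<i>) - li2_series (z + 4 * Ln u) + li2_series (z + (4 * Ln u + pi * \<i>))) / 2"
  have "(\<lambda>k. ((li2 (\<i> * u ^ (8 * k + 1)) - li2 (inverse \<i> * u ^ (8 * k + (8 - 1)))) -
         (li2 (- \<i> * u ^ (8 * k + 1)) - li2 (inverse (- \<i>) * u ^ (8 * k + (8 - 1)))) -
         (li2 (\<i> * u ^ (8 * k + 5)) - li2 (inverse \<i> * u ^ (8 * k + (8 - 5)))) +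
         (li2 (- \<i> * u ^ (8 * k + 5)) - li2 (inverse (- \<i>) * u ^ (8 * k + (8 - 5))))) / 2 / \<i>) sums (A / \<i>)"
    unfolding A_def by (intro sums_divide sums_add sums_diff S) auto
  also have "(\<lambda>k. ((li2 (\<i> * u ^ (8 * k + 1)) - li2 (inverse \<i> * u ^ (8 * k + (8 - 1)))) -
         (li2 (- \<i> * u ^ (8 * k + 1)) - li2 (inverse (- \<i>) * u ^ (8 * k + (8 - 1)))) -
         (li2 (\<i> * u ^ (8 * k + 5)) - li2 (inverse \<i> * u ^ (8 * k + (8 - 5)))) +
         (li2 (- \<i> * u ^ (8 * k + 5)) - li2 (inverse (- \<i>) * u ^ (8 * k + (8 - 5))))) / 2 / \<i>) =
     (\<lambda>k. odd_li2 (u ^ (8 * k + 1)) - odd_li2 (u ^ (8 * k + 3)) - odd_li2 (u ^ (8 * k + 5)) + odd_li2 (u ^ (8 * k + 7)))" (is "?f = ?g")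
  proof
    fix k
    have "((p1 - m7) - (m1 - p7) - (p5 - m3) + (m5 - p3)) / 2 / \<i> =
        (p1 - m1) / (2 * \<i>) - (p3 - m3) / (2 * \<i>) - (p5 - m5) / (2 * \<i>) + (p7 - m7) / (2 * \<i>)"
      for p1 m1 p3 m3 p5 m5 p7 m7 :: complex
    proof -
      have d: "x / (2 * \<i>) = - \<i> / 2 * x" "x / 2 / \<i> = - \<i> / 2 * x" for x
        by (simp_all add: complex_eq_iff)
      show ?thesis unfolding d by algebra
    qed
    moreover have "8 - 1 = (7::nat)" "8 - 5 = (3::nat)" "inverse \<i> * v = - (\<i> * v)" "inverse (- \<i>) * v = \<i> * v"
      "- \<i> * v = - (\<i> * v)" for v
      by simp_all
    ultimately show "?f k = ?g k" unfolding odd_li2_def by simp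
  qed
  also have "A / \<i> = u * (ram_phi (- (u\<^sup>2)) * ram_phi (u ^ 4) * (3 * ram_psi (- (u\<^sup>2)) ^ 4 - ram_psi (u\<^sup>2) ^ 4)) / 2"
  proof -
    interpret w: unit_disc "u ^ 2" by (rule unit_disc_power) simp
    define a where "a = ram_phi (u ^ 2)"
    define b where "b = ram_phi (- (u ^ 2))"
    define c where "c = ram_phi (u ^ 4)"
    define s where "s = ram_psi (u ^ 4)"
    note nonz = eul_nonzero[of 2] eul_nonzero[of 4] eul_nonzero[of 8] eul_nonzero[of 16]
    have c: "c = eul 8 ^ 5 / (eul 4 ^ 2 * eul 16 ^ 2)" and s: "s = eul 8 ^ 2 / eul 4" and b: "b = eul 2 ^ 2 / eul 4"
      unfolding c_def s_def b_def using ram_power[of 4] ram_power(3)[of 2] by simp_all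
    have A: "A = \<i> * u * (eul 2 ^ 2 * eul 16 ^ 2 / (eul 4 * eul 8)) * (c ^ 4 - 8 * u ^ 2 * s ^ 4)"
    proof -
      have P: "(eul 8)\<^sup>2 / T (4 * Ln u + pi * \<i>) * exp z * T (2 * z + (4 * Ln u + pi * \<i>)) / T (2 * z) =
          \<i> * u * (eul 2 ^ 2 * eul 16 ^ 2 / (eul 4 * eul 8))"
        unfolding V e using nonz by (simp add: divide_simps del: eul_nonzero) (simp add: eval_nat_numeral)
      have Q: "(eul 8)\<^sup>2 * T (4 * z) * (T (4 * Ln u + pi * \<i>))\<^sup>2 / ((T (2 * z))\<^sup>2 * (T (2 * z + (4 * Ln u + pi * \<i>)))\<^sup>2) = c\<^sup>2"
        unfolding V c using nonz by (simp add: divide_simps del: eul_nonzero) (simp add: eval_nat_numeral)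
      have R: "eul 8 ^ 4 * exp (2 * z) * T (4 * z + (4 * Ln u + pi * \<i>)) * T (4 * Ln u + pi * \<i>) /
           ((T (2 * z + (4 * Ln u + pi * \<i>)))\<^sup>2 * (T (2 * z))\<^sup>2) = - 2 * u ^ 2 * s ^ 4"
        unfolding V e s using nonz by (simp add: divide_simps del: eul_nonzero)
      show ?thesis
        using alt_second_deriv[unfolded \<eta>, OF nz2] unfolding A_def[symmetric] eul_def[of 8, symmetric] P Q R
        by (simp add: algebra_simps flip: power_mult)
    qed
    have psi: "ram_psi (u\<^sup>2) ^ 4 = a\<^sup>2 * s\<^sup>2" "ram_psi (- (u\<^sup>2)) ^ 4 = b\<^sup>2 * s\<^sup>2"
    proof -
      interpret mw: unit_disc "- (u ^ 2)" using w.u0 w.u1 by unfold_locales auto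
      have r: "ram_psi (u\<^sup>2) ^ 2 = a * s" "ram_psi (- (u\<^sup>2)) ^ 2 = b * s"
        using w.ram_psi_square mw.ram_psi_square by (simp_all add: a_def b_def s_def flip: power_mult)
      have p: "x ^ 4 = (x ^ 2) ^ 2" for x :: complex by (simp flip: power_mult)
      show "ram_psi (u\<^sup>2) ^ 4 = a\<^sup>2 * s\<^sup>2" "ram_psi (- (u\<^sup>2)) ^ 4 = b\<^sup>2 * s\<^sup>2"
        unfolding p r power_mult_distrib by (rule refl)+
    qed
    have sq: "a\<^sup>2 + b\<^sup>2 = 2 * c\<^sup>2" and fd: "a ^ 4 - b ^ 4 = 16 * u ^ 2 * s ^ 4"
      using w.ram_phi_squares w.phi_fourth_diff by (simp_all add: a_def b_def c_def s_def flip: power_mult)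
    \<comment> \<open>By \<open>sq\<close> and \<open>fd\<close>, 8 u^2 s^4 = c^2 (a^2 - b^2).
      Replacing one factor c^2 of c^4 by (a^2 + b^2) / 2 then yields the combination 3 b^2 - a^2 of
      the integrand.\<close>
    have "4 * (c ^ 4 - 8 * u ^ 2 * s ^ 4) = 2 * (c\<^sup>2 * (3 * b\<^sup>2 - a\<^sup>2))"
      using sq fd by algebra
    moreover have "eul 2 ^ 2 * eul 16 ^ 2 / (eul 4 * eul 8) * c = b * s\<^sup>2"
      unfolding b s c using nonz by (simp add: divide_simps del: eul_nonzero) (simp add: eval_nat_numeral)
    ultimately have fin: "2 * (eul 2 ^ 2 * eul 16 ^ 2 / (eul 4 * eul 8)) * (c ^ 4 - 8 * u ^ 2 * s ^ 4) = b * c * (3 * (b\<^sup>2 * s\<^sup>2) - a\<^sup>2 * s\<^sup>2)"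
      by algebra
    have "\<i> * u * P * X / \<i> = u * (2 * P * X) / 2" for P X :: complex
      by (simp add: mult.assoc[symmetric])
    thus ?thesis unfolding psi A a_def[symmetric] b_def[symmetric] c_def[symmetric] fin[symmetric] .
  qed
  finally show ?thesis .
qed

end

section \<open>Antiderivatives\<close>

text \<open>Dividing by the index cancels the factor that differentiating u^j brings down, so u d/du
  returns the Lambert series with kernel v K'(v).\<close>

definition lambert :: "(nat \<Rightarrow> complex) \<Rightarrow> (complex \<Rightarrow> complex) \<Rightarrow> complex \<Rightarrow> complex" where
  "lambert c K u = (\<Sum>k. c (Suc k) / of_nat (Suc k) * K (u ^ Suc k))"

text \<open>The derivative is described after multiplication by \<open>u\<close>, the form in which
  the theta identities come. At u = 0 this leaves its value open.\<close>

lemma lambert_deriv: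
  assumes K: "K holomorphic_on ball 0 1" "K 0 = 0" and c: "\<And>j. norm (c j) \<le> C" and u: "norm u < 1"
  shows "summable (\<lambda>k. c (Suc k) / of_nat (Suc k) * K (u ^ Suc k))"
    and "summable (\<lambda>k. c (Suc k) * (u ^ Suc k * deriv K (u ^ Suc k)))"
    and "\<exists>D. (lambert c K has_field_derivative D) (at u) \<and>
           u * D = (\<Sum>k. c (Suc k) * (u ^ Suc k * deriv K (u ^ Suc k)))"
proof -
  define r where "r = (1 + norm u) / 2"
  have r: "norm u < r" "0 < r" "r < 1" using u by (auto simp: r_def field_simps add_pos_nonneg)
  have b: "norm (v ^ Suc k) \<le> r ^ Suc k" if "v \<in> ball 0 r" for v :: complex and k
    using that by (simp only: norm_power) (intro power_mono, auto)
  have M: "summable (\<lambda>k. r ^ Suc k)" using r by (simp add: summable_mult summable_geometric)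
  have in1: "u ^ Suc k \<in> ball 0 1" for k
    using u by (simp add: norm_power norm_mult del: power_Suc) (metis norm_ge_zero power_Suc_less_one power_eq_0_iff less_le zero_less_Suc power_0_left norm_power zero_less_one power_Suc_0 power_less_one_iff)
  have cc: "norm (c (Suc k) / of_nat (Suc k)) \<le> C" for k
  proof -
    have "norm (c (Suc k) / of_nat (Suc k)) = norm (c (Suc k)) / real (Suc k)" by (simp add: norm_divide del: of_nat_Suc)
    also have "\<dots> \<le> norm (c (Suc k)) / 1" by (intro divide_left_mono) auto
    finally show ?thesis using c[of "Suc k"] by simp
  qed
  have h: "(\<lambda>v. v ^ Suc k) holomorphic_on ball 0 r" for k :: nat by (intro holomorphic_intros)
  have d: "deriv (\<lambda>v. v ^ Suc k) u = of_nat (Suc k) * u ^ k" for k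
    by (rule DERIV_imp_deriv) (rule DERIV_cong[OF DERIV_power[OF DERIV_ident]], simp)
  have ur: "u \<in> ball 0 r" using r by simp
  have S: "open (ball 0 1 :: complex set)" "(0::complex) \<in> ball 0 1" by auto
  define a where "a = (\<lambda>k. c (Suc k) / of_nat (Suc k))"
  have cca: "norm (a k) \<le> C" for k unfolding a_def by (rule cc)
  have A: "summable (\<lambda>k. a k * K (u ^ Suc k))"
    "summable (\<lambda>k. a k * (of_nat (Suc k) * u ^ k * deriv K (u ^ Suc k)))"
    "((\<lambda>v. \<Sum>k. a k * K (v ^ Suc k)) has_field_derivative
        (\<Sum>k. a k * (of_nat (Suc k) * u ^ k * deriv K (u ^ Suc k)))) (at u)"
    by (rule has_field_derivative_series_compose[where \<phi> = "\<lambda>k v. v ^ Suc k" and c = a and C = C,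
        OF K(1) S K(2) h open_ball ur in1 _ M cca, unfolded d], rule b, assumption)+
  have eq: "c (Suc k) / of_nat (Suc k) * (of_nat (Suc k) * u ^ k * deriv K (u ^ Suc k)) = c (Suc k) * (u ^ k * deriv K (u ^ Suc k))" for k
    by (simp del: of_nat_Suc)
  show "summable (\<lambda>k. c (Suc k) / of_nat (Suc k) * K (u ^ Suc k))" using A(1) unfolding a_def .
  have s: "summable (\<lambda>k. c (Suc k) * (u ^ k * deriv K (u ^ Suc k)))"
    using A(2) unfolding a_def eq .
  have um: "u * (c (Suc k) * (u ^ k * deriv K (u ^ Suc k))) = c (Suc k) * (u ^ Suc k * deriv K (u ^ Suc k))" for k
    by simp
  show "summable (\<lambda>k. c (Suc k) * (u ^ Suc k * deriv K (u ^ Suc k)))"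
    using summable_mult[OF s, of u] unfolding um .
  have "(lambert c K has_field_derivative (\<Sum>k. c (Suc k) * (u ^ k * deriv K (u ^ Suc k)))) (at u)"
    using A(3) unfolding a_def eq lambert_def[abs_def] .
  moreover have "u * (\<Sum>k. c (Suc k) * (u ^ k * deriv K (u ^ Suc k))) = (\<Sum>k. c (Suc k) * (u ^ Suc k * deriv K (u ^ Suc k)))"
    using suminf_mult[OF s, of u] unfolding um by simp
  ultimately show "\<exists>D. (lambert c K has_field_derivative D) (at u) \<and>
           u * D = (\<Sum>k. c (Suc k) * (u ^ Suc k * deriv K (u ^ Suc k)))" by blast
qed

text \<open>\<open>lambert\<close> is a primitive of \<open>f\<close> away from 0, and nothing is
  assumed about \<open>f\<close> at 0, where the integrand of (ii) is a division by 0. The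
  fundamental theorem is therefore used in the version that asks for continuity on the closed
  segment and for the derivative only in its interior. It also yields the existence of the
  integral.\<close>

lemma contour_integral_lambert:
  assumes K: "K holomorphic_on ball 0 1" "K 0 = 0" and c: "\<And>j. norm (c j) \<le> C" and w: "norm w < 1"
    and f: "\<And>u. u \<noteq> 0 \<Longrightarrow> norm u < 1 \<Longrightarrow> (\<lambda>k. c (Suc k) * (u ^ Suc k * deriv K (u ^ Suc k))) sums (u * f u)"
  shows "contour_integral (linepath 0 w) f = lambert c K w"
proof (rule contour_integral_unique)
  have D: "\<exists>D. (lambert c K has_field_derivative D) (at u) \<and> (u \<noteq> 0 \<longrightarrow> D = f u)" if u: "norm u < 1" for u
  proof -
    obtain D where D: "(lambert c K has_field_derivative D) (at u)"
       "u * D = (\<Sum>k. c (Suc k) * (u ^ Suc k * deriv K (u ^ Suc k)))"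
      using lambert_deriv(3)[of K c C u, OF K c u] by blast
    have "D = f u" if "u \<noteq> 0"
      using D(2) sums_unique[OF f[OF that u]] that by (metis mult_left_cancel)
    thus ?thesis using D by blast
  qed
  show "(f has_contour_integral lambert c K w) (linepath 0 w)"
  proof (cases "w = 0")
    case True
    thus ?thesis using K(2) by (simp add: lambert_def)
  next
    case False
    have tw: "norm (of_real t * w) < 1" if "t \<in> {0..1}" for t
    proof -
      have "norm (of_real t * w) \<le> 1 * norm w" unfolding norm_mult using that by (intro mult_right_mono) auto
      thus ?thesis using w by simp
    qed
    have "((\<lambda>t. f (of_real t * w) * w) has_integral (lambert c K (of_real 1 * w) - lambert c K (of_real 0 * w))) {0..1}"
    proof (rule fundamental_theorem_of_calculus_interior)
      have "isCont (lambert c K) (of_real t * w)" if "t \<in> {0..1}" for t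
        using D[OF tw[OF that]] DERIV_isCont by blast
      thus "continuous_on {0..1} (\<lambda>t. lambert c K (of_real t * w))"
      proof (intro continuous_at_imp_continuous_on ballI)
        fix t :: real assume "t \<in> {0..1}"
        hence "isCont (lambert c K) (of_real t * w)" by (rule \<open>\<And>t. t \<in> {0..1} \<Longrightarrow> isCont (lambert c K) (of_real t * w)\<close>)
        moreover have "isCont (\<lambda>t. of_real t * w) t" by (intro continuous_intros)
        ultimately show "isCont (\<lambda>t. lambert c K (of_real t * w)) t"
          using isCont_o2[of t "\<lambda>t. of_real t * w" "lambert c K"] by simp
      qed
      show "((\<lambda>t. lambert c K (of_real t * w)) has_vector_derivative f (of_real t * w) * w) (at t)" if "t \<in> {0<..<1}" for t
      proof -
        have "of_real t * w \<noteq> 0" using that False by auto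
        hence "(lambert c K has_field_derivative f (of_real t * w)) (at (of_real t * w))"
          using D[OF tw[of t]] that by auto
        moreover have "((\<lambda>t. of_real t * w) has_vector_derivative w) (at t)"
          by (auto intro!: derivative_eq_intros simp: has_vector_derivative_def scaleR_conv_of_real)
        ultimately show ?thesis
          using field_vector_diff_chain_at[of "\<lambda>t. of_real t * w" w t "lambert c K" "f (of_real t * w)"]
          by (simp add: o_def mult.commute)
      qed
    qed auto
    moreover have "lambert c K 0 = 0" using K(2) by (simp add: lambert_def)
    ultimately show ?thesis
      unfolding has_contour_integral_linepath by (simp add: linepath_def scaleR_conv_of_real)
  qed
qed

text \<open>Real primitive Dirichlet characters modulo 3, 4 and 8. The first two are odd;
  \<open>chi8\<close> is the even one, the Jacobi symbol (2 / j).\<close>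

definition chi3 :: "nat \<Rightarrow> complex" where
  "chi3 j = (if j mod 3 = 1 then 1 else if j mod 3 = 2 then - 1 else 0)"

definition chi4 :: "nat \<Rightarrow> complex" where
  "chi4 j = (if j mod 4 = 1 then 1 else if j mod 4 = 3 then - 1 else 0)"

definition chi8 :: "nat \<Rightarrow> complex" where
  "chi8 j = (if j mod 8 = 1 \<or> j mod 8 = 7 then 1 else if j mod 8 = 3 \<or> j mod 8 = 5 then - 1 else 0)"

lemma chi_0 [simp]: "chi3 0 = 0" "chi4 0 = 0" "chi8 0 = 0"
  by (simp_all add: chi3_def chi4_def chi8_def)

lemma chi_periodic [simp]: "chi3 (3 * n + i) = chi3 i" "chi4 (4 * n + i) = chi4 i" "chi8 (8 * n + i) = chi8 i"
  by (simp_all add: chi3_def chi4_def chi8_def)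

lemma sum_residues:
  fixes f :: "nat \<Rightarrow> complex"
  shows "(\<Sum>i<3. chi3 i * f i) = f 1 - f 2" "(\<Sum>i<4. chi4 i * f i) = f 1 - f 3"
    "(\<Sum>i<8. 2 * chi8 i * f i) = 2 * (f 1 - f 3 - f 5 + f 7)"
proof -
  have 3: "{..<3} = {0, 1, 2 :: nat}" and 4: "{..<4} = {0, 1, 2, 3 :: nat}" and
    8: "{..<8} = {0, 1, 2, 3, 4, 5, 6, 7 :: nat}" by auto
  show "(\<Sum>i<3. chi3 i * f i) = f 1 - f 2" unfolding 3 by (simp add: chi3_def)
  show "(\<Sum>i<4. chi4 i * f i) = f 1 - f 3" unfolding 4 by (simp add: chi4_def)
  show "(\<Sum>i<8. 2 * chi8 i * f i) = 2 * (f 1 - f 3 - f 5 + f 7)" unfolding 8 by (simp add: chi8_def algebra_simps)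
qed

text \<open>The theta identities give the series only grouped into periods; summability, known from
  the differentiated Lambert series, allows the grouping to be dissolved.\<close>

lemma sums_periodic:
  assumes "summable (\<lambda>k. c (Suc k) * g (Suc k) :: complex)" "c 0 = 0" "m > 0"
    and "(\<lambda>n. \<Sum>i<m. c (m * n + i) * g (m * n + i)) sums s"
  shows "(\<lambda>k. c (Suc k) * g (Suc k)) sums s"
proof -
  define f where "f = (\<lambda>j. c j * g j)"
  have "summable f" using assms(1) unfolding f_def summable_Suc_iff[of "\<lambda>j. c j * g j"] .
  hence "(\<lambda>n. sum f {n * m..<n * m + m}) sums suminf f"
    using assms(3) by (intro sums_group summable_sums)
  moreover have "sum f {n * m..<n * m + m} = (\<Sum>i<m. c (m * n + i) * g (m * n + i))" for n
    using sum.shift_bounds_nat_ivl[of f 0 "n * m" m] by (simp add: f_def lessThan_atLeast0 add.commute mult.commute)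
  ultimately have "suminf f = s" using assms(4) sums_unique2 by simp
  with \<open>summable f\<close> have "f sums s" by (simp add: sums_iff)
  hence "(\<lambda>k. f (Suc k)) sums (s - f 0)" by (subst sums_Suc_iff) simp
  thus ?thesis using assms(2) by (simp add: f_def)
qed

lemma li1_disc: "li1 holomorphic_on ball 0 1" "norm v < 1 \<Longrightarrow> v * deriv li1 v = li2 v"
proof -
  show "li1 holomorphic_on ball 0 1"
    by (rule holomorphic_on_subset[OF holomorphic_li(2)]) auto
  assume "norm v < 1"
  hence "v \<noteq> 1" by auto
  thus "v * deriv li1 v = li2 v" by (rule deriv_li(2))
qed

lemma odd_li1_disc: "odd_li1 holomorphic_on ball 0 1" "norm v < 1 \<Longrightarrow> v * deriv odd_li1 v = odd_li2 v" "odd_li1 0 = 0"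
proof -
  have h: "(\<lambda>v. li1 (s * v)) holomorphic_on ball 0 1" if "norm s = 1" for s
    using that by (intro holomorphic_on_compose_gen[OF _ li1_disc(1), unfolded o_def] holomorphic_intros) (auto simp: norm_mult)
  show "odd_li1 holomorphic_on ball 0 1"
    unfolding odd_li1_def[abs_def] using h[of \<i>] h[of "- \<i>"] by (intro holomorphic_intros) auto
  show "odd_li1 0 = 0" by (simp add: odd_li1_def)
  assume v: "norm v < 1"
  hence n: "norm (\<i> * v) < 1" "norm (- (\<i> * v)) < 1" by (simp_all add: norm_mult)
  hence "\<i> * v \<noteq> 1" "- (\<i> * v) \<noteq> 1" by (metis norm_one order_less_irrefl)+
  note D = DERIV_chain2[where g = "\<lambda>v. \<i> * v", OF DERIV_li1[OF this(1)]]
    DERIV_chain2[where g = "\<lambda>v. - (\<i> * v)", OF DERIV_li1[OF this(2)]]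
  have "((\<lambda>v. li1 (\<i> * v)) has_field_derivative (1 + \<i> * v) / (1 - \<i> * v) ^ 3 * \<i>) (at v)"
    by (rule D(1)) (auto intro!: derivative_eq_intros)
  moreover have "((\<lambda>v. li1 (- (\<i> * v))) has_field_derivative (1 + - (\<i> * v)) / (1 - - (\<i> * v)) ^ 3 * (- \<i>)) (at v)"
    by (rule D(2)) (auto intro!: derivative_eq_intros)
  ultimately have "(odd_li1 has_field_derivative ((1 + \<i> * v) / (1 - \<i> * v) ^ 3 * \<i> - (1 + - (\<i> * v)) / (1 - - (\<i> * v)) ^ 3 * (- \<i>)) / (2 * \<i>)) (at v)"
    unfolding odd_li1_def[abs_def] by (intro DERIV_cdivide DERIV_diff)
  from DERIV_imp_deriv[OF this] show "v * deriv odd_li1 v = odd_li2 v"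
    by (simp add: odd_li2_def li2_def algebra_simps)
qed

section \<open>The four integrals as values of Lambert series\<close>

context
  fixes w :: complex
  assumes w: "norm w < 1"
begin

lemma norm_pow_lt: "norm (u::complex) < 1 \<Longrightarrow> norm (u ^ Suc k) < 1"
  by (metis norm_ge_zero norm_power power_less_one_iff zero_less_Suc)

lemma integral_f: "contour_integral (linepath 0 w) (\<lambda>u. ram_f (- (u ^ 3)) ^ 9 / ram_f (- u) ^ 3) = lambert chi3 li1 w"
proof (rule contour_integral_lambert[OF li1_disc(1) _ _ w])
  show c: "norm (chi3 j) \<le> 1" for j by (simp add: chi3_def)
  fix u :: complex assume u: "u \<noteq> 0" "norm u < 1"
  interpret unit_disc u using u by unfold_locales
  have eq: "u ^ Suc k * deriv li1 (u ^ Suc k) = li2 (u ^ Suc k)" for k by (rule li1_disc(2)[OF norm_pow_lt[OF u(2)]])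
  have "(\<Sum>i<3. chi3 (3 * n + i) * li2 (u ^ (3 * n + i))) = li2 (u ^ (3 * n + 1)) - li2 (u ^ (3 * n + 2))" for n
    unfolding chi_periodic by (rule sum_residues)
  hence "(\<lambda>n. \<Sum>i<3. chi3 (3 * n + i) * li2 (u ^ (3 * n + i))) sums (u * ram_f (- (u ^ 3)) ^ 9 / ram_f (- u) ^ 3)"
    using f_sums by (simp only:)
  hence "(\<lambda>k. chi3 (Suc k) * li2 (u ^ Suc k)) sums (u * ram_f (- (u ^ 3)) ^ 9 / ram_f (- u) ^ 3)"
    by (rule sums_periodic[of chi3 "\<lambda>j. li2 (u ^ j)" 3, OF lambert_deriv(2)[OF li1_disc(1) li_0(2) c u(2), unfolded eq] chi_0(1) zero_less_numeral])
  thus "(\<lambda>k. chi3 (Suc k) * (u ^ Suc k * deriv li1 (u ^ Suc k))) sums (u * (ram_f (- (u ^ 3)) ^ 9 / ram_f (- u) ^ 3))"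
    unfolding eq by simp
qed simp

lemma integral_phi2_psi4: "contour_integral (linepath 0 w) (\<lambda>u. ram_phi u ^ 2 * ram_psi (u\<^sup>2) ^ 4) = lambert chi4 li1 w"
proof (rule contour_integral_lambert[OF li1_disc(1) _ _ w])
  show c: "norm (chi4 j) \<le> 1" for j by (simp add: chi4_def)
  fix u :: complex assume u: "u \<noteq> 0" "norm u < 1"
  interpret unit_disc u using u by unfold_locales
  have eq: "u ^ Suc k * deriv li1 (u ^ Suc k) = li2 (u ^ Suc k)" for k by (rule li1_disc(2)[OF norm_pow_lt[OF u(2)]])
  have "(\<Sum>i<4. chi4 (4 * n + i) * li2 (u ^ (4 * n + i))) = li2 (u ^ (4 * n + 1)) - li2 (u ^ (4 * n + 3))" for n
    unfolding chi_periodic by (rule sum_residues)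
  hence "(\<lambda>n. \<Sum>i<4. chi4 (4 * n + i) * li2 (u ^ (4 * n + i))) sums (u * (ram_phi u ^ 2 * ram_psi (u\<^sup>2) ^ 4))"
    using phi2_psi4_sums by (simp only:)
  hence "(\<lambda>k. chi4 (Suc k) * li2 (u ^ Suc k)) sums (u * (ram_phi u ^ 2 * ram_psi (u\<^sup>2) ^ 4))"
    by (rule sums_periodic[of chi4 "\<lambda>j. li2 (u ^ j)" 4, OF lambert_deriv(2)[OF li1_disc(1) li_0(2) c u(2), unfolded eq] chi_0(2) zero_less_numeral])
  thus "(\<lambda>k. chi4 (Suc k) * (u ^ Suc k * deriv li1 (u ^ Suc k))) sums (u * (ram_phi u ^ 2 * ram_psi (u\<^sup>2) ^ 4))"
    unfolding eq .
qed simp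

lemma integral_phi2_phi4:
  "contour_integral (linepath 0 w) (\<lambda>u. (ram_phi (- u) ^ 2 * ram_phi u ^ 4 - 1) / u) = lambert (\<lambda>j. - 4 * (- 1) ^ j) odd_li1 w"
proof (rule contour_integral_lambert[OF odd_li1_disc(1,3) _ w])
  show "norm (- 4 * (- 1) ^ j :: complex) \<le> 4" for j by (simp add: norm_mult norm_power)
  fix u :: complex assume u: "u \<noteq> 0" "norm u < 1"
  interpret unit_disc u using u by unfold_locales
  have eq: "u ^ Suc k * deriv odd_li1 (u ^ Suc k) = odd_li2 (u ^ Suc k)" for k by (rule odd_li1_disc(2)[OF norm_pow_lt[OF u(2)]])
  show "(\<lambda>k. - 4 * (- 1) ^ Suc k * (u ^ Suc k * deriv odd_li1 (u ^ Suc k))) sums (u * ((ram_phi (- u) ^ 2 * ram_phi u ^ 4 - 1) / u))"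
    using phi2_phi4_sums u unfolding eq by simp
qed

lemma integral_odd:
  "contour_integral (linepath 0 w)
            (\<lambda>u. ram_phi (- (u\<^sup>2)) * ram_phi (u ^ 4) *
                 (3 * ram_psi (- (u\<^sup>2)) ^ 4 - ram_psi (u\<^sup>2) ^ 4)) = lambert (\<lambda>j. 2 * chi8 j) odd_li1 w"
proof (rule contour_integral_lambert[OF odd_li1_disc(1,3) _ w])
  show c: "norm (2 * chi8 j) \<le> 2" for j by (simp add: chi8_def)
  have z: "2 * chi8 0 = 0" by simp
  fix u :: complex assume u: "u \<noteq> 0" "norm u < 1"
  interpret unit_disc u using u by unfold_locales
  have eq: "u ^ Suc k * deriv odd_li1 (u ^ Suc k) = odd_li2 (u ^ Suc k)" for k by (rule odd_li1_disc(2)[OF norm_pow_lt[OF u(2)]])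
  have "(\<Sum>i<8. 2 * chi8 (8 * n + i) * odd_li2 (u ^ (8 * n + i))) =
      2 * (odd_li2 (u ^ (8 * n + 1)) - odd_li2 (u ^ (8 * n + 3)) - odd_li2 (u ^ (8 * n + 5)) + odd_li2 (u ^ (8 * n + 7)))" for n
    unfolding chi_periodic by (rule sum_residues)
  hence "(\<lambda>n. \<Sum>i<8. 2 * chi8 (8 * n + i) * odd_li2 (u ^ (8 * n + i))) sums (u * (ram_phi (- (u\<^sup>2)) * ram_phi (u ^ 4) *
                 (3 * ram_psi (- (u\<^sup>2)) ^ 4 - ram_psi (u\<^sup>2) ^ 4)))"
    using sums_mult[OF odd_li2_sums, of 2] by (simp del: chi_periodic)
  hence "(\<lambda>k. 2 * chi8 (Suc k) * odd_li2 (u ^ Suc k)) sums (u * (ram_phi (- (u\<^sup>2)) * ram_phi (u ^ 4) *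
                 (3 * ram_psi (- (u\<^sup>2)) ^ 4 - ram_psi (u\<^sup>2) ^ 4)))"
    by (rule sums_periodic[of "\<lambda>j. 2 * chi8 j" "\<lambda>j. odd_li2 (u ^ j)" 8, OF lambert_deriv(2)[OF odd_li1_disc(1,3) c u(2), unfolded eq] z zero_less_numeral])
  thus "(\<lambda>k. 2 * chi8 (Suc k) * (u ^ Suc k * deriv odd_li1 (u ^ Suc k))) sums (u * (ram_phi (- (u\<^sup>2)) * ram_phi (u ^ 4) *
                 (3 * ram_psi (- (u\<^sup>2)) ^ 4 - ram_psi (u\<^sup>2) ^ 4)))"
    unfolding eq .
qed

end

section \<open>Row sums\<close>

lemma has_sum_int_split:
  fixes f :: "int \<Rightarrow> 'a :: real_normed_vector"
  assumes "((\<lambda>k. f (int k)) has_sum A) UNIV" "((\<lambda>k. f (- int (Suc k))) has_sum B) UNIV"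
  shows "(f has_sum A + B) UNIV"
proof -
  have "(f has_sum A) (range int)" "(f has_sum B) (range (\<lambda>k. - int (Suc k)))"
    using assms by (subst has_sum_reindex; simp add: inj_def o_def del: of_nat_Suc)+
  hence "(f has_sum A + B) (range int \<union> range (\<lambda>k. - int (Suc k)))"
  proof (rule has_sum_Un_disjoint)
    have "int k \<noteq> - int (Suc j)" for k j by linarith
    thus "range int \<inter> range (\<lambda>k. - int (Suc k)) = {}" by blast
  qed
  moreover have "n \<in> range int \<union> range (\<lambda>k. - int (Suc k))" for n
    by (cases n rule: int_cases) (auto simp del: of_nat_Suc)
  hence "range int \<union> range (\<lambda>k. - int (Suc k)) = UNIV" by blast
  ultimately show ?thesis by simp
qed

lemma Im_mult_of_real: "Im (of_real r * w) = r * Im w"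
  by simp

section \<open>Partial fractions by way of polygamma functions\<close>

lemma Re_in_unit_not_Ints: "0 < Re z \<Longrightarrow> Re z < 1 \<Longrightarrow> z \<notin> \<int>"
  by (auto elim!: Ints_cases)

text \<open>The logarithmic derivative of Euler's reflection formula. Differentiating once and twice
  more leads to 1 / sin^2 and cos / sin^3, while the polygamma functions are one-sided sums of
  powers.\<close>

lemma Digamma_reflection:
  fixes z :: complex
  assumes "z \<notin> \<int>"
  shows "Digamma z - Digamma (1 - z) = - (pi * cos (pi * z) / sin (pi * z))"
proof -
  have nz: "z \<notin> \<int>\<^sub>\<le>\<^sub>0" "1 - z \<notin> \<int>\<^sub>\<le>\<^sub>0"
    using assms nonpos_Ints_subset_Ints Ints_diff[of 1 "1 - z"] by auto
  have s: "sin (pi * w) \<noteq> 0" if "w \<notin> \<int>" for w :: complex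
    using that by (auto simp: sin_eq_0 elim!: Ints_cases)
  have 1: "((\<lambda>z. Gamma z * Gamma (1 - z)) has_field_derivative Gamma z * Gamma (1 - z) * (Digamma z - Digamma (1 - z))) (at z)"
    using nz by (auto intro!: derivative_eq_intros simp: algebra_simps)
  have 2: "((\<lambda>z. of_real pi / sin (of_real pi * z)) has_field_derivative
      - (pi * (cos (pi * z) * pi)) / (sin (pi * z) * sin (pi * z))) (at z)"
    using s[OF assms] by (auto intro!: derivative_eq_intros)
  have 3: "eventually (\<lambda>z. Gamma z * Gamma (1 - z) = of_real pi / sin (of_real pi * z)) (nhds z)"
    by (simp add: Gamma_reflection_complex)
  have "Gamma z * Gamma (1 - z) * (Digamma z - Digamma (1 - z)) = - (pi * (cos (pi * z) * pi)) / (sin (pi * z) * sin (pi * z))"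
    by (rule DERIV_unique[OF 1 DERIV_eventually_eq[OF 2 3]])
  hence eq: "of_real pi / sin (pi * z) * (Digamma z - Digamma (1 - z)) = - (pi * (cos (pi * z) * pi)) / (sin (pi * z) * sin (pi * z))"
    by (simp add: Gamma_reflection_complex)
  have "Digamma z - Digamma (1 - z) = sin (pi * z) / pi * (of_real pi / sin (pi * z) * (Digamma z - Digamma (1 - z)))"
    using s[OF assms] by simp
  also have "\<dots> = - (pi * cos (pi * z) / sin (pi * z))"
    unfolding eq using s[OF assms] by simp
  finally show ?thesis .
qed

lemma Polygamma_reflection:
  fixes z :: complex
  assumes "z \<notin> \<int>"
  shows "Polygamma 1 z + Polygamma 1 (1 - z) = pi\<^sup>2 / sin (pi * z) ^ 2"
    and "Polygamma 2 z - Polygamma 2 (1 - z) = - (2 * pi ^ 3 * cos (pi * z) / sin (pi * z) ^ 3)"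
proof -
  have s: "sin (pi * w) \<noteq> 0" if "w \<notin> \<int>" for w :: complex
    using that by (auto simp: sin_eq_0 elim!: Ints_cases)
  have ev: "eventually (\<lambda>w. w \<notin> \<int>) (nhds z)" if "z \<notin> \<int>" for z :: complex
    using eventually_nhds_in_open[of "- \<int>" z] that closed_Ints by (simp add: open_Compl)
  have nz: "z \<notin> \<int>\<^sub>\<le>\<^sub>0" "1 - z \<notin> \<int>\<^sub>\<le>\<^sub>0" if "z \<notin> \<int>" for z :: complex
    using that nonpos_Ints_subset_Ints Ints_diff[of 1 "1 - z"] by auto
  have 1: "Polygamma 1 z + Polygamma 1 (1 - z) = pi\<^sup>2 / sin (pi * z) ^ 2" if z: "z \<notin> \<int>" for z :: complex
  proof (rule DERIV_unique)
    show "((\<lambda>z. Digamma z - Digamma (1 - z)) has_field_derivative Polygamma 1 z + Polygamma 1 (1 - z)) (at z)"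
      using nz[OF z] by (auto intro!: derivative_eq_intros)
    have "((\<lambda>z. - (pi * cos (pi * z) / sin (pi * z))) has_field_derivative
        - ((pi * (- sin (pi * z) * pi) * sin (pi * z) - pi * cos (pi * z) * (cos (pi * z) * pi)) / (sin (pi * z) * sin (pi * z)))) (at z)"
      using s[OF z] by (auto intro!: derivative_eq_intros)
    also have "- ((pi * (- sin (pi * z) * pi) * sin (pi * z) - pi * cos (pi * z) * (cos (pi * z) * pi)) / (sin (pi * z) * sin (pi * z)))
      = pi\<^sup>2 * (sin (pi * z) ^ 2 + cos (pi * z) ^ 2) / sin (pi * z) ^ 2"
    proof -
      have "- ((p * (- S * p) * S - p * C * (C * p)) / (S * S)) = p\<^sup>2 * (S\<^sup>2 + C\<^sup>2) / S\<^sup>2" for p S C :: complex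
        by (subst minus_divide_left, rule arg_cong2[of _ _ _ _ "(/)"]) (simp_all add: power2_eq_square algebra_simps)
      thus ?thesis unfolding of_real_power .
    qed
    finally have "((\<lambda>z. - (pi * cos (pi * z) / sin (pi * z))) has_field_derivative pi\<^sup>2 / sin (pi * z) ^ 2) (at z)"
      by (simp only: sin_cos_squared_add mult_1_right)
    thus "((\<lambda>z. Digamma z - Digamma (1 - z)) has_field_derivative pi\<^sup>2 / sin (pi * z) ^ 2) (at z)"
      by (rule DERIV_eventually_eq) (use ev[OF z] Digamma_reflection in \<open>auto elim!: eventually_mono\<close>)
  qed
  show "Polygamma 1 z + Polygamma 1 (1 - z) = pi\<^sup>2 / sin (pi * z) ^ 2" by (rule 1[OF assms])
  show "Polygamma 2 z - Polygamma 2 (1 - z) = - (2 * pi ^ 3 * cos (pi * z) / sin (pi * z) ^ 3)"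
  proof (rule DERIV_unique)
    show "((\<lambda>z. Polygamma 1 z + Polygamma 1 (1 - z)) has_field_derivative Polygamma 2 z - Polygamma 2 (1 - z)) (at z)"
      using nz[OF assms] by (auto intro!: derivative_eq_intros simp: numeral_2_eq_2)
    have "((\<lambda>z. of_real pi ^ 2 / sin (of_real pi * z) ^ 2) has_field_derivative
       - (of_real pi ^ 2 * (2 * sin (pi * z) * (cos (pi * z) * pi))) / (sin (pi * z) ^ 2 * sin (pi * z) ^ 2)) (at z)"
      using s[OF assms] by (auto intro!: derivative_eq_intros)
    also have "- (of_real pi ^ 2 * (2 * sin (pi * z) * (cos (pi * z) * pi))) / (sin (pi * z) ^ 2 * sin (pi * z) ^ 2) =
        - (2 * of_real pi ^ 3 * cos (pi * z) / sin (pi * z) ^ 3)"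
      using s[OF assms] by (simp add: divide_simps) (simp add: eval_nat_numeral)
    finally have D: "((\<lambda>z. of_real pi ^ 2 / sin (of_real pi * z) ^ 2) has_field_derivative
        - (2 * of_real pi ^ 3 * cos (pi * z) / sin (pi * z) ^ 3)) (at z)" .
    have "eventually (\<lambda>z. Polygamma 1 z + Polygamma 1 (1 - z) = of_real pi ^ 2 / sin (of_real pi * z) ^ 2) (nhds z)"
      using ev[OF assms] unfolding of_real_power[symmetric] by eventually_elim (rule 1)
    from DERIV_eventually_eq[OF D this]
    show "((\<lambda>z. Polygamma 1 z + Polygamma 1 (1 - z)) has_field_derivative - (2 * pi ^ 3 * cos (pi * z) / sin (pi * z) ^ 3)) (at z)"
      by (simp only: of_real_power of_real_mult of_real_numeral)
  qed
qed

lemma norm_summable_shifted_power: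
  fixes z :: complex
  assumes "0 < Re z" "n \<ge> 2"
  shows "summable (\<lambda>k. norm (inverse ((z + of_nat k) ^ n)))"
proof (rule summable_comparison_test_ev)
  show "summable (\<lambda>k. inverse (real k ^ n))" using inverse_power_summable[of n] assms by simp
  show "eventually (\<lambda>k. norm (norm (inverse ((z + of_nat k) ^ n))) \<le> inverse (real k ^ n)) sequentially"
    using eventually_gt_at_top[of 0]
  proof eventually_elim
    case (elim k)
    have "real k \<le> Re (z + of_nat k)" using assms by simp
    also have "\<dots> \<le> norm (z + of_nat k)" by (rule complex_Re_le_cmod)
    finally have "real k ^ n \<le> norm (z + of_nat k) ^ n" by (intro power_mono) auto
    thus ?case using elim by (simp add: norm_inverse norm_power le_imp_inverse_le)
  qed
qed

text \<open>The terms with k \<ge> 0 form a polygamma series at z, those with k < 0 one at 1 - z,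
  with a sign for odd powers.\<close>

lemma has_sum_shifted_powers:
  fixes z :: complex
  assumes "0 < Re z" "Re z < 1"
  shows "((\<lambda>k::int. 1 / (z + of_int k)\<^sup>2) has_sum (of_real pi)\<^sup>2 / sin (pi * z) ^ 2) UNIV"
    and "((\<lambda>k::int. 1 / (z + of_int k) ^ 3) has_sum of_real pi ^ 3 * cos (pi * z) / sin (pi * z) ^ 3) UNIV"
proof -
  have re: "0 < Re (1 - z)" using assms by simp
  have A: "((\<lambda>k. inverse ((w + of_nat k) ^ n)) has_sum (\<Sum>k. inverse ((w + of_nat k) ^ n))) UNIV"
    if "0 < Re w" "n \<ge> 2" for w :: complex and n
    using norm_summable_shifted_power[OF that] by (metis norm_summable_imp_has_sum summable_norm_cancel summable_sums)
  have m: "z + of_int (- int (Suc k)) = - (1 - z + of_nat k)" for k by simp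
  have "((\<lambda>k::int. 1 / (z + of_int k)\<^sup>2) has_sum (\<Sum>k. inverse ((z + of_nat k) ^ 2)) + (\<Sum>k. inverse ((1 - z + of_nat k) ^ 2))) UNIV"
  proof (rule has_sum_int_split)
    show "((\<lambda>k. 1 / (z + of_int (int k))\<^sup>2) has_sum (\<Sum>k. inverse ((z + of_nat k) ^ 2))) UNIV"
      using A[OF assms(1), of 2] by (simp add: inverse_eq_divide)
    show "((\<lambda>k. 1 / (z + of_int (- int (Suc k)))\<^sup>2) has_sum (\<Sum>k. inverse ((1 - z + of_nat k) ^ 2))) UNIV"
      unfolding m power2_minus using A[OF re, of 2] by (simp add: inverse_eq_divide)
  qed
  also have "(\<Sum>k. inverse ((z + of_nat k) ^ 2)) + (\<Sum>k. inverse ((1 - z + of_nat k) ^ 2)) = Polygamma 1 z + Polygamma 1 (1 - z)"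
    by (simp add: Polygamma_def numeral_2_eq_2)
  finally show "((\<lambda>k::int. 1 / (z + of_int k)\<^sup>2) has_sum (of_real pi)\<^sup>2 / sin (pi * z) ^ 2) UNIV"
    unfolding Polygamma_reflection(1)[OF Re_in_unit_not_Ints[OF assms]] by simp
  have "((\<lambda>k::int. 1 / (z + of_int k) ^ 3) has_sum (\<Sum>k. inverse ((z + of_nat k) ^ 3)) + - (\<Sum>k. inverse ((1 - z + of_nat k) ^ 3))) UNIV"
  proof (rule has_sum_int_split)
    show "((\<lambda>k. 1 / (z + of_int (int k)) ^ 3) has_sum (\<Sum>k. inverse ((z + of_nat k) ^ 3))) UNIV"
      using A[OF assms(1), of 3] by (simp add: inverse_eq_divide)
    show "((\<lambda>k. 1 / (z + of_int (- int (Suc k))) ^ 3) has_sum - (\<Sum>k. inverse ((1 - z + of_nat k) ^ 3))) UNIV"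
    proof -
      have "1 / (- w) ^ 3 = - inverse (w ^ 3)" for w :: complex
        by (simp add: power_minus_odd inverse_eq_divide)
      thus ?thesis unfolding m using has_sum_uminusI[OF A[OF re, of 3]] by (simp only:)
    qed
  qed
  also have "(\<Sum>k. inverse ((z + of_nat k) ^ 3)) + - (\<Sum>k. inverse ((1 - z + of_nat k) ^ 3)) = - (Polygamma 2 z - Polygamma 2 (1 - z)) / 2"
    by (simp add: Polygamma_def numeral_3_eq_3 numeral_2_eq_2)
  finally show "((\<lambda>k::int. 1 / (z + of_int k) ^ 3) has_sum of_real pi ^ 3 * cos (pi * z) / sin (pi * z) ^ 3) UNIV"
    unfolding Polygamma_reflection(2)[OF Re_in_unit_not_Ints[OF assms]] by simp
qed

lemma csc_square_eq_li1: "sin z \<noteq> 0 \<Longrightarrow> 1 / (sin z)\<^sup>2 = - 4 * li1 (exp (2 * \<i> * z))"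
proof -
  assume s: "sin z \<noteq> 0"
  define e where "e = exp (\<i> * z)"
  have e0: "e \<noteq> 0" by (simp add: e_def)
  have e2: "exp (2 * \<i> * z) = e\<^sup>2" by (simp add: e_def mult.assoc exp_double)
  have sin: "sin z = (e - 1 / e) / (2 * \<i>)"
    by (simp add: sin_exp_eq e_def exp_minus inverse_eq_divide)
  have "(sin z)\<^sup>2 = - ((1 - e\<^sup>2)\<^sup>2 / (4 * e\<^sup>2))"
    unfolding sin using e0 by (simp add: power2_eq_square field_simps)
  moreover from this have "1 - e\<^sup>2 \<noteq> 0" using s by auto
  ultimately show ?thesis unfolding e2 li1_def using e0 s by (simp add: divide_simps) (simp add: mult_ac)
qed

text \<open>For z = (1 + \<i> y) / N the term is a constant times the imaginary part of 1 / (z +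
  k)^2. The sum is thus the imaginary part of 1 / sin^2 (pi z), and \<open>li1\<close> expresses
  that function in exp (2 pi \<i> z), a root of unity times a real exponential.\<close>

lemma has_sum_row:
  fixes y :: real
  assumes N: "N \<ge> 2" and y: "y > 0"
  shows "((\<lambda>k::int. (real N * of_int k + 1) / ((real N * of_int k + 1)\<^sup>2 + y\<^sup>2)\<^sup>2) has_sum
    (2 * pi\<^sup>2 / ((real N)\<^sup>2 * y) * Im (li1 (exp (2 * pi * \<i> / of_nat N) * exp (- 2 * pi * y / real N))))) UNIV"
proof -
  define z where "z = (1 + \<i> * y) / of_nat N"
  have N0: "real N > 1" using N by simp
  have z: "0 < Re z" "Re z < 1" "Im z = y / N" using N0 by (simp_all add: z_def)
  have "sin (pi * z) \<noteq> 0"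
  proof
    assume "sin (of_real pi * z) = 0"
    then obtain n :: int where "of_real pi * z = of_real (of_int n * pi)" unfolding sin_eq_0 by (auto simp: mult_ac)
    hence "Im (of_real pi * z) = 0" by (metis Im_complex_of_real)
    thus False using z(3) y N0 by simp
  qed
  note csc = csc_square_eq_li1[OF this]
  have e: "exp (2 * \<i> * (pi * z)) = exp (2 * pi * \<i> / of_nat N) * exp (- 2 * pi * y / real N)"
    using N0 by (simp add: z_def exp_of_real[symmetric] field_simps flip: exp_add)
  have "((\<lambda>k::int. Im (1 / (z + of_int k)\<^sup>2) * (- (1 / (2 * y * (real N)\<^sup>2)))) has_sum
      Im ((of_real pi)\<^sup>2 / sin (pi * z) ^ 2) * (- (1 / (2 * y * (real N)\<^sup>2)))) UNIV"
    by (intro has_sum_cmult_left has_sum_Im has_sum_shifted_powers z)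
  moreover have "Im ((of_real pi)\<^sup>2 / sin (pi * z) ^ 2) * (- (1 / (2 * y * (real N)\<^sup>2))) =
     2 * pi\<^sup>2 / ((real N)\<^sup>2 * y) * Im (li1 (exp (2 * pi * \<i> / of_nat N) * exp (- 2 * pi * y / real N)))"
  proof -
    have "(of_real pi)\<^sup>2 / sin (pi * z) ^ 2 = of_real (pi\<^sup>2) * (- 4 * li1 (exp (2 * \<i> * (pi * z))))"
      using csc by (simp add: divide_inverse)
    hence "Im ((of_real pi)\<^sup>2 / sin (pi * z) ^ 2) = - 4 * pi\<^sup>2 * Im (li1 (exp (2 * \<i> * (pi * z))))"
      by (simp only: Im_mult_of_real) simp
    thus ?thesis unfolding e using N0 y by (simp add: field_simps)
  qed
  moreover have "Im (1 / (z + of_int k)\<^sup>2) * (- (1 / (2 * y * (real N)\<^sup>2))) =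
      (real N * of_int k + 1) / ((real N * of_int k + 1)\<^sup>2 + y\<^sup>2)\<^sup>2" for k :: int
  proof -
    define a where "a = real N * of_int k + 1"
    have zk: "z + of_int k = (Complex a y) / of_nat N"
      using N0 by (simp add: z_def a_def complex_eq_iff field_simps)
    have D: "a\<^sup>2 + y\<^sup>2 > 0" using y by (simp add: sum_power2_gt_zero_iff)
    have c2: "(Complex a y)\<^sup>2 = Complex (a\<^sup>2 - y\<^sup>2) (2 * a * y)"
      by (simp add: complex_eq_iff power2_eq_square)
    have d: "(a\<^sup>2 - y\<^sup>2)\<^sup>2 + (2 * a * y)\<^sup>2 = (a\<^sup>2 + y\<^sup>2)\<^sup>2" by algebra
    have "1 / (z + of_int k)\<^sup>2 = of_real ((real N)\<^sup>2) * (1 / (Complex a y)\<^sup>2)"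
      unfolding zk by (simp add: power_divide)
    hence "Im (1 / (z + of_int k)\<^sup>2) = (real N)\<^sup>2 * Im (1 / (Complex a y)\<^sup>2)"
      by (simp only: Im_mult_of_real)
    also have "Im (1 / (Complex a y)\<^sup>2) = - (2 * a * y) / (a\<^sup>2 + y\<^sup>2)\<^sup>2"
      unfolding c2 by (simp add: Im_divide d)
    finally show ?thesis unfolding a_def[symmetric] using y N0 D by (simp add: field_simps)
  qed
  ultimately show ?thesis by simp
qed

text \<open>Needed for the row n = 0 of \<open>F12\<close>, where y would be 0 and
  \<open>has_sum_row\<close> does not apply.\<close>

lemma has_sum_cubes_mod_4: "((\<lambda>k::int. 1 / (4 * of_int k + 1) ^ 3 :: real) has_sum pi ^ 3 / 32) UNIV"
proof -
  have p: "0 < Re (1 / 4)" "Re (1 / 4) < 1" by simp_all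
  note r = has_sum_cmult_left[OF has_sum_Re[OF has_sum_shifted_powers(2)[OF p]], of "1 / 64"]
  have "Re (1 / (1 / 4 + of_int k) ^ 3) * (1 / 64) = 1 / (4 * of_int k + 1) ^ 3" for k :: int
  proof -
    have "(1 / 4 + of_int k :: complex) = of_real ((4 * of_int k + 1) / 4)" by (simp add: field_simps)
    hence "1 / (1 / 4 + of_int k :: complex) ^ 3 = of_real (1 / ((4 * of_int k + 1) / 4) ^ 3)" by (simp only: of_real_divide of_real_1 of_real_power)
    thus ?thesis by (simp only: Re_complex_of_real) (simp add: power_divide)
  qed
  moreover have "of_real pi ^ 3 * cos (complex_of_real pi * (1 / 4)) / sin (complex_of_real pi * (1 / 4)) ^ 3 = complex_of_real (pi ^ 3 * cos (pi / 4) / sin (pi / 4) ^ 3)"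
  proof -
    have "complex_of_real pi * (1 / 4) = of_real (pi / 4)" by simp
    hence "cos (complex_of_real pi * (1 / 4)) = of_real (cos (pi / 4))" "sin (complex_of_real pi * (1 / 4)) = of_real (sin (pi / 4))"
      by (simp_all only: cos_of_real sin_of_real)
    thus ?thesis by (simp only: of_real_mult of_real_divide of_real_power)
  qed
  moreover have "pi ^ 3 * cos (pi / 4) / sin (pi / 4) ^ 3 = 2 * pi ^ 3"
    by (simp add: cos_45 sin_45 power3_eq_cube field_simps)
  ultimately show ?thesis using r by (simp only: Re_complex_of_real) simp
qed

text \<open>The index \<open>int_decode k\<close> runs through \<open>0, -1, 1, -2, 2, \<dots>\<close>, so that \<open>4 * int_decode k + 1\<close> is
  \<open>2 * k + 1\<close> up to the sign \<open>(- 1) ^ k\<close>.\<close>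

lemma has_sum_odd_reindex:
  fixes g :: "real \<Rightarrow> real"
  assumes "((\<lambda>k::int. g (4 * of_int k + 1)) has_sum s) UNIV" "\<And>a. g (- a) = - g a"
  shows "((\<lambda>k::nat. (- 1) ^ k * g (2 * real k + 1)) has_sum s) UNIV"
proof -
  have "((\<lambda>k. g (4 * of_int (int_decode k) + 1)) has_sum s) UNIV"
    using assms(1) has_sum_reindex_bij_betw[OF bij_int_decode, of "\<lambda>k. g (4 * of_int k + 1)" s] by simp
  moreover have "g (4 * of_int (int_decode k) + 1) = (- 1) ^ k * g (2 * real k + 1)" for k
  proof (cases "even k")
    case True
    then obtain j where "k = 2 * j" by (auto elim: evenE)
    thus ?thesis by (simp add: int_decode_def sum_decode_def)
  next
    case False
    then obtain j where j: "k = 2 * j + 1" by (auto elim: oddE)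
    hence "4 * of_int (int_decode k) + 1 = - (2 * real k + 1)" by (simp add: int_decode_def sum_decode_def)
    thus ?thesis using False assms(2)[of "2 * real k + 1"] by (simp only: power_minus_odd) simp
  qed
  ultimately show ?thesis by simp
qed

lemma has_sum_row_odd:
  fixes y :: real
  assumes y: "y > 0"
  shows "((\<lambda>k::nat. (- 1) ^ k * (2 * real k + 1) / ((2 * real k + 1)\<^sup>2 + y\<^sup>2)\<^sup>2) has_sum
    (pi\<^sup>2 / (8 * y) * Im (li1 (\<i> * exp (- pi * y / 2))))) UNIV"
proof -
  have "exp (2 * complex_of_real pi * \<i> / of_nat 4) = \<i>"
    using exp_half_pi_i by (simp add: field_simps)
  moreover have "exp (- 2 * pi * y / real 4) = exp (- pi * y / 2)" by simp
  ultimately have "((\<lambda>k::int. (4 * of_int k + 1) / ((4 * of_int k + 1)\<^sup>2 + y\<^sup>2)\<^sup>2) has_sum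
     (pi\<^sup>2 / (8 * y) * Im (li1 (\<i> * exp (- pi * y / 2))))) UNIV"
    using has_sum_row[of 4 y] y by simp
  from has_sum_odd_reindex[of "\<lambda>a. a / (a\<^sup>2 + y\<^sup>2)\<^sup>2", OF this] show ?thesis by simp
qed

lemma has_sum_odd_cubes: "((\<lambda>k::nat. (- 1) ^ k * (1 / (2 * real k + 1) ^ 3)) has_sum pi ^ 3 / 32) UNIV"
  by (rule has_sum_odd_reindex[of "\<lambda>a. 1 / a ^ 3", OF has_sum_cubes_mod_4]) (simp add: power_minus_odd)

section \<open>Double series\<close>

lemma summable_on_nat_powr: "(\<lambda>k::nat. (real k + 1) powr (- (3 / 2))) summable_on UNIV"
proof -
  have "summable (\<lambda>k. real (Suc k) powr (- (3 / 2)))"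
    using iffD2[OF summable_real_powr_iff[of "- (3 / 2)"]] summable_Suc_iff[of "\<lambda>k. real k powr (- (3 / 2))"] by simp
  hence "summable (\<lambda>k. norm ((real k + 1) powr (- (3 / 2))))" by (simp add: add.commute)
  thus ?thesis by (rule norm_summable_imp_summable_on)
qed

lemma summable_on_int_powr: "(\<lambda>n::int. (\<bar>of_int n\<bar> + 1 :: real) powr (- (3 / 2))) summable_on UNIV"
proof -
  have 1: "(\<lambda>k. (real k + 1) powr (- (3 / 2))) summable_on UNIV" by (rule summable_on_nat_powr)
  hence "(\<lambda>k. (real k + 1) powr (- (3 / 2))) summable_on range Suc"
    by (rule summable_on_subset_banach) auto
  hence 2: "(\<lambda>k. (real (Suc k) + 1) powr (- (3 / 2))) summable_on UNIV"
    by (subst (asm) summable_on_reindex) (simp_all add: o_def)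
  have eq: "\<bar>real_of_int (int k)\<bar> = real k" "\<bar>real_of_int (- int (Suc k))\<bar> = real (Suc k)" for k by simp_all
  show ?thesis
    by (rule has_sum_imp_summable, rule has_sum_int_split, unfold eq)
       (rule has_sum_infsum[OF 1] has_sum_infsum[OF 2])+
qed

text \<open>The majorant comes from \<open>a powr (5 / 2) * b powr (3 / 2) \<le> (a\<^sup>2 + b\<^sup>2)\<^sup>2\<close>.\<close>

lemma summable_on_lattice:
  fixes A :: "'k \<Rightarrow> real" and B :: "'n \<Rightarrow> real" and f :: "'n \<Rightarrow> 'k \<Rightarrow> real"
  assumes B: "(\<lambda>n. B n powr (- (3 / 2))) summable_on X" "\<And>n. B n > 0"
    and A: "(\<lambda>k. A k powr (- (3 / 2))) summable_on Y" "\<And>k. A k > 0"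
    and D: "m > 0" "\<And>n k. m * ((A k)\<^sup>2 + (B n)\<^sup>2) \<le> D n k"
    and f: "\<And>n k. \<bar>f n k\<bar> \<le> C * A k / (D n k)\<^sup>2" and C: "C > 0"
  shows "(\<lambda>(n, k). f n k) summable_on (X \<times> Y)"
proof -
  have bound: "\<bar>f n k\<bar> \<le> C / m\<^sup>2 * (B n powr (- (3 / 2)) * A k powr (- (3 / 2)))" for n k
  proof -
    define a b where "a = A k" and "b = B n"
    have ab: "a > 0" "b > 0" using A B by (simp_all add: a_def b_def)
    define M where "M = max a b"
    have M: "a \<le> M" "b \<le> M" "M > 0" using ab by (auto simp: M_def)
    have "a * (a powr (3 / 2) * b powr (3 / 2)) \<le> M * (M powr (3 / 2) * M powr (3 / 2))"
      using M ab by (intro mult_mono powr_mono2) auto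
    also have "M powr (3 / 2) * M powr (3 / 2) = M ^ 3"
      using M by (simp add: powr_realpow flip: powr_add)
    also have "M * M ^ 3 = (M\<^sup>2)\<^sup>2" by (simp add: eval_nat_numeral)
    also have "(M\<^sup>2)\<^sup>2 \<le> (a\<^sup>2 + b\<^sup>2)\<^sup>2"
      by (intro power_mono) (auto simp: M_def max_def)
    finally have "a * (a powr (3 / 2) * b powr (3 / 2)) \<le> (a\<^sup>2 + b\<^sup>2)\<^sup>2" .
    hence *: "a / (a\<^sup>2 + b\<^sup>2)\<^sup>2 \<le> b powr (- (3 / 2)) * a powr (- (3 / 2))"
      using ab by (simp add: powr_minus field_simps sum_power2_gt_zero_iff)
    have "0 < a\<^sup>2 + b\<^sup>2" using ab by (simp add: sum_power2_gt_zero_iff)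
    hence p: "0 < m * (a\<^sup>2 + b\<^sup>2)" using D(1) by simp
    have "\<bar>f n k\<bar> \<le> C * a / (D n k)\<^sup>2" using f by (simp add: a_def)
    also have "\<dots> \<le> C * a / (m * (a\<^sup>2 + b\<^sup>2))\<^sup>2"
    proof (intro divide_left_mono power_mono mult_pos_pos)
      show "m * (a\<^sup>2 + b\<^sup>2) \<le> D n k" using D(2)[of k n] by (simp add: a_def b_def)
      with p show "0 < (D n k)\<^sup>2" "0 < (m * (a\<^sup>2 + b\<^sup>2))\<^sup>2" "0 \<le> m * (a\<^sup>2 + b\<^sup>2)" by auto
      show "0 \<le> C * a" using ab C by simp
    qed
    also have "\<dots> = C / m\<^sup>2 * (a / (a\<^sup>2 + b\<^sup>2)\<^sup>2)" by (simp add: power_mult_distrib)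
    also have "\<dots> \<le> C / m\<^sup>2 * (b powr (- (3 / 2)) * a powr (- (3 / 2)))"
      using * C by (intro mult_left_mono) auto
    finally show ?thesis by (simp add: a_def b_def)
  qed
  have "(\<lambda>(n, k). B n powr (- (3 / 2)) * A k powr (- (3 / 2))) summable_on (X \<times> Y)"
    by (rule summable_on_product_real[OF B(1) A(1)]) auto
  hence "(\<lambda>p. C / m\<^sup>2 * (case p of (n, k) \<Rightarrow> B n powr (- (3 / 2)) * A k powr (- (3 / 2)))) summable_on (X \<times> Y)"
    by (rule summable_on_cmult_right)
  hence "(\<lambda>p. norm (case p of (n, k) \<Rightarrow> f n k)) summable_on (X \<times> Y)"
    by (rule Infinite_Sum.abs_summable_on_comparison_test') (use bound in auto)
  thus ?thesis by (rule abs_summable_summable)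
qed

lemma infsum_rows:
  fixes f :: "'n \<Rightarrow> 'k \<Rightarrow> real"
  assumes "(\<lambda>(n, k). f n k) summable_on (X \<times> Y)" "\<And>n. n \<in> X \<Longrightarrow> (f n has_sum r n) Y"
  shows "(r has_sum (\<Sum>\<^sub>\<infinity>(n, k)\<in>X \<times> Y. f n k)) X"
proof (rule has_sum_SigmaD)
  show "((\<lambda>(n, k). f n k) has_sum (\<Sum>\<^sub>\<infinity>(n, k)\<in>X \<times> Y. f n k)) (X \<times> Y)"
    using assms(1) by simp
qed (use assms(2) in auto)

lemma square_le_linear_square:
  fixes n :: int
  assumes "a \<ge> 3"
  shows "(\<bar>of_int n\<bar> + 1)\<^sup>2 / 4 \<le> (of_int a * of_int n + 1 :: real)\<^sup>2"
proof -
  have "\<bar>n\<bar> + 1 \<le> 2 * \<bar>a * n + 1\<bar>"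
  proof (cases "n = 0")
    case False
    have "3 * \<bar>n\<bar> \<le> \<bar>a * n\<bar>" using assms unfolding abs_mult by (intro mult_right_mono) auto
    moreover have "\<bar>a * n\<bar> \<le> \<bar>a * n + 1\<bar> + 1"
      using abs_triangle_ineq4[of "a * n + 1" 1] by simp
    moreover have "1 \<le> \<bar>n\<bar>" using False by simp
    moreover have "N + 1 \<le> 2 * B" if "3 * N \<le> A" "A \<le> B + 1" "1 \<le> N" for A B N :: int
      using that by linarith
    ultimately show ?thesis by blast
  qed auto
  hence "real_of_int (\<bar>n\<bar> + 1) \<le> real_of_int (2 * \<bar>a * n + 1\<bar>)" by (simp only: of_int_le_iff)
  hence "\<bar>of_int n\<bar> + 1 \<le> 2 * \<bar>of_int a * of_int n + 1 :: real\<bar>" by simp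
  hence "(\<bar>of_int n\<bar> + 1)\<^sup>2 \<le> (2 * \<bar>of_int a * of_int n + 1 :: real\<bar>)\<^sup>2" by (intro power_mono) auto
  thus ?thesis by (simp add: power_mult_distrib)
qed

text \<open>The real even character modulo 12. Its value at |6n + 1| is (-1)^n, the sign occurring
  in the lattice sums.\<close>

definition chi12 :: "nat \<Rightarrow> real" where "chi12 j = Re (chi3 j * chi4 j)"

lemma chi12_code: "chi12 j = (if j mod 12 = 1 \<or> j mod 12 = 11 then 1 else if j mod 12 = 5 \<or> j mod 12 = 7 then - 1 else 0)"
proof -
  define r where "r = j mod 12"
  have "j mod 3 = r mod 3" "j mod 4 = r mod 4" by (simp_all add: r_def mod_mod_cancel)
  hence e: "chi3 j = chi3 r" "chi4 j = chi4 r" by (simp_all add: chi3_def chi4_def)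
  have "r < 12" by (simp add: r_def)
  hence "r \<in> {0, 1, 2, 3, 4, 5, 6, 7, 8, 9, 10, 11}" by simp presburger
  moreover have "\<forall>r\<in>{0, 1, 2, 3, 4, 5, 6, 7, 8, 9, 10, 11}. Re (chi3 r * chi4 r) =
      (if r = 1 \<or> r = 11 then 1 else if r = 5 \<or> r = 7 then - 1 else 0)"
    by (simp add: chi3_def chi4_def)
  ultimately show ?thesis unfolding chi12_def e r_def[symmetric] by blast
qed

text \<open>n -> |6n + 1| is a bijection from the integers onto the positive integers prime to 6,
  and \<open>chi12\<close> vanishes at all others.\<close>

lemma sums_6n1:
  fixes g :: "nat \<Rightarrow> real"
  assumes "((\<lambda>n::int. (- 1) powi n * g (nat \<bar>6 * n + 1\<bar>)) has_sum s) UNIV"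
  shows "(\<lambda>k. chi12 (Suc k) * g (Suc k)) sums s"
proof -
  define J where "J = {j::nat. j mod 6 = 1 \<or> j mod 6 = 5}"
  \<comment> \<open>The inverse bijection. Residue 5 belongs to negative n, where |6n + 1| = 6 (- n
    - 1) + 5.\<close>
  define h where "h = (\<lambda>j. if j mod 6 = 1 then int (j div 6) else - int (j div 6) - 1)"
  have ij: "int j = 6 * int (j div 6) + int (j mod 6)" for j
    using mult_div_mod_eq[of 6 j] by linarith
  have hj: "nat \<bar>6 * h j + 1\<bar> = j" if "j \<in> J" for j
    using that ij[of j] unfolding h_def J_def by (auto simp: abs_if nat_eq_iff)
  have bij: "bij_betw h J UNIV"
  proof (rule bij_betwI[where g = "\<lambda>n. nat \<bar>6 * n + 1\<bar>"])
    show "nat \<bar>6 * h j + 1\<bar> = j" if "j \<in> J" for j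
      by (rule hj[OF that])
    show "(\<lambda>n. nat \<bar>6 * n + 1\<bar>) \<in> UNIV \<rightarrow> J"
    proof
      fix n :: int
      show "nat \<bar>6 * n + 1\<bar> \<in> J"
      proof (cases n rule: int_cases)
        case (nonneg k)
        have "nat \<bar>6 * int k + 1\<bar> = 6 * k + 1" by simp
        moreover have "(6 * k + 1) mod 6 = 1" by presburger
        ultimately show ?thesis by (simp add: J_def nonneg)
      next
        case (neg k)
        have "6 * - int (Suc k) + 1 = - int (6 * k + 5)" by simp
        hence e1: "nat \<bar>6 * - int (Suc k) + 1\<bar> = 6 * k + 5" by (simp only: abs_minus_cancel abs_of_nat nat_int)
        have "(6 * k + 5) mod 6 = 5" by presburger
        thus ?thesis unfolding neg e1 J_def by blast
      qed
    qed
    show "h (nat \<bar>6 * n + 1\<bar>) = n" for n :: int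
    proof (cases n rule: int_cases)
      case (nonneg k)
      have "nat \<bar>6 * int k + 1\<bar> = 6 * k + 1" by simp
      moreover have "(6 * k + 1) mod 6 = 1" "(6 * k + 1) div 6 = k" by presburger+
      ultimately show ?thesis by (simp add: h_def nonneg)
    next
      case (neg k)
      have "6 * - int (Suc k) + 1 = - int (6 * k + 5)" by simp
      hence e1: "nat \<bar>6 * - int (Suc k) + 1\<bar> = 6 * k + 5" by (simp only: abs_minus_cancel abs_of_nat nat_int)
      have "(6 * k + 5) mod 6 = 5" "(6 * k + 5) div 6 = k" by presburger+
      thus ?thesis unfolding neg e1 h_def by simp
    qed
  qed auto
  have "((\<lambda>j. (- 1) powi (h j) * g (nat \<bar>6 * h j + 1\<bar>)) has_sum s) J"
    using has_sum_reindex_bij_betw[OF bij, of "\<lambda>n. (- 1) powi n * g (nat \<bar>6 * n + 1\<bar>)" s] assms by simp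
  also have "?this \<longleftrightarrow> ((\<lambda>j. chi12 j * g j) has_sum s) J"
  proof (rule has_sum_cong)
    fix j assume j: "j \<in> J"
    note hj[OF j]
    moreover have "(- 1) powi (h j) = chi12 j"
    proof -
      have e: "(- 1 :: real) powi n = (if even n then 1 else - 1)" for n :: int
        by (simp add: power_int_minus_left)
      consider m where "j = 12 * m + 1" | m where "j = 12 * m + 5" | m where "j = 12 * m + 7" | m where "j = 12 * m + 11"
      proof -
        have "j = 12 * (j div 12) + j mod 12" by simp
        moreover have "j mod 12 = 1 \<or> j mod 12 = 5 \<or> j mod 12 = 7 \<or> j mod 12 = 11" proof -
          have "j mod 6 = 1 \<or> j mod 6 = 5" using j by (simp add: J_def)
          thus ?thesis by presburger
        qed
        ultimately show ?thesis using that by metis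
      qed
      thus ?thesis
      proof cases
        case (1 m)
        hence "j mod 6 = 1" "j div 6 = 2 * m" "j mod 12 = 1" by presburger+
        thus ?thesis by (simp add: e h_def chi12_code)
      next
        case (2 m)
        hence "j mod 6 = 5" "j div 6 = 2 * m" "j mod 12 = 5" by presburger+
        thus ?thesis by (simp add: e h_def chi12_code)
      next
        case (3 m)
        hence "j mod 6 = 1" "j div 6 = 2 * m + 1" "j mod 12 = 7" by presburger+
        thus ?thesis by (simp add: e h_def chi12_code)
      next
        case (4 m)
        hence "j mod 6 = 5" "j div 6 = 2 * m + 1" "j mod 12 = 11" by presburger+
        thus ?thesis by (simp add: e h_def chi12_code)
      qed
    qed
    ultimately show "(- 1) powi (h j) * g (nat \<bar>6 * h j + 1\<bar>) = chi12 j * g j" by simp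
  qed
  also have "\<dots> \<longleftrightarrow> ((\<lambda>j. chi12 j * g j) has_sum s) UNIV"
  proof (rule has_sum_cong_neutral)
    fix j assume "j \<in> UNIV - J"
    hence "j mod 6 \<noteq> 1" "j mod 6 \<noteq> 5" by (auto simp: J_def)
    moreover have "j mod 6 = j mod 12 mod 6" by (simp add: mod_mod_cancel)
    ultimately show "chi12 j * g j = 0" by (auto simp: chi12_code)
  qed auto
  finally have "(\<lambda>j. chi12 j * g j) sums s" by (rule has_sum_imp_sums)
  moreover have "chi12 0 = 0" by (simp add: chi12_code)
  ultimately show ?thesis by (subst sums_Suc_iff) simp
qed

section \<open>Real and imaginary parts of Lambert series at roots of unity times q\<close>

lemma li1_cnj: "li1 (cnj v) = cnj (li1 v)"
  by (simp add: li1_def)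

lemma li1_of_real: "Im (li1 (of_real r)) = 0"
proof -
  have "li1 (of_real r) = of_real (r / (1 - r)\<^sup>2)" by (simp add: li1_def)
  thus ?thesis by (simp only: Im_complex_of_real)
qed

lemma odd_li1_of_real: "odd_li1 (of_real r) = of_real (Im (li1 (\<i> * of_real r)))"
proof -
  have "- (\<i> * of_real r) = cnj (\<i> * of_real r)" by simp
  hence "odd_li1 (of_real r) = (li1 (\<i> * of_real r) - cnj (li1 (\<i> * of_real r))) / (2 * \<i>)"
    unfolding odd_li1_def by (simp only: li1_cnj)
  thus ?thesis by (simp add: complex_eq_iff)
qed

lemma lambert_sums:
  assumes "K holomorphic_on ball 0 1" "K 0 = 0" "\<And>j. norm (c j) \<le> C" "norm u < 1"
  shows "(\<lambda>k. c (Suc k) / of_nat (Suc k) * K (u ^ Suc k)) sums lambert c K u"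
  unfolding lambert_def by (intro summable_sums lambert_deriv(1)[OF assms])

lemma chi_bound: "norm (chi3 j) \<le> 1" "norm (chi4 j) \<le> 1" "norm (2 * chi8 j) \<le> 2"
  by (simp_all add: chi3_def chi4_def chi8_def)

text \<open>As \<open>\<rho> ^ 2\<close> is the conjugate of \<open>\<rho>\<close>, replacing
  \<rho>^j by \<rho> in the argument of \<open>li1\<close> costs exactly the factor chi3(j) in the
  imaginary part. Together with \<open>chi4\<close> this makes \<open>chi12\<close>.\<close>

lemma Im_lambert_chi4:
  assumes q: "0 < q" "q < 1" and \<rho>: "\<rho> = exp (2 * complex_of_real pi * \<i> / 3)"
  shows "(\<lambda>k. chi12 (Suc k) * (Im (li1 (\<rho> * of_real (q ^ Suc k))) / real (Suc k))) sums Im (lambert chi4 li1 (\<rho> * of_real q))"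
proof -
  have r3: "\<rho> ^ 3 = 1"
  proof -
    have "of_nat 3 * (2 * complex_of_real pi * \<i> / 3) = 2 * complex_of_real pi * \<i>" by simp
    thus ?thesis unfolding \<rho> using exp_of_nat_mult[of 3 "2 * complex_of_real pi * \<i> / 3"] exp_two_pi_i by metis
  qed
  have n1: "norm \<rho> = 1" unfolding \<rho> by simp
  hence cnj: "cnj \<rho> = \<rho> ^ 2"
  proof -
    have "\<rho> * cnj \<rho> = 1" using n1 by (simp add: complex_norm_square[symmetric])
    hence "\<rho> ^ 3 * cnj \<rho> = \<rho> ^ 2" by (simp add: power3_eq_cube power2_eq_square mult.assoc)
    thus ?thesis using r3 by simp
  qed
  have nu: "norm (\<rho> * of_real q) < 1" using q n1 by (simp add: norm_mult)
  have "Im (chi4 j / of_nat j * li1 ((\<rho> * of_real q) ^ j)) = chi12 j * (Im (li1 (\<rho> * of_real (q ^ j))) / real j)" for j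
  proof -
    have c4: "chi4 j = of_real (Re (chi4 j))" by (simp add: chi4_def)
    have "Im (chi4 j / of_nat j * li1 ((\<rho> * of_real q) ^ j)) = Re (chi4 j) / real j * Im (li1 ((\<rho> * of_real q) ^ j))"
    proof -
      have "chi4 j / of_nat j = of_real (Re (chi4 j) / real j)" by (subst c4) simp
      thus ?thesis by (simp only: Im_mult_of_real)
    qed
    also have "Im (li1 ((\<rho> * of_real q) ^ j)) = Re (chi3 j) * Im (li1 (\<rho> * of_real (q ^ j)))"
    proof -
      have "\<rho> ^ j = \<rho> ^ (3 * (j div 3) + j mod 3)" by simp
      also have "\<dots> = \<rho> ^ (j mod 3)" unfolding power_add power_mult r3 by simp
      finally have p: "(\<rho> * of_real q) ^ j = \<rho> ^ (j mod 3) * of_real (q ^ j)" by (simp add: power_mult_distrib)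
      consider "j mod 3 = 0" | "j mod 3 = 1" | "j mod 3 = 2" by linarith
      thus ?thesis
      proof cases
        case 1
        thus ?thesis unfolding p using li1_of_real[of "q ^ j"] by (simp add: chi3_def)
      next
        case 2
        thus ?thesis unfolding p by (simp add: chi3_def)
      next
        case 3
        hence "(\<rho> * of_real q) ^ j = cnj (\<rho> * of_real (q ^ j))" unfolding p using cnj by simp
        thus ?thesis using 3 by (simp only: li1_cnj) (simp add: chi3_def)
      qed
    qed
    also have "Re (chi4 j) / real j * (Re (chi3 j) * Im (li1 (\<rho> * of_real (q ^ j)))) = chi12 j * (Im (li1 (\<rho> * of_real (q ^ j))) / real j)"
      by (simp add: chi12_def chi3_def chi4_def)
    finally show ?thesis .
  qed
  with sums_Im[OF lambert_sums[of li1 chi4 1, OF li1_disc(1) li_0(2) chi_bound(2) nu]] show ?thesis by (simp only:)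
qed

text \<open>The same mechanism with the powers of \<i>: even ones give real values, and \<i>^3 is
  the conjugate of \<i>, so the factor is chi4(j).\<close>

lemma Im_lambert_chi3:
  assumes q: "0 < q" "q < 1"
  shows "(\<lambda>k. chi12 (Suc k) * (Im (li1 (\<i> * of_real (q ^ Suc k))) / real (Suc k))) sums Im (lambert chi3 li1 (\<i> * of_real q))"
proof -
  have nu: "norm (\<i> * of_real q) < 1" using q by (simp add: norm_mult)
  have "Im (chi3 j / of_nat j * li1 ((\<i> * of_real q) ^ j)) = chi12 j * (Im (li1 (\<i> * of_real (q ^ j))) / real j)" for j
  proof -
    have c3: "chi3 j = of_real (Re (chi3 j))" by (simp add: chi3_def)
    have "Im (chi3 j / of_nat j * li1 ((\<i> * of_real q) ^ j)) = Re (chi3 j) / real j * Im (li1 ((\<i> * of_real q) ^ j))"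
    proof -
      have "chi3 j / of_nat j = of_real (Re (chi3 j) / real j)" by (subst c3) simp
      thus ?thesis by (simp only: Im_mult_of_real)
    qed
    also have "Im (li1 ((\<i> * of_real q) ^ j)) = Re (chi4 j) * Im (li1 (\<i> * of_real (q ^ j)))"
    proof -
      have i4: "\<i> ^ 4 = 1" by (simp add: eval_nat_numeral)
      have "\<i> ^ j = \<i> ^ (4 * (j div 4) + j mod 4)" by simp
      also have "\<dots> = \<i> ^ (j mod 4)" unfolding power_add power_mult i4 by simp
      finally have p: "(\<i> * of_real q) ^ j = \<i> ^ (j mod 4) * of_real (q ^ j)" by (simp add: power_mult_distrib)
      consider "j mod 4 = 0" | "j mod 4 = 1" | "j mod 4 = 2" | "j mod 4 = 3" by linarith
      thus ?thesis
      proof cases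
        case 1
        thus ?thesis unfolding p using li1_of_real[of "q ^ j"] by (simp add: chi4_def)
      next
        case 2
        thus ?thesis unfolding p by (simp add: chi4_def)
      next
        case 3
        thus ?thesis unfolding p using li1_of_real[of "- (q ^ j)"] by (simp add: chi4_def)
      next
        case 4
        hence "(\<i> * of_real q) ^ j = cnj (\<i> * of_real (q ^ j))" unfolding p by (simp add: power3_eq_cube)
        thus ?thesis using 4 by (simp only: li1_cnj) (simp add: chi4_def)
      qed
    qed
    also have "Re (chi3 j) / real j * (Re (chi4 j) * Im (li1 (\<i> * of_real (q ^ j)))) = chi12 j * (Im (li1 (\<i> * of_real (q ^ j))) / real j)"
      by (simp add: chi12_def chi3_def chi4_def)
    finally show ?thesis .
  qed
  with sums_Im[OF lambert_sums[of li1 chi3 1, OF li1_disc(1) li_0(2) chi_bound(1) nu]] show ?thesis by (simp only:)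
qed

section \<open>The double series as Lambert series\<close>

lemma abs_minus_one_powi: "\<bar>(- 1 :: real) powi n\<bar> = 1"
  by (simp add: power_int_minus_left)

lemma six_int_ne_0: "(6 * of_int n + 1 :: real) \<noteq> 0"
proof
  assume "(6 * of_int n + 1 :: real) = 0"
  hence "of_int (6 * n + 1) = (of_int 0 :: real)" by simp
  hence "6 * n + 1 = 0" by (simp only: of_int_eq_iff)
  thus False by presburger
qed

lemma real_nat_abs: "real (nat \<bar>6 * n + 1\<bar>) = \<bar>6 * of_int n + 1\<bar>"
  by simp

lemma exp_power_nat: "exp (c * real j) = exp (c :: real) ^ j"
  by (metis exp_of_nat_mult mult.commute)

text \<open>The sum over \<open>k\<close> is taken first: with y = x |6n + 1| / 2 the denominator is
  16 ((3k + 1)^2 + y^2)^2, a row for N = 3.\<close>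

lemma lattice_14:
  fixes x :: real
  assumes x: "x > 0"
  defines "q \<equiv> exp (- pi * x / 3)" and "\<rho> \<equiv> exp (2 * complex_of_real pi * \<i> / 3)"
  shows "F14 x = 25 * pi\<^sup>2 / (36 * x) * Im (lambert chi4 li1 (\<rho> * of_real q))"
proof -
  define f where "f = (\<lambda>n k :: int. (- 1) powi n * (3 * of_int k + 1) / (4 * (3 * of_int k + 1)\<^sup>2 + x\<^sup>2 * (6 * of_int n + 1)\<^sup>2)\<^sup>2 :: real)"
  define g where "g = (\<lambda>j. pi\<^sup>2 / (36 * x) * (Im (li1 (\<rho> * of_real (q ^ j))) / real j))"
  have q: "0 < q" "q < 1" using x by (simp_all add: q_def)
  have sm: "(\<lambda>(n, k). f n k) summable_on (UNIV \<times> UNIV)"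
  proof (rule summable_on_lattice[OF summable_on_int_powr _ summable_on_int_powr])
    show "min 1 (x\<^sup>2 / 4) > 0" using x by simp
    show "min 1 (x\<^sup>2 / 4) * ((\<bar>of_int k\<bar> + 1)\<^sup>2 + (\<bar>of_int n\<bar> + 1)\<^sup>2) \<le> 4 * (3 * of_int k + 1)\<^sup>2 + x\<^sup>2 * (6 * of_int n + 1)\<^sup>2" for n k :: int
    proof -
      have "min 1 (x\<^sup>2 / 4) * (\<bar>of_int k\<bar> + 1)\<^sup>2 \<le> 1 * (\<bar>of_int k\<bar> + 1)\<^sup>2" by (intro mult_right_mono) auto
      also have "\<dots> \<le> 4 * (3 * of_int k + 1)\<^sup>2" using square_le_linear_square[of 3 k] by simp
      finally have 1: "min 1 (x\<^sup>2 / 4) * (\<bar>of_int k\<bar> + 1)\<^sup>2 \<le> 4 * (3 * of_int k + 1)\<^sup>2" .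
      have "min 1 (x\<^sup>2 / 4) * (\<bar>of_int n\<bar> + 1)\<^sup>2 \<le> x\<^sup>2 / 4 * (\<bar>of_int n\<bar> + 1)\<^sup>2" by (intro mult_right_mono) auto
      also have "\<dots> = x\<^sup>2 * ((\<bar>of_int n\<bar> + 1)\<^sup>2 / 4)" by simp
      also have "\<dots> \<le> x\<^sup>2 * (6 * of_int n + 1)\<^sup>2" using square_le_linear_square[of 6 n] by (intro mult_left_mono) auto
      finally have "min 1 (x\<^sup>2 / 4) * (\<bar>of_int n\<bar> + 1)\<^sup>2 \<le> x\<^sup>2 * (6 * of_int n + 1)\<^sup>2" .
      with 1 show ?thesis by (simp add: distrib_left)
    qed
    show "\<bar>f n k\<bar> \<le> 3 * (\<bar>of_int k\<bar> + 1) / (4 * (3 * of_int k + 1)\<^sup>2 + x\<^sup>2 * (6 * of_int n + 1)\<^sup>2)\<^sup>2" for n k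
    proof -
      have "\<bar>3 * of_int k + 1 :: real\<bar> \<le> 3 * (\<bar>of_int k\<bar> + 1)"
        using abs_triangle_ineq[of "3 * of_int k :: real" 1] unfolding abs_mult by simp
      thus ?thesis unfolding f_def abs_divide abs_mult abs_minus_one_powi by (auto intro!: divide_right_mono)
    qed
  qed auto
  have row: "(f n has_sum (- 1) powi n * g (nat \<bar>6 * n + 1\<bar>)) UNIV" for n
  proof -
    define j where "j = nat \<bar>6 * n + 1\<bar>"
    define y where "y = x * real j / 2"
    have j: "real j = \<bar>6 * of_int n + 1\<bar>" "real j > 0" using six_int_ne_0[of n] by (simp_all only: j_def real_nat_abs zero_less_abs_iff not_False_eq_True)
    hence y: "y > 0" using x by (simp add: y_def)
    have e: "exp (- 2 * pi * y / 3) = q ^ j"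
      unfolding q_def exp_power_nat[symmetric] by (rule arg_cong[of _ _ exp]) (simp add: y_def field_simps)
    have "((\<lambda>k. (- 1) powi n / 16 * ((3 * of_int k + 1) / ((3 * of_int k + 1)\<^sup>2 + y\<^sup>2)\<^sup>2)) has_sum
       (- 1) powi n / 16 * (2 * pi\<^sup>2 / (3\<^sup>2 * y) * Im (li1 (\<rho> * of_real (q ^ j))))) UNIV"
      using has_sum_row[of 3 y] y unfolding \<rho>_def e[symmetric] by (intro has_sum_cmult_right) simp
    moreover have "(- 1) powi n / 16 * ((3 * of_int k + 1) / ((3 * of_int k + 1)\<^sup>2 + y\<^sup>2)\<^sup>2) = f n k" for k
    proof -
      have "4 * y\<^sup>2 = x\<^sup>2 * (real j)\<^sup>2" by (simp add: y_def power_mult_distrib power_divide)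
      hence eq: "4 * (3 * of_int k + 1)\<^sup>2 + x\<^sup>2 * (6 * of_int n + 1)\<^sup>2 = 4 * ((3 * of_int k + 1)\<^sup>2 + y\<^sup>2)"
        by (simp add: j distrib_left)
      show ?thesis unfolding f_def eq by (simp add: power_mult_distrib del: distrib_left_numeral)
    qed
    moreover have "(- 1) powi n / 16 * (2 * pi\<^sup>2 / (3\<^sup>2 * y) * Im (li1 (\<rho> * of_real (q ^ j)))) = (- 1) powi n * g j"
      using x j by (simp add: g_def y_def)
    ultimately show ?thesis by (simp add: j_def)
  qed
  define S where "S = (\<Sum>\<^sub>\<infinity>(n, k)\<in>UNIV \<times> UNIV. f n k)"
  have "((\<lambda>n. (- 1) powi n * g (nat \<bar>6 * n + 1\<bar>)) has_sum S) UNIV"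
    unfolding S_def by (rule infsum_rows[OF sm row])
  hence "(\<lambda>k. chi12 (Suc k) * g (Suc k)) sums S" by (rule sums_6n1)
  moreover have "(\<lambda>k. chi12 (Suc k) * g (Suc k)) sums (pi\<^sup>2 / (36 * x) * Im (lambert chi4 li1 (\<rho> * of_real q)))"
    using sums_mult[OF Im_lambert_chi4[OF q \<rho>_def[THEN meta_eq_to_obj_eq]], of "pi\<^sup>2 / (36 * x)"]
    unfolding g_def by (simp only: mult.left_commute)
  ultimately have "S = pi\<^sup>2 / (36 * x) * Im (lambert chi4 li1 (\<rho> * of_real q))" by (rule sums_unique2)
  moreover have "F14 x = 25 * S" by (simp add: F14_def S_def f_def)
  ultimately show ?thesis by simp
qed

text \<open>The double series to which \<open>lattice_F\<close> reduces: 3 (2k + 1)^2 and the factor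
  2k + 1 are what Jacobi's identity makes of the three variables with coefficient 1.\<close>

lemma lattice_13:
  fixes x :: real
  assumes x: "x > 0"
  defines "q \<equiv> exp (- pi * x / sqrt 12)"
  defines "f \<equiv> (\<lambda>n k. (- 1) powi n * ((- 1) ^ k * (2 * real k + 1)) / (3 * (2 * real k + 1)\<^sup>2 + x\<^sup>2 * (6 * of_int n + 1)\<^sup>2)\<^sup>2)"
  shows "(\<lambda>(n, k). f n k) summable_on (UNIV \<times> UNIV)"
    and "(\<Sum>\<^sub>\<infinity>(n, k)\<in>UNIV \<times> UNIV. f n k) = pi\<^sup>2 / (24 * sqrt 3 * x) * Im (lambert chi3 li1 (\<i> * of_real q))"
proof -
  define g where "g = (\<lambda>j. pi\<^sup>2 / (24 * sqrt 3 * x) * (Im (li1 (\<i> * of_real (q ^ j))) / real j))"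
  have q: "0 < q" "q < 1" using x by (simp_all add: q_def)
  have s12: "sqrt 12 = 2 * sqrt 3" using real_sqrt_mult[of 4 3] by simp
  show sm: "(\<lambda>(n, k). f n k) summable_on (UNIV \<times> UNIV)"
  proof (rule summable_on_lattice[OF summable_on_int_powr _ summable_on_nat_powr])
    show "min 3 (x\<^sup>2 / 4) > 0" using x by simp
    show "min 3 (x\<^sup>2 / 4) * ((real k + 1)\<^sup>2 + (\<bar>of_int n\<bar> + 1)\<^sup>2) \<le> 3 * (2 * real k + 1)\<^sup>2 + x\<^sup>2 * (6 * of_int n + 1)\<^sup>2" for n k
    proof -
      have 1: "min 3 (x\<^sup>2 / 4) * (real k + 1)\<^sup>2 \<le> 3 * (2 * real k + 1)\<^sup>2" by (intro mult_mono power_mono) auto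
      have "min 3 (x\<^sup>2 / 4) * (\<bar>of_int n\<bar> + 1)\<^sup>2 \<le> x\<^sup>2 / 4 * (\<bar>of_int n\<bar> + 1)\<^sup>2" by (intro mult_right_mono) auto
      also have "\<dots> = x\<^sup>2 * ((\<bar>of_int n\<bar> + 1)\<^sup>2 / 4)" by simp
      also have "\<dots> \<le> x\<^sup>2 * (6 * of_int n + 1)\<^sup>2" using square_le_linear_square[of 6 n] by (intro mult_left_mono) auto
      finally have "min 3 (x\<^sup>2 / 4) * (\<bar>of_int n\<bar> + 1)\<^sup>2 \<le> x\<^sup>2 * (6 * of_int n + 1)\<^sup>2" .
      with 1 show ?thesis by (simp add: distrib_left)
    qed
    show "\<bar>f n k\<bar> \<le> 2 * (real k + 1) / (3 * (2 * real k + 1)\<^sup>2 + x\<^sup>2 * (6 * of_int n + 1)\<^sup>2)\<^sup>2" for n k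
      unfolding f_def abs_divide abs_mult abs_minus_one_powi by (auto intro!: divide_right_mono simp: power_abs)
  qed auto
  have row: "(f n has_sum (- 1) powi n * g (nat \<bar>6 * n + 1\<bar>)) UNIV" for n
  proof -
    define j where "j = nat \<bar>6 * n + 1\<bar>"
    define y where "y = x * real j / sqrt 3"
    have j: "real j = \<bar>6 * of_int n + 1\<bar>" "real j > 0" using six_int_ne_0[of n] by (simp_all only: j_def real_nat_abs zero_less_abs_iff not_False_eq_True)
    hence y: "y > 0" using x by (simp add: y_def)
    have e: "exp (- pi * y / 2) = q ^ j"
      unfolding q_def exp_power_nat[symmetric] by (rule arg_cong[of _ _ exp]) (simp add: y_def s12 field_simps)
    have "((\<lambda>k. (- 1) powi n / 9 * ((- 1) ^ k * (2 * real k + 1) / ((2 * real k + 1)\<^sup>2 + y\<^sup>2)\<^sup>2)) has_sum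
       (- 1) powi n / 9 * (pi\<^sup>2 / (8 * y) * Im (li1 (\<i> * of_real (q ^ j))))) UNIV"
      using has_sum_row_odd[OF y] unfolding e by (intro has_sum_cmult_right) simp
    moreover have "(- 1) powi n / 9 * ((- 1) ^ k * (2 * real k + 1) / ((2 * real k + 1)\<^sup>2 + y\<^sup>2)\<^sup>2) = f n k" for k
    proof -
      have "3 * y\<^sup>2 = x\<^sup>2 * (real j)\<^sup>2" by (simp add: y_def power_mult_distrib power_divide)
      hence eq: "3 * (2 * real k + 1)\<^sup>2 + x\<^sup>2 * (6 * of_int n + 1)\<^sup>2 = 3 * ((2 * real k + 1)\<^sup>2 + y\<^sup>2)"
        by (simp add: j distrib_left)
      show ?thesis unfolding f_def eq by (simp add: power_mult_distrib del: distrib_left_numeral)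
    qed
    moreover have "(- 1) powi n / 9 * (pi\<^sup>2 / (8 * y) * Im (li1 (\<i> * of_real (q ^ j)))) = (- 1) powi n * g j"
    proof -
      have "1 / 9 * (pi\<^sup>2 / (8 * y)) = pi\<^sup>2 / (24 * sqrt 3 * x) / real j"
        using x j by (simp add: y_def field_simps)
      thus ?thesis unfolding g_def by (simp add: field_simps)
    qed
    ultimately show ?thesis by (simp add: j_def)
  qed
  have "((\<lambda>n. (- 1) powi n * g (nat \<bar>6 * n + 1\<bar>)) has_sum (\<Sum>\<^sub>\<infinity>(n, k)\<in>UNIV \<times> UNIV. f n k)) UNIV"
    by (rule infsum_rows[OF sm row])
  hence "(\<lambda>k. chi12 (Suc k) * g (Suc k)) sums (\<Sum>\<^sub>\<infinity>(n, k)\<in>UNIV \<times> UNIV. f n k)" by (rule sums_6n1)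
  moreover have "(\<lambda>k. chi12 (Suc k) * g (Suc k)) sums (pi\<^sup>2 / (24 * sqrt 3 * x) * Im (lambert chi3 li1 (\<i> * of_real q)))"
    using sums_mult[OF Im_lambert_chi3[OF q], of "pi\<^sup>2 / (24 * sqrt 3 * x)"]
    unfolding g_def by (simp only: mult.left_commute)
  ultimately show "(\<Sum>\<^sub>\<infinity>(n, k)\<in>UNIV \<times> UNIV. f n k) = pi\<^sup>2 / (24 * sqrt 3 * x) * Im (lambert chi3 li1 (\<i> * of_real q))"
    by (rule sums_unique2)
qed

text \<open>n (n + 1) / 2 is even exactly when n is 0 or 3 modulo 4, that is, when 2n + 1 is 1 or 7
  modulo 8.\<close>

lemma Re_chi8_odd: "Re (chi8 (2 * n + 1)) = (- 1) ^ (n * (n + 1) div 2)"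
proof -
  define t where "t = n * (n + 1) div 2"
  have t: "2 * t = n * (n + 1)" by (simp add: t_def)
  consider m where "n = 4 * m" | m where "n = 4 * m + 1" | m where "n = 4 * m + 2" | m where "n = 4 * m + 3"
  proof -
    have "n = 4 * (n div 4) + n mod 4" by simp
    moreover have "n mod 4 = 0 \<or> n mod 4 = 1 \<or> n mod 4 = 2 \<or> n mod 4 = 3" by linarith
    ultimately show ?thesis using that by (metis add_0_right)
  qed
  hence "Re (chi8 (2 * n + 1)) = (- 1) ^ t"
  proof cases
    case (1 m)
    have "2 * t = 2 * (2 * (m * (4 * m + 1)))" unfolding t 1 by (simp add: algebra_simps)
    hence "t = 2 * (m * (4 * m + 1))" by (subst (asm) nat_mult_eq_cancel1) simp_all
    moreover have "(2 * n + 1) mod 8 = 1" unfolding 1 by presburger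
    ultimately show ?thesis by (simp add: chi8_def)
  next
    case (2 m)
    have "2 * t = 2 * (2 * (4 * m * m + 3 * m) + 1)" unfolding t 2 by (simp add: algebra_simps)
    hence "t = 2 * (4 * m * m + 3 * m) + 1" by (subst (asm) nat_mult_eq_cancel1) simp_all
    moreover have "(2 * n + 1) mod 8 = 3" unfolding 2 by presburger
    ultimately show ?thesis by (simp add: chi8_def)
  next
    case (3 m)
    have "2 * t = 2 * (2 * (4 * m * m + 5 * m + 1) + 1)" unfolding t 3 by (simp add: algebra_simps)
    hence "t = 2 * (4 * m * m + 5 * m + 1) + 1" by (subst (asm) nat_mult_eq_cancel1) simp_all
    moreover have "(2 * n + 1) mod 8 = 5" unfolding 3 by presburger
    ultimately show ?thesis by (simp add: chi8_def)
  next
    case (4 m)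
    have "2 * t = 2 * (2 * (4 * m * m + 7 * m + 3))" unfolding t 4 by (simp add: algebra_simps)
    hence "t = 2 * (4 * m * m + 7 * m + 3)" by (subst (asm) nat_mult_eq_cancel1) simp_all
    moreover have "(2 * n + 1) mod 8 = 7" unfolding 4 by presburger
    ultimately show ?thesis by (simp add: chi8_def)
  qed
  thus ?thesis by (simp add: t_def)
qed

lemma sums_odd:
  fixes g :: "nat \<Rightarrow> real"
  assumes "((\<lambda>n. (- 1) ^ (n * (n + 1) div 2) * g (2 * n + 1)) has_sum s) UNIV"
  shows "(\<lambda>k. Re (chi8 (Suc k)) * g (Suc k)) sums s"
proof -
  have "((\<lambda>j. Re (chi8 j) * g j) has_sum s) (range (\<lambda>n. 2 * n + 1))"
    by (subst has_sum_reindex) (use assms in \<open>simp_all only: inj_def o_def Re_chi8_odd, simp\<close>)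
  also have "?this \<longleftrightarrow> ((\<lambda>j. Re (chi8 j) * g j) has_sum s) UNIV"
  proof (rule has_sum_cong_neutral)
    fix j :: nat assume "j \<in> UNIV - range (\<lambda>n. 2 * n + 1)"
    hence "even j" by (metis DiffD2 oddE rangeI)
    hence "j mod 8 \<noteq> 1" "j mod 8 \<noteq> 3" "j mod 8 \<noteq> 5" "j mod 8 \<noteq> 7" by presburger+
    thus "Re (chi8 j) * g j = 0" by (simp add: chi8_def)
  qed auto
  finally have "(\<lambda>j. Re (chi8 j) * g j) sums s" by (rule has_sum_imp_sums)
  thus ?thesis by (subst sums_Suc_iff) simp
qed

text \<open>At a real argument the kernel is real; this links the complex Lambert value with the
  real row sums.\<close>

lemma lambert_odd_of_real:
  assumes c: "\<And>j. c j = of_real (r j)" "\<And>j. \<bar>r j\<bar> \<le> C" and q: "0 < q" "q < 1"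
    and s: "(\<lambda>k. r (Suc k) * (Im (li1 (\<i> * of_real (q ^ Suc k))) / real (Suc k))) sums S"
  shows "lambert c odd_li1 (of_real q) = of_real S"
proof -
  have "norm (c j) \<le> C" for j unfolding c using c(2)[of j] by simp
  moreover have "norm (of_real q :: complex) < 1" using q by simp
  ultimately have "(\<lambda>k. c (Suc k) / of_nat (Suc k) * odd_li1 (of_real q ^ Suc k)) sums lambert c odd_li1 (of_real q)"
    by (rule lambert_sums[OF odd_li1_disc(1,3)])
  also have "(\<lambda>k. c (Suc k) / of_nat (Suc k) * odd_li1 (of_real q ^ Suc k)) =
      (\<lambda>k. of_real (r (Suc k) * (Im (li1 (\<i> * of_real (q ^ Suc k))) / real (Suc k))))"
    unfolding of_real_power[symmetric] odd_li1_of_real c by (simp del: power_Suc of_real_power)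
  finally show ?thesis using sums_of_real[OF s] sums_unique2 by blast
qed

lemma lattice_22:
  fixes x :: real
  assumes x: "x > 0"
  defines "q \<equiv> exp (- pi * x / sqrt 8)"
  shows "complex_of_real (F22 x) = of_real (9 * pi\<^sup>2 / (32 * sqrt 2 * x)) * lambert (\<lambda>j. 2 * chi8 j) odd_li1 (of_real q)"
proof -
  define f where "f = (\<lambda>n k. (- 1) ^ (n * (n + 1) div 2 + k) * (2 * real k + 1) / (2 * (2 * real k + 1)\<^sup>2 + x\<^sup>2 * (2 * real n + 1)\<^sup>2)\<^sup>2)"
  define g where "g = (\<lambda>j. pi\<^sup>2 / (16 * sqrt 2 * x) * (Im (li1 (\<i> * of_real (q ^ j))) / real j))"
  have q: "0 < q" "q < 1" using x by (simp_all add: q_def)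
  have s8: "sqrt 8 = 2 * sqrt 2" using real_sqrt_mult[of 4 2] by simp
  have sm: "(\<lambda>(n, k). f n k) summable_on (UNIV \<times> UNIV)"
  proof (rule summable_on_lattice[OF summable_on_nat_powr _ summable_on_nat_powr])
    show "min 2 (x\<^sup>2) > 0" using x by simp
    show "min 2 (x\<^sup>2) * ((real k + 1)\<^sup>2 + (real n + 1)\<^sup>2) \<le> 2 * (2 * real k + 1)\<^sup>2 + x\<^sup>2 * (2 * real n + 1)\<^sup>2" for n k
    proof -
      have "min 2 (x\<^sup>2) * (real k + 1)\<^sup>2 \<le> 2 * (2 * real k + 1)\<^sup>2" by (intro mult_mono power_mono) auto
      moreover have "min 2 (x\<^sup>2) * (real n + 1)\<^sup>2 \<le> x\<^sup>2 * (2 * real n + 1)\<^sup>2" by (intro mult_mono power_mono) auto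
      ultimately show ?thesis by (simp add: distrib_left)
    qed
    show "\<bar>f n k\<bar> \<le> 2 * (real k + 1) / (2 * (2 * real k + 1)\<^sup>2 + x\<^sup>2 * (2 * real n + 1)\<^sup>2)\<^sup>2" for n k
      unfolding f_def abs_divide abs_mult by (auto intro!: divide_right_mono simp: power_abs)
  qed auto
  have row: "(f n has_sum (- 1) ^ (n * (n + 1) div 2) * g (2 * n + 1)) UNIV" for n
  proof -
    define j where "j = 2 * n + 1"
    define y where "y = x * real j / sqrt 2"
    have j: "real j = 2 * real n + 1" "real j > 0" by (simp_all add: j_def)
    hence y: "y > 0" using x by (simp add: y_def)
    have e: "exp (- pi * y / 2) = q ^ j"
      unfolding q_def exp_power_nat[symmetric] by (rule arg_cong[of _ _ exp]) (simp add: y_def s8 field_simps)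
    have "((\<lambda>k. (- 1) ^ (n * (n + 1) div 2) / 4 * ((- 1) ^ k * (2 * real k + 1) / ((2 * real k + 1)\<^sup>2 + y\<^sup>2)\<^sup>2)) has_sum
       (- 1) ^ (n * (n + 1) div 2) / 4 * (pi\<^sup>2 / (8 * y) * Im (li1 (\<i> * of_real (q ^ j))))) UNIV"
      using has_sum_row_odd[OF y] unfolding e by (intro has_sum_cmult_right) simp
    moreover have "(- 1) ^ (n * (n + 1) div 2) / 4 * ((- 1) ^ k * (2 * real k + 1) / ((2 * real k + 1)\<^sup>2 + y\<^sup>2)\<^sup>2) = f n k" for k
    proof -
      have "2 * y\<^sup>2 = x\<^sup>2 * (real j)\<^sup>2" by (simp add: y_def power_mult_distrib power_divide)
      hence eq: "2 * (2 * real k + 1)\<^sup>2 + x\<^sup>2 * (2 * real n + 1)\<^sup>2 = 2 * ((2 * real k + 1)\<^sup>2 + y\<^sup>2)"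
        by (simp add: j distrib_left)
      show ?thesis unfolding f_def eq by (simp add: power_mult_distrib power_add del: distrib_left_numeral)
    qed
    moreover have "(- 1) ^ (n * (n + 1) div 2) / 4 * (pi\<^sup>2 / (8 * y) * Im (li1 (\<i> * of_real (q ^ j)))) = (- 1) ^ (n * (n + 1) div 2) * g j"
    proof -
      have "1 / 4 * (pi\<^sup>2 / (8 * y)) = pi\<^sup>2 / (16 * sqrt 2 * x) / real j"
        using x j(2) by (simp add: y_def field_simps)
      thus ?thesis unfolding g_def by (simp add: field_simps)
    qed
    ultimately show ?thesis by (simp add: j_def)
  qed
  define S where "S = (\<Sum>\<^sub>\<infinity>(n, k)\<in>UNIV \<times> UNIV. f n k)"
  have "((\<lambda>n. (- 1) ^ (n * (n + 1) div 2) * g (2 * n + 1)) has_sum S) UNIV"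
    unfolding S_def by (rule infsum_rows[OF sm row])
  hence "(\<lambda>k. Re (chi8 (Suc k)) * g (Suc k)) sums S" by (rule sums_odd)
  from sums_mult[OF this, of "32 * sqrt 2 * x / pi\<^sup>2"]
  have "(\<lambda>k. 2 * Re (chi8 (Suc k)) * (Im (li1 (\<i> * of_real (q ^ Suc k))) / real (Suc k))) sums (32 * sqrt 2 * x / pi\<^sup>2 * S)"
  proof -
    assume *: "(\<lambda>k. 32 * sqrt 2 * x / pi\<^sup>2 * (Re (chi8 (Suc k)) * g (Suc k))) sums (32 * sqrt 2 * x / pi\<^sup>2 * S)"
    have "32 * sqrt 2 * x / pi\<^sup>2 * (r * (pi\<^sup>2 / (16 * sqrt 2 * x) * v)) = 2 * r * v" for r v
      using x by simp
    thus ?thesis using * unfolding g_def by (simp only:)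
  qed
  hence "lambert (\<lambda>j. 2 * chi8 j) odd_li1 (of_real q) = of_real (32 * sqrt 2 * x / pi\<^sup>2 * S)"
    by (intro lambert_odd_of_real[where C = 2 and r = "\<lambda>j. 2 * Re (chi8 j)"] q) (auto simp: chi8_def)
  moreover have "F22 x = 9 * S" by (simp add: F22_def S_def f_def)
  moreover have "9 * pi\<^sup>2 / (32 * sqrt 2 * x) * (32 * sqrt 2 * x / pi\<^sup>2 * S) = 9 * S" using x by simp
  ultimately show ?thesis by (metis of_real_mult)
qed

lemma lattice_12:
  fixes x :: real
  assumes x: "x > 0"
  defines "q \<equiv> exp (- pi * x)"
  shows "complex_of_real (F12 x) = of_real (pi ^ 3 / 32) - of_real (pi\<^sup>2 / (32 * x)) * lambert (\<lambda>j. - 4 * (- 1) ^ j) odd_li1 (of_real q)"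
proof -
  define f where "f = (\<lambda>(n::int) k. (- 1) powi (n + int k) * (2 * real k + 1) / ((2 * real k + 1)\<^sup>2 + x\<^sup>2 * (2 * of_int n)\<^sup>2)\<^sup>2)"
  define g where "g = (\<lambda>j. pi\<^sup>2 / (16 * x) * (Im (li1 (\<i> * of_real (q ^ j))) / real j))"
  define r where "r = (\<lambda>n::int. if n = 0 then pi ^ 3 / 32 else (- 1) ^ nat \<bar>n\<bar> * g (nat \<bar>n\<bar>))"
  have q: "0 < q" "q < 1" using x by (simp_all add: q_def)
  have sm: "(\<lambda>(n, k). f n k) summable_on (UNIV \<times> UNIV)"
  proof (rule summable_on_lattice[OF summable_on_int_powr _ summable_on_nat_powr])
    \<comment> \<open>At n = 0 the term with \<open>x\<close> vanishes although (|n| + 1)^2 does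
      not. With m \<le> 1/4 the square (2k + 1)^2 covers both (k + 1)^2 and the constant in (|n| +
      1)^2 \<le> 2 n^2 + 2.\<close>
    define m where "m = min (1 / 4) (2 * x\<^sup>2)"
    show m0: "m > 0" using x by (simp add: m_def)
    show "m * ((real k + 1)\<^sup>2 + (\<bar>of_int n\<bar> + 1)\<^sup>2) \<le> (2 * real k + 1)\<^sup>2 + x\<^sup>2 * (2 * of_int n)\<^sup>2" for n k
    proof -
      define a where "a = (\<bar>of_int n\<bar> :: real)"
      have a2: "a\<^sup>2 = (of_int n)\<^sup>2" by (simp add: a_def)
      have 1: "m * (real k + 1)\<^sup>2 \<le> 1 / 4 * (real k + 1)\<^sup>2" by (intro mult_right_mono) (auto simp: m_def)
      have 2: "(real k + 1)\<^sup>2 \<le> (2 * real k + 1)\<^sup>2" "1 \<le> (2 * real k + 1)\<^sup>2" by (auto intro!: power_mono one_le_power)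
      have "0 \<le> (a - 1)\<^sup>2" by simp
      hence "(a + 1)\<^sup>2 \<le> 2 * a\<^sup>2 + 2" by (simp add: power2_eq_square algebra_simps)
      hence "m * (a + 1)\<^sup>2 \<le> m * (2 * a\<^sup>2 + 2)" using m0 by (intro mult_left_mono) auto
      also have "\<dots> = 2 * (m * a\<^sup>2) + 2 * m" by (simp add: algebra_simps)
      also have "m * a\<^sup>2 \<le> 2 * x\<^sup>2 * a\<^sup>2" by (intro mult_right_mono) (auto simp: m_def)
      finally have "m * (a + 1)\<^sup>2 \<le> 4 * (x\<^sup>2 * a\<^sup>2) + 2 * m" by simp
      moreover have "2 * m \<le> 1 / 2" by (simp add: m_def)
      moreover have "x\<^sup>2 * (2 * of_int n)\<^sup>2 = 4 * (x\<^sup>2 * a\<^sup>2)" by (simp add: a2 power_mult_distrib)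
      ultimately show ?thesis using 1 2 unfolding distrib_left a_def by linarith
    qed
    show "\<bar>f n k\<bar> \<le> 2 * (real k + 1) / ((2 * real k + 1)\<^sup>2 + x\<^sup>2 * (2 * of_int n)\<^sup>2)\<^sup>2" for n k
      unfolding f_def abs_divide abs_mult abs_minus_one_powi by (auto intro!: divide_right_mono)
  qed auto
  have sgn: "(- 1 :: real) powi (n + int k) = (- 1) ^ nat \<bar>n\<bar> * (- 1) ^ k" for n k
    by (simp add: power_int_minus_left power_int_add even_nat_iff minus_one_power_iff)
  have row: "(f n has_sum r n) UNIV" for n
  proof (cases "n = 0")
    case True
    have "(2 * real k + 1) / ((2 * real k + 1)\<^sup>2)\<^sup>2 = 1 / (2 * real k + 1) ^ 3" for k
      by (simp add: power2_eq_square power3_eq_cube divide_simps add_nonneg_eq_0_iff)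
    hence "f n k = (- 1) ^ k * (1 / (2 * real k + 1) ^ 3)" for k
      unfolding f_def sgn True by (simp flip: times_divide_eq_right)
    hence "f n = (\<lambda>k. (- 1) ^ k * (1 / (2 * real k + 1) ^ 3))" by (rule ext)
    thus ?thesis using has_sum_odd_cubes by (simp add: r_def True)
  next
    case False
    define j where "j = nat \<bar>n\<bar>"
    define y where "y = 2 * x * real j"
    have j: "real j = \<bar>of_int n\<bar>" "real j > 0" using False by (simp_all add: j_def)
    hence y: "y > 0" using x by (simp add: y_def)
    have e: "exp (- pi * y / 2) = q ^ j"
      unfolding q_def exp_power_nat[symmetric] by (rule arg_cong[of _ _ exp]) (simp add: y_def)
    have A: "((\<lambda>k. (- 1) ^ j * ((- 1) ^ k * (2 * real k + 1) / ((2 * real k + 1)\<^sup>2 + y\<^sup>2)\<^sup>2)) has_sum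
       (- 1) ^ j * (pi\<^sup>2 / (8 * y) * Im (li1 (\<i> * of_real (q ^ j))))) UNIV"
      using has_sum_row_odd[OF y] unfolding e by (intro has_sum_cmult_right) simp
    have B: "(- 1) ^ j * ((- 1) ^ k * (2 * real k + 1) / ((2 * real k + 1)\<^sup>2 + y\<^sup>2)\<^sup>2) = f n k" for k
    proof -
      have "y\<^sup>2 = x\<^sup>2 * (2 * of_int n)\<^sup>2" by (simp add: y_def j power_mult_distrib)
      thus ?thesis unfolding f_def sgn by (simp add: j_def)
    qed
    have V: "pi\<^sup>2 / (8 * y) * Im (li1 (\<i> * of_real (q ^ j))) = g j"
      using x j by (simp add: g_def y_def)
    have "r n = (- 1) ^ j * g j" using False by (simp add: r_def j_def)
    thus ?thesis using A unfolding B V by (simp only:)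
  qed
  define S where "S = (\<Sum>\<^sub>\<infinity>(n, k)\<in>UNIV \<times> UNIV. f n k)"
  have hs: "(r has_sum S) UNIV" unfolding S_def by (rule infsum_rows[OF sm row])
  \<comment> \<open>The rows n and - n agree, so those with n \<noteq> 0 contribute twice a series
    over positive indices; the row n = 0 supplies pi^3 / 32.\<close>
  define p where "p = (\<lambda>k. (- 1) ^ Suc k * g (Suc k))"
  have rp: "r (int (Suc k)) = p k" "r (- int (Suc k)) = p k" for k
  proof -
    have "nat \<bar>int (Suc k)\<bar> = Suc k" "nat \<bar>- int (Suc k)\<bar> = Suc k" "int (Suc k) \<noteq> 0" "- int (Suc k) \<noteq> 0" by linarith+
    thus "r (int (Suc k)) = p k" "r (- int (Suc k)) = p k" unfolding r_def p_def by (simp_all only: if_False)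
  qed
  have "r summable_on range (\<lambda>k. - int (Suc k))"
    using has_sum_imp_summable[OF hs] by (rule summable_on_subset_banach) auto
  hence "p summable_on UNIV"
    by (subst (asm) summable_on_reindex) (simp_all add: inj_def o_def rp del: of_nat_Suc)
  then obtain P where P: "(p has_sum P) UNIV" by (auto simp: summable_on_def)
  have "((\<lambda>k. r (int k)) has_sum (pi ^ 3 / 32 + P)) UNIV"
  proof -
    have "((\<lambda>k. r (int k)) has_sum P) (range Suc)"
      by (subst has_sum_reindex) (use P in \<open>simp_all add: o_def rp del: of_nat_Suc\<close>)
    from has_sum_insert[OF _ this, of 0] have "((\<lambda>k. r (int k)) has_sum (r 0 + P)) (insert 0 (range Suc))" by auto
    moreover have "insert 0 (range Suc) = UNIV" by (metis UNIV_nat_eq)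
    ultimately show ?thesis by (simp add: r_def)
  qed
  from has_sum_int_split[OF this, of P] P have "(r has_sum (pi ^ 3 / 32 + P + P)) UNIV" by (simp only: rp)
  hence S: "S = pi ^ 3 / 32 + 2 * P" using has_sum_unique[OF hs] by fastforce
  from sums_mult[OF has_sum_imp_sums[OF P], of "- 64 * x / pi\<^sup>2"]
  have "(\<lambda>k. - 4 * (- 1) ^ Suc k * (Im (li1 (\<i> * of_real (q ^ Suc k))) / real (Suc k))) sums (- 64 * x / pi\<^sup>2 * P)"
  proof -
    assume *: "(\<lambda>k. - 64 * x / pi\<^sup>2 * p k) sums (- 64 * x / pi\<^sup>2 * P)"
    have "- 64 * x / pi\<^sup>2 * (r * (pi\<^sup>2 / (16 * x) * v)) = - 4 * r * v" for r v
      using x by simp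
    thus ?thesis using * unfolding p_def g_def by (simp only:)
  qed
  hence "lambert (\<lambda>j. - 4 * (- 1) ^ j) odd_li1 (of_real q) = of_real (- 64 * x / pi\<^sup>2 * P)"
    by (intro lambert_odd_of_real[where C = 4 and r = "\<lambda>j. - 4 * (- 1) ^ j"] q) (auto simp: abs_mult power_abs)
  moreover have "F12 x = S" by (simp add: F12_def S_def f_def)
  moreover have "pi ^ 3 / 32 - pi\<^sup>2 / (32 * x) * (- 64 * x / pi\<^sup>2 * P) = pi ^ 3 / 32 + 2 * P" using x by simp
  ultimately show ?thesis unfolding S by (metis of_real_mult of_real_diff)
qed

section \<open>The series over cubes\<close>

text \<open>\<open>max 0 t\<close> cuts the integrand off at 0, so that later integrals run over the
  whole line while bounds matter for t > 0 only.\<close>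

lemma has_bochner_integral_Laplace:
  fixes A :: real
  assumes A: "A > 0"
  shows "has_bochner_integral lborel (\<lambda>t. max 0 t * exp (- (A * t))) (1 / A\<^sup>2)"
proof (rule has_bochner_integral_nn_integral)
  have "(\<integral>\<^sup>+t. ennreal (t * exp (- (A * t))) * indicator {0..} t \<partial>lborel) = 0 - (- (0 / A + 1 / A\<^sup>2) * exp (- (A * 0)))"
  proof (rule nn_integral_FTC_atLeast)
    fix t :: real
    show "((\<lambda>t. - (t / A + 1 / A\<^sup>2) * exp (- (A * t))) has_real_derivative t * exp (- (A * t))) (at t)"
      using A by (auto intro!: derivative_eq_intros simp: field_simps power2_eq_square)
    show "((\<lambda>t. - (t / A + 1 / A\<^sup>2) * exp (- (A * t))) \<longlongrightarrow> 0) at_top"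
      using A by real_asymp
  qed auto
  thus "(\<integral>\<^sup>+t. ennreal (max 0 t * exp (- (A * t))) \<partial>lborel) = ennreal (1 / A\<^sup>2)"
    by (subst nn_integral_cong[where v = "\<lambda>t. ennreal (t * exp (- (A * t))) * indicator {0..} t"])
      (auto simp: indicator_def max_def)
qed auto

lemma alternating_sum_bounds:
  fixes a :: "nat \<Rightarrow> real"
  assumes "decseq a" "\<And>n. 0 \<le> a n"
  shows "0 \<le> (\<Sum>n<N. (- 1) ^ n * a n) \<and> (\<Sum>n<N. (- 1) ^ n * a n) \<le> a 0"
  using assms
proof (induction N arbitrary: a)
  case (Suc N)
  have "decseq (\<lambda>n. a (Suc n))" using Suc.prems(1) by (simp add: decseq_Suc_iff)
  from Suc.IH[OF this] Suc.prems(2)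
  have "0 \<le> (\<Sum>n<N. (- 1) ^ n * a (Suc n)) \<and> (\<Sum>n<N. (- 1) ^ n * a (Suc n)) \<le> a (Suc 0)" by simp
  moreover have "a (Suc 0) \<le> a 0" using Suc.prems(1) by (simp add: decseq_Suc_iff)
  moreover have "(\<Sum>n<Suc N. (- 1) ^ n * a n) = a 0 - (\<Sum>n<N. (- 1) ^ n * a (Suc n))"
    by (subst sum.lessThan_Suc_shift) (simp add: sum_negf)
  ultimately show ?case by linarith
qed simp

lemma sum_symmetric_int:
  fixes f :: "int \<Rightarrow> 'a :: comm_monoid_add"
  shows "(\<Sum>n = - int v..int v. f n) = (\<Sum>n<Suc v. f (int n)) + (\<Sum>n<v. f (- int (Suc n)))"
proof (induction v)
  case (Suc v)
  have "{- int (Suc v)..int (Suc v)} = insert (int (Suc v)) (insert (- int (Suc v)) {- int v..int v})" by auto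
  hence "(\<Sum>n = - int (Suc v)..int (Suc v). f n) = f (int (Suc v)) + (f (- int (Suc v)) + (\<Sum>n = - int v..int v. f n))" by simp
  thus ?case unfolding Suc.IH sum.lessThan_Suc[of _ "Suc v"] sum.lessThan_Suc[of "\<lambda>n. f (- int (Suc n))"] by (simp add: ac_simps)
qed simp

lemma has_sum_int_LIMSEQ:
  fixes f :: "int \<Rightarrow> 'a :: real_normed_vector"
  assumes "(f has_sum S) UNIV"
  shows "(\<lambda>v. \<Sum>n = - int v..int v. f n) \<longlonglongrightarrow> S"
proof -
  have "filterlim (\<lambda>v. {- int v..int v}) (finite_subsets_at_top UNIV) sequentially"
    unfolding filterlim_finite_subsets_at_top
  proof (intro allI impI, elim conjE)
    fix X :: "int set" assume X: "finite X"
    have "X \<subseteq> {- int v..int v}" if "v \<ge> nat (\<Sum>n\<in>X. \<bar>n\<bar>)" for v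
    proof
      fix n assume "n \<in> X"
      hence "\<bar>n\<bar> \<le> (\<Sum>n\<in>X. \<bar>n\<bar>)" using X by (intro member_le_sum) auto
      thus "n \<in> {- int v..int v}" using that by auto
    qed
    thus "\<forall>\<^sub>F v in sequentially. finite {- int v..int v} \<and> X \<subseteq> {- int v..int v} \<and> {- int v..int v} \<subseteq> UNIV"
      by (auto intro: eventually_sequentiallyI)
  qed
  with assms show ?thesis unfolding has_sum_def by (rule filterlim_compose)
qed

text \<open>By the pentagonal number theorem \<open>pent t\<close> is \<open>exp (- t)\<close> times the product of
  \<open>1 - exp (- 24 * n * t)\<close>, because \<open>(6 * n + 1)\<^sup>2 = 24 * (n * (3 * n + 1) / 2) + 1\<close>.\<close>

definition pent_sum :: "nat \<Rightarrow> real \<Rightarrow> real" where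
  "pent_sum v t = (\<Sum>n = - int v..int v. (- 1) powi n * exp (- ((6 * of_int n + 1)\<^sup>2 * t)))"

definition pent :: "real \<Rightarrow> real" where
  "pent t = (\<Sum>\<^sub>\<infinity>n::int. (- 1) powi n * exp (- ((6 * of_int n + 1)\<^sup>2 * t)))"

lemma borel_measurable_pent_sum [measurable]: "pent_sum v \<in> borel_measurable borel"
  unfolding pent_sum_def by measurable

text \<open>The terms n \<ge> 0 and n < 0 form two alternating sums with decreasing absolute values,
  each within 0 and exp (- t), and \<open>pent_sum\<close> is their difference. Absolute values term
  by term would give only t^(-1/2) per factor near 0, hence t^(-1) for the fourfold product times t,
  which is not integrable.\<close>

lemma abs_pent_sum_le:
  assumes t: "t \<ge> 0"
  shows "\<bar>pent_sum v t\<bar> \<le> exp (- t)"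
proof -
  define a b where "a = (\<lambda>n. exp (- ((6 * real n + 1)\<^sup>2 * t)))" and "b = (\<lambda>n. exp (- ((6 * real n + 5)\<^sup>2 * t)))"
  have "decseq a" "decseq b" using t by (auto simp: a_def b_def decseq_def intro!: mult_right_mono power_mono)
  note alternating_sum_bounds[OF this(1), of "Suc v"] alternating_sum_bounds[OF this(2), of v]
  moreover have "pent_sum v t = (\<Sum>n<Suc v. (- 1) ^ n * a n) - (\<Sum>n<v. (- 1) ^ n * b n)"
  proof -
    have "(- 1) powi (- int (Suc n)) * exp (- ((6 * of_int (- int (Suc n)) + 1)\<^sup>2 * t)) = - ((- 1) ^ n * b n)" for n
    proof -
      have "(6 * of_int (- int (Suc n)) + 1 :: real)\<^sup>2 = (6 * real n + 5)\<^sup>2" by (simp add: power2_eq_square algebra_simps)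
      moreover have "(- 1 :: real) powi (- int (Suc n)) = - ((- 1) ^ n)"
        by (simp add: power_int_minus flip: power_inverse del: of_nat_Suc)
      ultimately show ?thesis unfolding b_def by (simp only: mult_minus_left)
    qed
    thus ?thesis unfolding pent_sum_def sum_symmetric_int by (simp add: a_def sum_negf del: of_nat_Suc sum.lessThan_Suc)
  qed
  moreover have "a n \<ge> 0" "b n \<ge> 0" for n by (simp_all add: a_def b_def)
  moreover have "a 0 = exp (- t)" "b 0 \<le> exp (- t)" using t by (simp_all add: a_def b_def)
  ultimately show ?thesis by (smt (verit))
qed

text \<open>Let q = exp (- 24 t). The triple product for the nome q^3 at x = q^2 collects all
  residues modulo 3 into \<open>qpoch q q\<close>. With the factor exp (- t), the coefficient of - t
  in the exponent is 48 n + 36 n (n - 1) + 1 = (6n + 1)^2. For the cube it is 12 k (k + 1) + 3 = 3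
  (2k + 1)^2.\<close>

lemma pent:
  assumes t: "t > 0"
  shows has_sum_pent: "((\<lambda>n. (- 1) powi n * exp (- ((6 * of_int n + 1)\<^sup>2 * t))) has_sum pent t) UNIV"
    and pent_cube_sums: "(\<lambda>k. (- 1) ^ k * (2 * real k + 1) * exp (- (3 * (2 * real k + 1)\<^sup>2 * t))) sums (pent t ^ 3)"
proof -
  define q where "q = (exp (- 24 * of_real t) :: complex)"
  interpret one: nome q "- 24 * of_real t" using t by unfold_locales (simp_all add: q_def)
  interpret three: nome "q ^ 3" "- 72 * of_real t"
    using t by unfold_locales (simp_all add: q_def norm_power power_less_one_iff flip: exp_of_nat_mult)
  have qn: "q \<noteq> 0" by (simp add: q_def)
  define f where "f = (\<lambda>n::int. (- 1) powi n * exp (- ((6 * of_int n + 1)\<^sup>2 * t)))"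
  have "qpoch (q ^ 3) (q ^ 3) * theta (q\<^sup>2) (q ^ 3) = qpoch q q"
    using qpoch_split[OF one.lt1, of 3 q] qn by (simp add: theta_def eval_nat_numeral mult_ac)
  moreover have "(- (q\<^sup>2)) powi n * (q ^ 3) ^ nat (n * (n - 1) div 2) * exp (- of_real t) = of_real (f n)" for n
  proof -
    have e: "even (n * (n - 1))" by simp
    have p: "n * (n - 1) div 2 \<ge> 0" by (cases "n \<ge> 1") (auto intro: mult_nonpos_nonpos)
    have m: "real (nat (n * (n - 1) div 2)) = of_int n * (of_int n - 1) / 2"
      using p real_of_int_div[of 2 "n * (n - 1)"] e by simp
    have "(- (q\<^sup>2)) powi n = (- 1) powi n * (q\<^sup>2) powi n"
      using power_int_mult_distrib[of "- 1" "q\<^sup>2" n] by simp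
    also have "(q\<^sup>2) powi n = of_real (exp (of_int n * (- 48 * t)))"
      by (simp add: q_def exp_power_int flip: exp_of_nat_mult exp_of_real)
    finally have A: "(- (q\<^sup>2)) powi n = (- 1) powi n * of_real (exp (of_int n * (- 48 * t)))" .
    have B: "(q ^ 3) ^ nat (n * (n - 1) div 2) = of_real (exp (real (nat (n * (n - 1) div 2)) * (- 72 * t)))"
      by (simp add: q_def flip: exp_of_nat_mult exp_of_real)
    have "(- (q\<^sup>2)) powi n * (q ^ 3) ^ nat (n * (n - 1) div 2) * exp (- of_real t) =
      of_real ((- 1) powi n * exp (of_int n * (- 48 * t) + of_int n * (of_int n - 1) / 2 * (- 72 * t) + - t))"
      unfolding A B exp_add m of_real_mult of_real_power_int by (simp flip: exp_of_real)
    also have "of_int n * (- 48 * t) + of_int n * (of_int n - 1) / 2 * (- 72 * t) + - t = - ((6 * of_int n + 1)\<^sup>2 * t)"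
      by (simp add: power2_eq_square field_simps)
    finally show ?thesis by (simp add: f_def)
  qed
  ultimately have hs: "((\<lambda>n. complex_of_real (f n)) has_sum qpoch q q * exp (- of_real t)) UNIV"
    using has_sum_cmult_left[OF three.has_sum_triple_product[of "q\<^sup>2"], of "exp (- of_real t)"] qn by simp
  from has_sum_Re[OF this] have "f summable_on UNIV" by (auto simp: summable_on_def)
  thus P: "(f has_sum pent t) UNIV" unfolding pent_def f_def by simp
  from has_sum_unique[OF hs has_sum_of_real[OF this]]
  have eq: "qpoch q q * exp (- of_real t) = of_real (pent t)" by simp
  have "(\<lambda>k. (- 1) ^ k * of_nat (2 * k + 1) * q ^ tri k * exp (- of_real t) ^ 3) sums (qpoch q q ^ 3 * exp (- of_real t) ^ 3)"
    by (intro sums_mult2 one.jacobi_cube)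
  also have "qpoch q q ^ 3 * exp (- of_real t) ^ 3 = of_real (pent t ^ 3)"
    unfolding power_mult_distrib[symmetric] eq by simp
  finally have "(\<lambda>k. (- 1) ^ k * of_nat (2 * k + 1) * q ^ tri k * exp (- of_real t) ^ 3) sums of_real (pent t ^ 3)" .
  moreover have "(- 1) ^ k * of_nat (2 * k + 1) * q ^ tri k * exp (- of_real t) ^ 3 =
    of_real ((- 1) ^ k * (2 * real k + 1) * exp (- (3 * (2 * real k + 1)\<^sup>2 * t)))" for k
  proof -
    have "real (tri k) = real k * (real k + 1) / 2" using arg_cong[OF two_tri[of k], of real] by (simp add: field_simps)
    hence "real (tri k) * (- 24 * t) + 3 * - t = - (3 * (2 * real k + 1)\<^sup>2 * t)"
      by (simp only:) (simp add: power2_eq_square field_simps)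
    moreover have "q ^ tri k * exp (- of_real t) ^ 3 = of_real (exp (real (tri k) * (- 24 * t) + 3 * - t))"
      unfolding exp_add q_def exp_of_nat_mult[symmetric] by (simp flip: exp_of_real exp_of_nat_mult exp_add)
    ultimately show ?thesis by simp
  qed
  ultimately show "(\<lambda>k. (- 1) ^ k * (2 * real k + 1) * exp (- (3 * (2 * real k + 1)\<^sup>2 * t))) sums (pent t ^ 3)"
    by (simp only: sums_of_real_iff)
qed

lemma pent_sum_LIMSEQ: "t > 0 \<Longrightarrow> (\<lambda>v. pent_sum v t) \<longlonglongrightarrow> pent t"
  unfolding pent_sum_def by (intro has_sum_int_LIMSEQ has_sum_pent)

lemma abs_pent_le: "t > 0 \<Longrightarrow> \<bar>pent t\<bar> \<le> exp (- t)"
  using abs_pent_sum_le by (intro LIMSEQ_le_const2[OF tendsto_rabs[OF pent_sum_LIMSEQ]]) auto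

section \<open>Dominated convergence over the cubes\<close>

lemma dominated_LIMSEQ:
  fixes s :: "nat \<Rightarrow> real \<Rightarrow> real"
  assumes "\<And>v. s v \<in> borel_measurable lborel" "integrable lborel w"
    and lim: "\<And>t. (\<lambda>v. s v t) \<longlonglongrightarrow> f t" and "\<And>v t. \<bar>s v t\<bar> \<le> w t"
  shows "integrable lborel f" "(\<lambda>v. integral\<^sup>L lborel (s v)) \<longlonglongrightarrow> integral\<^sup>L lborel f"
proof -
  have f: "f \<in> borel_measurable lborel" by (rule borel_measurable_LIMSEQ_real[OF lim assms(1)])
  show "integrable lborel f" by (rule integrable_dominated_convergence[where s = s and w = w, OF f assms(1,2)]) (use assms in auto)
  show "(\<lambda>v. integral\<^sup>L lborel (s v)) \<longlonglongrightarrow> integral\<^sup>L lborel f"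
    by (rule integral_dominated_convergence[where s = s and w = w, OF f assms(1,2)]) (use assms in auto)
qed

lemma exp_abs_le: "max 0 t * exp (- (A * t)) * \<bar>p\<bar> \<le> max 0 t * exp (- ((A + B) * t))"
  if "t > 0 \<Longrightarrow> \<bar>p\<bar> \<le> exp (- (B * t))" for t A B p :: real
proof (cases "t > 0")
  case True
  have "exp (- ((A + B) * t)) = exp (- (A * t)) * exp (- (B * t))" by (simp add: algebra_simps flip: exp_add)
  thus ?thesis using that[OF True] True by (simp add: mult_ac)
qed simp

text \<open>Used with A = 3 (2k + 1)^2: one row over n of the double series, summed in the symmetric
  order in which the integral produces it.\<close>

lemma pent_row:
  assumes x: "x > 0" and A: "A > 0"
  shows "integrable lborel (\<lambda>t. max 0 t * exp (- (A * t)) * pent (x\<^sup>2 * t))"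
    and "(\<lambda>v. \<Sum>n = - int v..int v. (- 1) powi n / (A + x\<^sup>2 * (6 * of_int n + 1)\<^sup>2)\<^sup>2) \<longlonglongrightarrow>
           (LINT t|lborel. max 0 t * exp (- (A * t)) * pent (x\<^sup>2 * t))"
proof -
  let ?s = "\<lambda>v t. max 0 t * exp (- (A * t)) * pent_sum v (x\<^sup>2 * t)"
  let ?w = "\<lambda>t. max 0 t * exp (- ((A + x\<^sup>2) * t))"
  have pos: "A + x\<^sup>2 * r\<^sup>2 > 0" "A + x\<^sup>2 > 0" for r using A by (simp_all add: add_pos_nonneg)
  have w: "integrable lborel ?w"
    using has_bochner_integral_Laplace[OF pos(2)] by (simp add: has_bochner_integral_iff)
  have b: "\<bar>?s v t\<bar> \<le> ?w t" for v t
    unfolding abs_mult using exp_abs_le[of t "pent_sum v (x\<^sup>2 * t)" "x\<^sup>2" A] abs_pent_sum_le[of "x\<^sup>2 * t" v] by simp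
  have lim: "(\<lambda>v. ?s v t) \<longlonglongrightarrow> max 0 t * exp (- (A * t)) * pent (x\<^sup>2 * t)" for t
    using x by (cases "t > 0") (auto intro!: tendsto_mult pent_sum_LIMSEQ)
  have m: "?s v \<in> borel_measurable lborel" for v by measurable
  show "integrable lborel (\<lambda>t. max 0 t * exp (- (A * t)) * pent (x\<^sup>2 * t))"
    by (rule dominated_LIMSEQ[OF m w lim b])
  have "has_bochner_integral lborel (?s v) (\<Sum>n = - int v..int v. (- 1) powi n / (A + x\<^sup>2 * (6 * of_int n + 1)\<^sup>2)\<^sup>2)" for v
  proof -
    have "has_bochner_integral lborel (\<lambda>t. \<Sum>n = - int v..int v. (- 1) powi n * (max 0 t * exp (- ((A + x\<^sup>2 * (6 * of_int n + 1)\<^sup>2) * t))))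
      (\<Sum>n = - int v..int v. (- 1) powi n * (1 / (A + x\<^sup>2 * (6 * of_int n + 1)\<^sup>2)\<^sup>2))"
      by (intro has_bochner_integral_sum has_bochner_integral_mult_right has_bochner_integral_Laplace pos)
    also have "(\<lambda>t. \<Sum>n = - int v..int v. (- 1) powi n * (max 0 t * exp (- ((A + x\<^sup>2 * (6 * of_int n + 1)\<^sup>2) * t)))) = ?s v"
      unfolding pent_sum_def sum_distrib_left by (intro ext sum.cong refl) (simp add: algebra_simps exp_diff exp_minus field_simps)
    finally show ?thesis by simp
  qed
  hence "integral\<^sup>L lborel (?s v) = (\<Sum>n = - int v..int v. (- 1) powi n / (A + x\<^sup>2 * (6 * of_int n + 1)\<^sup>2)\<^sup>2)" for v
    by (rule has_bochner_integral_integral_eq)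
  with dominated_LIMSEQ(2)[OF m w lim b]
  show "(\<lambda>v. \<Sum>n = - int v..int v. (- 1) powi n / (A + x\<^sup>2 * (6 * of_int n + 1)\<^sup>2)\<^sup>2) \<longlonglongrightarrow>
           (LINT t|lborel. max 0 t * exp (- (A * t)) * pent (x\<^sup>2 * t))" by simp
qed

lemma cube_sum_eq_integral:
  assumes x: "x > 0"
  shows "(\<Sum>n1 = - int v..int v. \<Sum>n2 = - int v..int v. \<Sum>n3 = - int v..int v. \<Sum>n4 = - int v..int v.
      (- 1) powi (n1 + n2 + n3 + n4) /
      (1 * (6 * real_of_int n1 + 1)\<^sup>2 + 1 * (6 * real_of_int n2 + 1)\<^sup>2 +
       1 * (6 * real_of_int n3 + 1)\<^sup>2 + x\<^sup>2 * (6 * real_of_int n4 + 1)\<^sup>2)\<^sup>2) =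
    (LINT t|lborel. max 0 t * (pent_sum v t ^ 3 * pent_sum v (x\<^sup>2 * t)))"
proof -
  define I where "I = {- int v..int v}"
  define c where "c = (\<lambda>n. (6 * real_of_int n + 1)\<^sup>2)"
  define D where "D = (\<lambda>n1 n2 n3 n4. c n1 + c n2 + c n3 + x\<^sup>2 * c n4)"
  define e where "e = (\<lambda>t n. (- 1) powi n * exp (- (c n * t)))"
  have cpos: "c n > 0" for n using six_int_ne_0[of n] by (simp add: c_def)
  have D: "D n1 n2 n3 n4 > 0" for n1 n2 n3 n4
    using cpos x unfolding D_def by (intro add_pos_pos mult_pos_pos) auto
  have "has_bochner_integral lborel
      (\<lambda>t. \<Sum>n1\<in>I. \<Sum>n2\<in>I. \<Sum>n3\<in>I. \<Sum>n4\<in>I. (- 1) powi (n1 + n2 + n3 + n4) * (max 0 t * exp (- (D n1 n2 n3 n4 * t))))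
      (\<Sum>n1\<in>I. \<Sum>n2\<in>I. \<Sum>n3\<in>I. \<Sum>n4\<in>I. (- 1) powi (n1 + n2 + n3 + n4) * (1 / (D n1 n2 n3 n4)\<^sup>2))"
    by (intro has_bochner_integral_sum has_bochner_integral_mult_right has_bochner_integral_Laplace D)
  also have "(\<lambda>t. \<Sum>n1\<in>I. \<Sum>n2\<in>I. \<Sum>n3\<in>I. \<Sum>n4\<in>I. (- 1) powi (n1 + n2 + n3 + n4) * (max 0 t * exp (- (D n1 n2 n3 n4 * t)))) =
      (\<lambda>t. max 0 t * (pent_sum v t ^ 3 * pent_sum v (x\<^sup>2 * t)))"
  proof
    fix t
    have "exp (- (D n1 n2 n3 n4 * t)) = exp (- (c n1 * t)) * exp (- (c n2 * t)) * exp (- (c n3 * t)) * exp (- (c n4 * (x\<^sup>2 * t)))" for n1 n2 n3 n4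
      unfolding exp_add[symmetric] by (rule arg_cong[of _ _ exp]) (simp add: D_def algebra_simps)
    hence "(- 1) powi (n1 + n2 + n3 + n4) * (max 0 t * exp (- (D n1 n2 n3 n4 * t))) =
        max 0 t * (e t n1 * (e t n2 * (e t n3 * e (x\<^sup>2 * t) n4)))" for n1 n2 n3 n4
      by (simp add: e_def power_int_add mult_ac)
    hence "(\<Sum>n1\<in>I. \<Sum>n2\<in>I. \<Sum>n3\<in>I. \<Sum>n4\<in>I. (- 1) powi (n1 + n2 + n3 + n4) * (max 0 t * exp (- (D n1 n2 n3 n4 * t)))) =
        max 0 t * (sum (e t) I * (sum (e t) I * (sum (e t) I * sum (e (x\<^sup>2 * t)) I)))"
      by (simp only: sum_distrib_left[symmetric] sum_distrib_right[symmetric])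
    also have "\<dots> = max 0 t * (pent_sum v t ^ 3 * pent_sum v (x\<^sup>2 * t))"
      by (simp add: pent_sum_def e_def c_def I_def power3_eq_cube mult_ac)
    finally show "(\<Sum>n1\<in>I. \<Sum>n2\<in>I. \<Sum>n3\<in>I. \<Sum>n4\<in>I. (- 1) powi (n1 + n2 + n3 + n4) * (max 0 t * exp (- (D n1 n2 n3 n4 * t)))) =
        max 0 t * (pent_sum v t ^ 3 * pent_sum v (x\<^sup>2 * t))" .
  qed
  finally show ?thesis
    by (subst has_bochner_integral_integral_eq) (auto simp: D_def c_def I_def)
qed

lemma lattice_F_eq_infsum:
  fixes x :: real
  assumes x: "x > 0"
  defines "f \<equiv> (\<lambda>n k. (- 1) powi n * ((- 1) ^ k * (2 * real k + 1)) / (3 * (2 * real k + 1)\<^sup>2 + x\<^sup>2 * (6 * of_int n + 1)\<^sup>2)\<^sup>2)"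
  shows "lattice_F 1 1 1 (x\<^sup>2) / (3 + x\<^sup>2)\<^sup>2 = (\<Sum>\<^sub>\<infinity>(n, k)\<in>UNIV \<times> UNIV. f n k)"
proof -
  define L where "L = (LINT t|lborel. max 0 t * (pent t ^ 3 * pent (x\<^sup>2 * t)))"
  have w: "integrable lborel (\<lambda>t. max 0 t * exp (- ((0 + (3 + x\<^sup>2)) * t)))"
    using has_bochner_integral_Laplace[of "3 + x\<^sup>2"] by (simp add: has_bochner_integral_iff add_pos_nonneg)
  have "(\<lambda>v. LINT t|lborel. max 0 t * (pent_sum v t ^ 3 * pent_sum v (x\<^sup>2 * t))) \<longlonglongrightarrow> L"
    unfolding L_def
  proof (rule dominated_LIMSEQ(2)[OF _ w])
    show "(\<lambda>v. max 0 t * (pent_sum v t ^ 3 * pent_sum v (x\<^sup>2 * t))) \<longlonglongrightarrow> max 0 t * (pent t ^ 3 * pent (x\<^sup>2 * t))" for t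
      using x by (cases "t > 0") (auto intro!: tendsto_mult tendsto_power pent_sum_LIMSEQ)
    show "\<bar>max 0 t * (pent_sum v t ^ 3 * pent_sum v (x\<^sup>2 * t))\<bar> \<le> max 0 t * exp (- ((0 + (3 + x\<^sup>2)) * t))" for t v
    proof -
      have "\<bar>pent_sum v t ^ 3 * pent_sum v (x\<^sup>2 * t)\<bar> \<le> exp (- t) ^ 3 * exp (- (x\<^sup>2 * t))" if "t > 0"
        unfolding abs_mult power_abs using that by (intro mult_mono power_mono abs_pent_sum_le) auto
      also have "exp (- t) ^ 3 * exp (- (x\<^sup>2 * t)) = exp (- ((3 + x\<^sup>2) * t))"
        by (simp add: algebra_simps flip: exp_of_nat_mult exp_add)
      finally show ?thesis
        using exp_abs_le[of t "pent_sum v t ^ 3 * pent_sum v (x\<^sup>2 * t)" "3 + x\<^sup>2" 0] by (simp add: abs_mult)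
    qed
  qed simp
  hence "lattice_F 1 1 1 (x\<^sup>2) = (3 + x\<^sup>2)\<^sup>2 * L"
    unfolding lattice_F_def cube_sum_eq_integral[OF x] by (simp add: limI)
  moreover have "3 + x\<^sup>2 \<noteq> 0" using x by (simp add: add_nonneg_eq_0_iff)
  ultimately have "lattice_F 1 1 1 (x\<^sup>2) / (3 + x\<^sup>2)\<^sup>2 = L" by simp
  also have "L = (\<Sum>\<^sub>\<infinity>(n, k)\<in>UNIV \<times> UNIV. f n k)"
  proof -
    define A where "A = (\<lambda>k. 3 * (2 * real k + 1)\<^sup>2)"
    define h where "h = (\<lambda>k t. max 0 t * exp (- (A k * t)) * pent (x\<^sup>2 * t))"
    define c where "c = (\<lambda>k. (- 1) ^ k * (2 * real k + 1))"
    have A: "A k > 0" for k by (simp add: A_def add_nonneg_pos)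
    have sq: "summable (\<lambda>k. K * (1 / real (Suc k) ^ 2))" for K
      using summable_Suc_iff[THEN iffD2, OF inverse_power_summable[of 2, where 'a = real]]
      by (intro summable_mult) (simp add: inverse_eq_divide)
    \<comment> \<open>The left side is the integral of the k-th majorant. It decays like k^(-3), but
      comparison with k^(-2) is enough.\<close>
    have cA: "\<bar>c k\<bar> / (A k)\<^sup>2 \<le> 1 / real (Suc k) ^ 2" for k
    proof -
      define m where "m = 2 * real k + 1"
      have m: "m \<ge> real (Suc k)" "m \<ge> 1" by (simp_all add: m_def)
      have "m / (3 * m\<^sup>2)\<^sup>2 = 1 / (9 * m * m\<^sup>2)" using m by (simp add: field_simps power2_eq_square)
      also have "\<dots> \<le> 1 / real (Suc k) ^ 2"
        using m by (intro divide_left_mono order_trans[OF power_mono[OF m(1)], of 2]) (auto intro!: mult_right_le_one_le simp: mult_le_cancel_right1)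
      finally show ?thesis by (simp add: c_def A_def m_def abs_mult power_abs)
    qed
    have "(\<lambda>k. LINT t|lborel. c k * h k t) sums (LINT t|lborel. (\<Sum>k. c k * h k t))"
    proof (rule sums_integral)
      show int: "integrable lborel (\<lambda>t. c k * h k t)" for k
        unfolding h_def by (intro integrable_mult_right pent_row x A)
      \<comment> \<open>Here \<open>pent\<close> is bounded by 1 only (the case B = 0 of
        \<open>exp_abs_le\<close>); the decay in k comes from exp (- A k * t).\<close>
      have hle: "\<bar>h k t\<bar> \<le> max 0 t * exp (- (A k * t))" for k t
      proof -
        have "\<bar>pent (x\<^sup>2 * t)\<bar> \<le> exp (- (0 * t))" if "t > 0"
          using abs_pent_le[of "x\<^sup>2 * t"] that x by (intro order_trans[OF abs_pent_le]) auto
        from exp_abs_le[OF this, of "A k"] show ?thesis by (simp add: h_def abs_mult)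
      qed
      show "AE t in lborel. summable (\<lambda>k. norm (c k * h k t))"
      proof (rule AE_I2)
        fix t :: real
        show "summable (\<lambda>k. norm (c k * h k t))"
        proof (cases "t > 0")
          case True
          have "\<bar>c k * h k t\<bar> \<le> 2 / t * (1 / real (Suc k) ^ 2)" for k
          proof -
            \<comment> \<open>The quadratic Taylor term bounds exp (- s) by 2 / s^2; with s = A k *
              t this is summable against \<open>c\<close> for each fixed t > 0.\<close>
            have "1 + A k * t + (A k * t)\<^sup>2 / 2 \<le> exp (A k * t)"
              using A[of k] True by (intro exp_lower_Taylor_quadratic) auto
            hence "(A k * t)\<^sup>2 / 2 \<le> exp (A k * t)"
              using mult_pos_pos[OF A[of k] True] by linarith
            moreover have p: "(A k * t)\<^sup>2 / 2 > 0" using A[of k] True by simp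
            ultimately have "exp (- (A k * t)) \<le> 2 / (A k * t)\<^sup>2"
              by (simp add: exp_minus field_simps)
            hence "t * exp (- (A k * t)) \<le> t * (2 / (A k * t)\<^sup>2)" using True by (intro mult_left_mono) auto
            hence "\<bar>h k t\<bar> \<le> t * (2 / (A k * t)\<^sup>2)"
              using hle[of k t] True by simp
            also have "t * (2 / (A k * t)\<^sup>2) = 2 / t * (1 / (A k)\<^sup>2)" using True by (simp add: power2_eq_square)
            finally have "\<bar>c k\<bar> * \<bar>h k t\<bar> \<le> \<bar>c k\<bar> * (2 / t * (1 / (A k)\<^sup>2))" by (rule mult_left_mono) simp
            also have "\<dots> = 2 / t * (\<bar>c k\<bar> / (A k)\<^sup>2)" by simp
            also have "\<dots> \<le> 2 / t * (1 / real (Suc k) ^ 2)" using True by (intro mult_left_mono cA) auto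
            finally show ?thesis by (simp only: abs_mult)
          qed
          thus ?thesis by (intro summable_comparison_test'[OF sq[of "2 / t"]]) (simp only: real_norm_def abs_abs)
        qed (simp add: h_def)
      qed
      show "summable (\<lambda>k. LINT t|lborel. norm (c k * h k t))"
      proof (rule summable_comparison_test'[OF sq[of 1]])
        fix k :: nat
        have L: "has_bochner_integral lborel (\<lambda>t. \<bar>c k\<bar> * (max 0 t * exp (- (A k * t)))) (\<bar>c k\<bar> * (1 / (A k)\<^sup>2))"
          by (intro has_bochner_integral_mult_right has_bochner_integral_Laplace A)
        have "(LINT t|lborel. norm (c k * h k t)) \<le> (LINT t|lborel. \<bar>c k\<bar> * (max 0 t * exp (- (A k * t))))"
          using int L hle by (intro integral_mono integrable_norm) (auto simp: has_bochner_integral_iff abs_mult intro!: mult_left_mono)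
        also have "\<dots> \<le> 1 * (1 / real (Suc k) ^ 2)" using L cA[of k] by (simp add: has_bochner_integral_iff)
        finally show "norm (LINT t|lborel. norm (c k * h k t)) \<le> 1 * (1 / real (Suc k) ^ 2)" by simp
      qed
    qed
    also have "(\<lambda>t. \<Sum>k. c k * h k t) = (\<lambda>t. max 0 t * (pent t ^ 3 * pent (x\<^sup>2 * t)))"
    proof
      fix t :: real
      show "(\<Sum>k. c k * h k t) = max 0 t * (pent t ^ 3 * pent (x\<^sup>2 * t))"
      proof (cases "t > 0")
        case True
        from sums_mult2[OF pent_cube_sums[OF this], of "max 0 t * pent (x\<^sup>2 * t)"]
        have "(\<lambda>k. c k * h k t) sums (max 0 t * (pent t ^ 3 * pent (x\<^sup>2 * t)))"
          by (simp add: c_def h_def A_def mult_ac)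
        thus ?thesis by (rule sums_unique[symmetric])
      qed (simp add: h_def)
    qed
    finally have sums: "(\<lambda>k. LINT t|lborel. c k * h k t) sums L" by (simp only: L_def)
    \<comment> \<open>The integral produces the sum with k outside and n inside, whereas the double
      series is stated in the opposite order; its unconditional convergence reconciles the
      two.\<close>
    have swap: "((\<lambda>(k, n). f n k) has_sum (\<Sum>\<^sub>\<infinity>(n, k)\<in>UNIV \<times> UNIV. f n k)) (UNIV \<times> UNIV)"
      using has_sum_infsum[OF lattice_13(1)[OF x]] unfolding f_def by (subst has_sum_swap) (simp add: case_prod_unfold)
    hence sm: "(\<lambda>(k, n). f n k) summable_on (UNIV \<times> UNIV)" by (auto simp: summable_on_def)
    \<comment> \<open>The integral is the limit of symmetric partial sums. The row is summable in
      the unordered sense, so this limit is its sum.\<close>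
    have row: "((\<lambda>n. f n k) has_sum (LINT t|lborel. c k * h k t)) UNIV" for k
    proof -
      have s: "(\<lambda>n. f n k) summable_on UNIV"
        using summable_on_SigmaD1[OF sm, of k] by simp
      hence "(\<lambda>v. \<Sum>n = - int v..int v. f n k) \<longlonglongrightarrow> (\<Sum>\<^sub>\<infinity>n. f n k)" by (intro has_sum_int_LIMSEQ) simp
      moreover have "(\<lambda>v. c k * (\<Sum>n = - int v..int v. (- 1) powi n / (A k + x\<^sup>2 * (6 * of_int n + 1)\<^sup>2)\<^sup>2)) \<longlonglongrightarrow>
           c k * (LINT t|lborel. h k t)"
        unfolding h_def by (intro tendsto_mult_left pent_row x A)
      hence "(\<lambda>v. \<Sum>n = - int v..int v. f n k) \<longlonglongrightarrow> (LINT t|lborel. c k * h k t)"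
        unfolding f_def c_def A_def sum_distrib_left by (simp add: mult_ac)
      ultimately have "(\<Sum>\<^sub>\<infinity>n. f n k) = (LINT t|lborel. c k * h k t)" by (rule LIMSEQ_unique)
      thus ?thesis using s by (metis has_sum_infsum)
    qed
    from has_sum_imp_sums[OF infsum_rows[OF sm row]] sums
    have "L = (\<Sum>\<^sub>\<infinity>(k, n)\<in>UNIV \<times> UNIV. f n k)" by (rule sums_unique2[symmetric])
    also have "\<dots> = (\<Sum>\<^sub>\<infinity>(n, k)\<in>UNIV \<times> UNIV. f n k)" by (rule infsumI[OF swap])
    finally show ?thesis .
  qed
  finally show ?thesis .
qed

text \<open>(ii) and (iv) are equations between complex numbers and so contain the assertion that
  their integrals are real.\<close>

theorem theorem3:
  fixes x :: real
  assumes "x > 0"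
  shows
    "(let q = exp (- pi * x / sqrt 12) in
        lattice_F 1 1 1 (x\<^sup>2) / (3 + x\<^sup>2)\<^sup>2 =
        pi\<^sup>2 / (24 * sqrt 3 * x) *
          Im (contour_integral (linepath 0 (\<i> * complex_of_real q))
                (\<lambda>u. ram_f (- (u ^ 3)) ^ 9 / ram_f (- u) ^ 3)))
   \<and> (let q = exp (- pi * x) in
        complex_of_real (F12 x) =
        complex_of_real (pi ^ 3 / 32) - complex_of_real (pi\<^sup>2 / (32 * x)) *
          contour_integral (linepath 0 (complex_of_real q))
            (\<lambda>u. (ram_phi (- u) ^ 2 * ram_phi u ^ 4 - 1) / u))
   \<and> (let q = exp (- pi * x / 3); \<rho> = exp (2 * complex_of_real pi * \<i> / 3) in
        F14 x =
        25 * pi\<^sup>2 / (36 * x) *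
          Im (contour_integral (linepath 0 (\<rho> * complex_of_real q))
                (\<lambda>u. ram_phi u ^ 2 * ram_psi (u\<^sup>2) ^ 4)))
   \<and> (let q = exp (- pi * x / sqrt 8) in
        complex_of_real (F22 x) =
        complex_of_real (9 * pi\<^sup>2 / (32 * sqrt 2 * x)) *
          contour_integral (linepath 0 (complex_of_real q))
            (\<lambda>u. ram_phi (- (u\<^sup>2)) * ram_phi (u ^ 4) *
                 (3 * ram_psi (- (u\<^sup>2)) ^ 4 - ram_psi (u\<^sup>2) ^ 4)))"
proof -
  have norm_q: "norm (complex_of_real (exp (- pi * x / d))) < 1" if "d > 0" for d
    using assms that by simp
  have norm_\<rho>: "norm (exp (2 * complex_of_real pi * \<i> / 3)) = 1"
    by (simp add: norm_exp_eq_Re)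
  show ?thesis
    unfolding Let_def
  proof (intro conjI)
    show "lattice_F 1 1 1 (x\<^sup>2) / (3 + x\<^sup>2)\<^sup>2 =
        pi\<^sup>2 / (24 * sqrt 3 * x) *
          Im (contour_integral (linepath 0 (\<i> * complex_of_real (exp (- pi * x / sqrt 12))))
                (\<lambda>u. ram_f (- (u ^ 3)) ^ 9 / ram_f (- u) ^ 3))"
      unfolding lattice_F_eq_infsum[OF assms] lattice_13(2)[OF assms]
      using norm_q[of "sqrt 12"] by (subst integral_f) (simp_all add: norm_mult)
    show "complex_of_real (F12 x) =
        complex_of_real (pi ^ 3 / 32) - complex_of_real (pi\<^sup>2 / (32 * x)) *
          contour_integral (linepath 0 (complex_of_real (exp (- pi * x))))
            (\<lambda>u. (ram_phi (- u) ^ 2 * ram_phi u ^ 4 - 1) / u)"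
      unfolding lattice_12[OF assms] using norm_q[of 1] by (subst integral_phi2_phi4) simp_all
    show "F14 x =
        25 * pi\<^sup>2 / (36 * x) *
          Im (contour_integral (linepath 0 (exp (2 * complex_of_real pi * \<i> / 3) * complex_of_real (exp (- pi * x / 3))))
                (\<lambda>u. ram_phi u ^ 2 * ram_psi (u\<^sup>2) ^ 4))"
      unfolding lattice_14[OF assms] using norm_q[of 3] by (subst integral_phi2_psi4) (simp_all add: norm_mult norm_\<rho>)
    show "complex_of_real (F22 x) =
        complex_of_real (9 * pi\<^sup>2 / (32 * sqrt 2 * x)) *
          contour_integral (linepath 0 (complex_of_real (exp (- pi * x / sqrt 8))))
            (\<lambda>u. ram_phi (- (u\<^sup>2)) * ram_phi (u ^ 4) *
                 (3 * ram_psi (- (u\<^sup>2)) ^ 4 - ram_psi (u\<^sup>2) ^ 4))"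
      unfolding lattice_22[OF assms] using norm_q[of "sqrt 8"] by (subst integral_odd) simp_all
  qed
qed

end
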